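(* (1) Let $\Lambda_{\mathbb{M}}$ be a Borel probability measure on $\mathbb{M}^{ac}$ and $J$ a $\sigma$-finite Radon measure on $\mathbb{M}^{ac}\times\mathbb{M}^{ac}$ such that $\int[1\wedge\rho_{var}(\gamma,\eta)^2]\,dJ(\gamma,\eta)<\infty$ and $J\ll\Lambda_{\mathbb{M}}\times\Lambda_{\mathbb{M}}$. Then the bilinear form $$\mathcal{E}^J_{\mathbb{M}}(u,v)=\int_{\mathbb{M}^{ac}\times\mathbb{M}^{ac}}(u(\gamma)-u(\eta))(v(\gamma)-v(\eta))\,dJ(\gamma,\eta),\quad u,v\in C_b^{E,1}(\mathbb{M}),$$ is closable in $L^2(\mathbb{M}^{ac},\Lambda_{\mathbb{M}})$ and its closure is a quasi-regular Dirichlet form. (2) Let $\Lambda_{\mathscr{P}}$ be a Borel probability measure on $\mathscr{P}^{ac}$ and $J$ a $\sigma$-finite Radon measure on $\mathscr{P}^{ac}\times\mathscr{P}^{ac}$ such that $\int[1\wedge\rho_{var}(\gamma,\eta)^2]\,dJ(\gamma,\eta)<\infty$ and $J\ll\Lambda_{\mathscr{P}}\times\Lambda_{\mathscr{P}}$. Then $$\mathcal{E}^J_{\mathscr{P}}(u,v)=\int_{\mathscr{P}^{ac}\times\mathscr{P}^{ac}}(u(\gamma)-u(\eta))(v(\gamma)-v(\eta))\,dJ(\gamma,\eta),\quad u,v\in C_b^{E,1}(\mathscr{P}),$$ is closable in $L^2(\mathscr{P}^{ac},\Lambda_{\mathscr{P}})$ and its closure is a quasi-regular Dirichlet form.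
   Context: Let $(M,\rho)$ be a Polish space and $\lambda\ne0$ a $\sigma$-finite Radon measure on $M$. $\mathbb{M}$ ($\mathscr{P}$) is the set of finite (probability) Borel measures on $M$; $\mathbb{M}^{ac}$, $\mathscr{P}^{ac}$ are those absolutely continuous w.r.t. $\lambda$, with the total variation distance $\rho_{var}(\mu,\nu)=\lambda(|d\mu/d\lambda-d\nu/d\lambda|)$ (both are Polish). A continuous $u:\mathbb{M}\to\mathbb{R}$ has extrinsic derivative $D^Eu(\mu)(x)=\lim_{\varepsilon\downarrow0}\frac{u(\mu+\varepsilon\delta_x)-u(\mu)}{\varepsilon}$; $C^{E,1}_b(\mathbb{M})$ is the set of such $u$ for which this exists for all $(\mu,x)$, $D^Eu$ is continuous on $\mathbb{M}\times M$, and $\sup_{\mu,x}(|u(\mu)|+|D^Eu(\mu)(x)|)<\infty$. Analogously, for continuous $u:\mathscr{P}\to\mathbb{R}$, $\tilde D^Eu(\mu)(x)=\lim_{\varepsilon\downarrow0}\frac{u((1-\varepsilon)\mu+\varepsilon\delta_x)-u(\mu)}{\varepsilon}$, and $C^{E,1}_b(\mathscr{P})$ consists of $u$ with $\tilde D^Eu$ existing everywhere, continuous on $\mathscr{P}\times M$, and $\sup(|u|+|\tilde D^Eu|)<\infty$. Quasi-regularity: there exist a nest (increasing closed sets with 1-capacity of complements tending to 0) of compact sets, an $\mathcal{E}_1^{1/2}$-dense subspace of quasi-continuous functions, and a sequence of quasi-continuous domain functions separating points outside a capacity-zero set. *)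

theory Defs
  imports "HOL-Analysis.Analysis" "HOL-Probability.Probability"
begin

definition borel_of :: "'x topology \<Rightarrow> 'x measure" where
  "borel_of T = sigma (topspace T) {U. openin T U}"

definition radon_on :: "'x topology \<Rightarrow> 'x measure \<Rightarrow> bool" where
  "radon_on T \<mu> \<longleftrightarrow>
     space \<mu> = topspace T \<and> sets \<mu> = sets (borel_of T) \<and>
     (\<forall>x\<in>topspace T. \<exists>U. openin T U \<and> x \<in> U \<and> emeasure \<mu> U < \<infinity>) \<and>
     (\<forall>B\<in>sets \<mu>. emeasure \<mu> B = (SUP K\<in>{K. compactin T K \<and> K \<subseteq> B}. emeasure \<mu> K))"

text \<open>Elements of L^2(m) are represented by (measurable, square integrable) functions;
  everything below is invariant under m-a.e. modification.\<close>
definition L2 :: "'x measure \<Rightarrow> ('x \<Rightarrow> real) set" where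
  "L2 m = {f. f \<in> borel_measurable m \<and> integrable m (\<lambda>x. (f x)\<^sup>2)}"

definition L2dist :: "'x measure \<Rightarrow> ('x \<Rightarrow> real) \<Rightarrow> ('x \<Rightarrow> real) \<Rightarrow> real" where
  "L2dist m f g = sqrt (\<integral>x. (f x - g x)\<^sup>2 \<partial>m)"

definition diff_fun :: "('x \<Rightarrow> real) \<Rightarrow> ('x \<Rightarrow> real) \<Rightarrow> ('x \<Rightarrow> real)" where
  "diff_fun f g = (\<lambda>x. f x - g x)"

definition E1 :: "'x measure \<Rightarrow> (('x \<Rightarrow> real) \<Rightarrow> ('x \<Rightarrow> real) \<Rightarrow> real)
                   \<Rightarrow> ('x \<Rightarrow> real) \<Rightarrow> ('x \<Rightarrow> real) \<Rightarrow> real" where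
  "E1 m E f g = E f g + (\<integral>x. f x * g x \<partial>m)"

definition form_cauchy :: "(('x \<Rightarrow> real) \<Rightarrow> ('x \<Rightarrow> real) \<Rightarrow> real) \<Rightarrow> (nat \<Rightarrow> 'x \<Rightarrow> real) \<Rightarrow> bool" where
  "form_cauchy E u \<longleftrightarrow>
     (\<forall>e>0. \<exists>N. \<forall>n\<ge>N. \<forall>k\<ge>N. E (diff_fun (u n) (u k)) (diff_fun (u n) (u k)) < e)"

definition sym_form :: "'x measure \<Rightarrow> ('x \<Rightarrow> real) set
                        \<Rightarrow> (('x \<Rightarrow> real) \<Rightarrow> ('x \<Rightarrow> real) \<Rightarrow> real) \<Rightarrow> bool" where
  "sym_form m D E \<longleftrightarrow>
     D \<subseteq> L2 m \<and> (\<lambda>x. 0) \<in> D \<and>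
     (\<forall>u\<in>D. \<forall>v\<in>D. \<forall>a b::real. (\<lambda>x. a * u x + b * v x) \<in> D) \<and>
     (\<forall>u\<in>D. \<forall>v\<in>D. E u v = E v u) \<and>
     (\<forall>u\<in>D. \<forall>v\<in>D. \<forall>w\<in>D. \<forall>a b::real. E (\<lambda>x. a * u x + b * v x) w = a * E u w + b * E v w) \<and>
     (\<forall>u\<in>D. E u u \<ge> 0)"

definition closable_form :: "'x measure \<Rightarrow> ('x \<Rightarrow> real) set
                        \<Rightarrow> (('x \<Rightarrow> real) \<Rightarrow> ('x \<Rightarrow> real) \<Rightarrow> real) \<Rightarrow> bool" where
  "closable_form m D E \<longleftrightarrow> sym_form m D E \<and>
     (\<forall>u. (\<forall>n. u n \<in> D) \<and> (\<lambda>n. L2dist m (u n) (\<lambda>x. 0)) \<longlonglongrightarrow> 0 \<and> form_cauchy E u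
          \<longrightarrow> (\<lambda>n. E (u n) (u n)) \<longlonglongrightarrow> 0)"

definition approx_seq :: "'x measure \<Rightarrow> ('x \<Rightarrow> real) set \<Rightarrow> (('x \<Rightarrow> real) \<Rightarrow> ('x \<Rightarrow> real) \<Rightarrow> real)
                         \<Rightarrow> (nat \<Rightarrow> 'x \<Rightarrow> real) \<Rightarrow> ('x \<Rightarrow> real) \<Rightarrow> bool" where
  "approx_seq m D E u f \<longleftrightarrow>
     (\<forall>n. u n \<in> D) \<and> (\<lambda>n. L2dist m (u n) f) \<longlonglongrightarrow> 0 \<and> form_cauchy E u"

definition closure_dom :: "'x measure \<Rightarrow> ('x \<Rightarrow> real) set
                        \<Rightarrow> (('x \<Rightarrow> real) \<Rightarrow> ('x \<Rightarrow> real) \<Rightarrow> real) \<Rightarrow> ('x \<Rightarrow> real) set" where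
  "closure_dom m D E = {f \<in> L2 m. \<exists>u. approx_seq m D E u f}"

definition closure_form :: "'x measure \<Rightarrow> ('x \<Rightarrow> real) set
                        \<Rightarrow> (('x \<Rightarrow> real) \<Rightarrow> ('x \<Rightarrow> real) \<Rightarrow> real)
                        \<Rightarrow> ('x \<Rightarrow> real) \<Rightarrow> ('x \<Rightarrow> real) \<Rightarrow> real" where
  "closure_form m D E f g =
     (THE c. \<forall>u v. approx_seq m D E u f \<and> approx_seq m D E v g \<longrightarrow> (\<lambda>n. E (u n) (v n)) \<longlonglongrightarrow> c)"

definition dirichlet_form :: "'x measure \<Rightarrow> ('x \<Rightarrow> real) set
                        \<Rightarrow> (('x \<Rightarrow> real) \<Rightarrow> ('x \<Rightarrow> real) \<Rightarrow> real) \<Rightarrow> bool" where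
  "dirichlet_form m F E \<longleftrightarrow>
     sym_form m F E \<and>
     (\<forall>u\<in>F. \<forall>v\<in>L2 m. (AE x in m. u x = v x) \<longrightarrow> v \<in> F) \<and>
     (\<forall>u\<in>F. (AE x in m. u x = 0) \<longrightarrow> E u u = 0) \<and>
     (\<forall>f\<in>L2 m. \<forall>e>0. \<exists>g\<in>F. L2dist m f g < e) \<and>
     (\<forall>u. (\<forall>n. u n \<in> F) \<and> form_cauchy (E1 m E) u \<longrightarrow>
          (\<exists>f\<in>F. (\<lambda>n. E1 m E (diff_fun (u n) f) (diff_fun (u n) f)) \<longlonglongrightarrow> 0)) \<and>
     (\<forall>u\<in>F. (\<lambda>x. min 1 (max 0 (u x))) \<in> F \<and>
             E (\<lambda>x. min 1 (max 0 (u x))) (\<lambda>x. min 1 (max 0 (u x))) \<le> E u u)"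

definition cap1 :: "'x measure \<Rightarrow> 'x topology \<Rightarrow> ('x \<Rightarrow> real) set
                    \<Rightarrow> (('x \<Rightarrow> real) \<Rightarrow> ('x \<Rightarrow> real) \<Rightarrow> real) \<Rightarrow> 'x set \<Rightarrow> ennreal" where
  "cap1 m T F E A =
     (INF U\<in>{U. openin T U \<and> A \<subseteq> U}.
        (INF f\<in>{f \<in> F. AE x in m. x \<in> U \<longrightarrow> f x \<ge> 1}. ennreal (E1 m E f f)))"

definition nest :: "'x measure \<Rightarrow> 'x topology \<Rightarrow> ('x \<Rightarrow> real) set
                    \<Rightarrow> (('x \<Rightarrow> real) \<Rightarrow> ('x \<Rightarrow> real) \<Rightarrow> real) \<Rightarrow> (nat \<Rightarrow> 'x set) \<Rightarrow> bool" where
  "nest m T F E K \<longleftrightarrow> (\<forall>k. closedin T (K k)) \<and> incseq K \<and>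
     (\<lambda>k. cap1 m T F E (topspace T - K k)) \<longlonglongrightarrow> 0"

definition quasi_continuous :: "'x measure \<Rightarrow> 'x topology \<Rightarrow> ('x \<Rightarrow> real) set
                    \<Rightarrow> (('x \<Rightarrow> real) \<Rightarrow> ('x \<Rightarrow> real) \<Rightarrow> real) \<Rightarrow> ('x \<Rightarrow> real) \<Rightarrow> bool" where
  "quasi_continuous m T F E f \<longleftrightarrow>
     (\<exists>K. nest m T F E K \<and> (\<forall>k. continuous_map (subtopology T (K k)) euclideanreal f))"

definition has_qc_version :: "'x measure \<Rightarrow> 'x topology \<Rightarrow> ('x \<Rightarrow> real) set
                    \<Rightarrow> (('x \<Rightarrow> real) \<Rightarrow> ('x \<Rightarrow> real) \<Rightarrow> real) \<Rightarrow> ('x \<Rightarrow> real) \<Rightarrow> bool" where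
  "has_qc_version m T F E f \<longleftrightarrow> (\<exists>g. quasi_continuous m T F E g \<and> (AE x in m. g x = f x))"

definition quasi_regular :: "'x measure \<Rightarrow> 'x topology \<Rightarrow> ('x \<Rightarrow> real) set
                    \<Rightarrow> (('x \<Rightarrow> real) \<Rightarrow> ('x \<Rightarrow> real) \<Rightarrow> real) \<Rightarrow> bool" where
  "quasi_regular m T F E \<longleftrightarrow>
     (\<exists>K. nest m T F E K \<and> (\<forall>k. compactin T (K k))) \<and>
     (\<exists>D0 \<subseteq> F. (\<forall>f\<in>F. \<forall>e>0. \<exists>g\<in>D0. sqrt (E1 m E (diff_fun f g) (diff_fun f g)) < e) \<and>
               (\<forall>g\<in>D0. has_qc_version m T F E g)) \<and>
     (\<exists>(u::nat \<Rightarrow> 'x \<Rightarrow> real) v N. (\<forall>n. u n \<in> F \<and> quasi_continuous m T F E (v n) \<and> (AE x in m. v n x = u n x)) \<and>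
              N \<subseteq> topspace T \<and> cap1 m T F E N = 0 \<and>
              (\<forall>x\<in>topspace T - N. \<forall>y\<in>topspace T - N. x \<noteq> y \<longrightarrow> (\<exists>n. v n x \<noteq> v n y)))"

definition fin_measures :: "'a::topological_space measure set" where
  "fin_measures = {\<mu>. sets \<mu> = sets borel \<and> finite_measure \<mu>}"

definition prob_measures :: "'a::topological_space measure set" where
  "prob_measures = {\<mu>. sets \<mu> = sets borel \<and> prob_space \<mu>}"

definition ac_part :: "'a measure \<Rightarrow> 'a measure set \<Rightarrow> 'a measure set" where
  "ac_part lam S = {\<mu> \<in> S. absolutely_continuous lam \<mu>}"

definition rho_var :: "'a measure \<Rightarrow> 'a measure \<Rightarrow> 'a measure \<Rightarrow> real" where
  "rho_var lam \<mu> \<nu> =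
     (\<integral>x. \<bar>enn2real (RN_deriv lam \<mu> x) - enn2real (RN_deriv lam \<nu> x)\<bar> \<partial>lam)"

definition var_topology :: "'a measure \<Rightarrow> 'a measure set \<Rightarrow> 'a measure topology" where
  "var_topology lam S = Metric_space.mtopology S (rho_var lam)"

definition weak_topology :: "'a::topological_space measure set \<Rightarrow> 'a measure topology" where
  "weak_topology S = topology_generated_by
     {{\<mu> \<in> S. (\<integral>x. f x \<partial>\<mu>) \<in> V} | (f :: 'a \<Rightarrow> real) V.
        continuous_on UNIV f \<and> bounded (range f) \<and> open V}"

definition meas_add :: "'a measure \<Rightarrow> 'a measure \<Rightarrow> 'a measure" where
  "meas_add \<mu> \<nu> = measure_of (space \<mu>) (sets \<mu>) (\<lambda>A. emeasure \<mu> A + emeasure \<nu> A)"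

definition ext_quot :: "('a::topological_space measure \<Rightarrow> real) \<Rightarrow> 'a measure \<Rightarrow> 'a \<Rightarrow> real \<Rightarrow> real" where
  "ext_quot u \<mu> x \<epsilon> = (u (meas_add \<mu> (scale_measure (ennreal \<epsilon>) (return borel x))) - u \<mu>) / \<epsilon>"

definition DE :: "('a::topological_space measure \<Rightarrow> real) \<Rightarrow> 'a measure \<Rightarrow> 'a \<Rightarrow> real" where
  "DE u \<mu> x = Lim (at_right 0) (ext_quot u \<mu> x)"

definition ext_quot_P :: "('a::topological_space measure \<Rightarrow> real) \<Rightarrow> 'a measure \<Rightarrow> 'a \<Rightarrow> real \<Rightarrow> real" where
  "ext_quot_P u \<mu> x \<epsilon> =
     (u (meas_add (scale_measure (ennreal (1 - \<epsilon>)) \<mu>) (scale_measure (ennreal \<epsilon>) (return borel x))) - u \<mu>) / \<epsilon>"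

definition DE_P :: "('a::topological_space measure \<Rightarrow> real) \<Rightarrow> 'a measure \<Rightarrow> 'a \<Rightarrow> real" where
  "DE_P u \<mu> x = Lim (at_right 0) (ext_quot_P u \<mu> x)"

definition CE1b_M :: "('a::topological_space measure \<Rightarrow> real) set" where
  "CE1b_M = {u. continuous_map (weak_topology fin_measures) euclideanreal u \<and>
     (\<forall>\<mu>\<in>fin_measures. \<forall>x. \<exists>D. (ext_quot u \<mu> x \<longlongrightarrow> D) (at_right 0)) \<and>
     continuous_map (prod_topology (weak_topology fin_measures) euclidean) euclideanreal
        (\<lambda>(\<mu>, x). DE u \<mu> x) \<and>
     (\<exists>C. \<forall>\<mu>\<in>fin_measures. \<forall>x. \<bar>u \<mu>\<bar> + \<bar>DE u \<mu> x\<bar> \<le> C)}"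

definition CE1b_P :: "('a::topological_space measure \<Rightarrow> real) set" where
  "CE1b_P = {u. continuous_map (weak_topology prob_measures) euclideanreal u \<and>
     (\<forall>\<mu>\<in>prob_measures. \<forall>x. \<exists>D. (ext_quot_P u \<mu> x \<longlongrightarrow> D) (at_right 0)) \<and>
     continuous_map (prod_topology (weak_topology prob_measures) euclidean) euclideanreal
        (\<lambda>(\<mu>, x). DE_P u \<mu> x) \<and>
     (\<exists>C. \<forall>\<mu>\<in>prob_measures. \<forall>x. \<bar>u \<mu>\<bar> + \<bar>DE_P u \<mu> x\<bar> \<le> C)}"

definition jump_form :: "('b \<times> 'b) measure \<Rightarrow> ('b \<Rightarrow> real) \<Rightarrow> ('b \<Rightarrow> real) \<Rightarrow> real" where
  "jump_form J u v = (\<integral>p. (u (fst p) - u (snd p)) * (v (fst p) - v (snd p)) \<partial>J)"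

definition jump_hyps :: "'a measure \<Rightarrow> 'a measure set \<Rightarrow> 'a measure measure
                         \<Rightarrow> ('a measure \<times> 'a measure) measure \<Rightarrow> bool" where
  "jump_hyps lam S \<Lambda> J \<longleftrightarrow>
     prob_space \<Lambda> \<and> space \<Lambda> = S \<and> sets \<Lambda> = sets (borel_of (var_topology lam S)) \<and>
     sigma_finite_measure J \<and>
     radon_on (prod_topology (var_topology lam S) (var_topology lam S)) J \<and>
     (\<integral>\<^sup>+ p. ennreal (min 1 ((rho_var lam (fst p) (snd p))\<^sup>2)) \<partial>J) < \<infinity> \<and>
     null_sets (\<Lambda> \<Otimes>\<^sub>M \<Lambda>) \<subseteq> null_sets J"

end

theory Submission
  imports Defs
begin

text \<open>
  The form is the restriction of an \<open>L\<^sup>2(J)\<close>-norm of the difference map \<open>u(\<gamma>) - u(\<eta>)\<close>. Since \<open>J\<close> is absolutely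
  continuous with respect to \<open>\<Lambda> \<times> \<Lambda>\<close>, convergence \<open>\<Lambda>\<close>-a.e. passes to the differences \<open>J\<close>-a.e.; Fatou's lemma then
  gives closability, and the closure acts on its domain by the same integral.

  A function with bounded extrinsic derivative is Lipschitz in total variation: the bound holds along Dirac masses,
  hence for finitely supported increments, hence by weak continuity for all increments, and \<open>\<gamma>\<close>, \<open>\<eta>\<close> are both
  increments of their common part. On probability measures the same is applied to \<open>u(\<mu> / \<mu>(M))\<close>. Conversely
  \<open>min 1 (\<rho>(\<cdot>, \<nu>))\<close> is a countable supremum of clamped integrals, so it lies in the domain, and then so do all
  bounded Lipschitz functions: uniformly Lipschitz pointwise limits converge in the form norm because
  \<open>min 1 (\<rho>\<^sup>2)\<close> is \<open>J\<close>-integrable.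

  For a dense sequence \<open>y\<^sub>i\<close> the functions \<open>min\<^sub>i\<^sub>\<le>\<^sub>n (min 1 (\<rho>(\<cdot>, y\<^sub>i)))\<close> therefore tend to 0 in the form norm, and
  their sublevel sets produce a nest of compact sets.
\<close>

section \<open>Square-integrable jumps\<close>

text \<open>The obstacle: the core consists of functions continuous for weak convergence, whereas
  the topology, the nests and the jump hypothesis speak of the distance \<rho>, in general only a
  supremum of weakly continuous functions. Distances must therefore be reached by limits, and most
  of the work is done in the closure. Each of these limits stays in a class with one sup bound and
  Lipschitz constant C, so that 4 C^2 (1 \<and> \<rho>^2) dominates all squared jumps at once. The
  supremum is countable because one sequence of open sets approximates every Borel set for every
  finite measure. Density in L2 escapes this domination, as indicators have no Lipschitz bound; it
  is obtained by letting the jump measure vanish.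

  The derivative sees added mass only, so two measures are compared through a measure below both.
  For probability measures this common part has mass 1 - \<rho>/2, which can degenerate under
  normalisation; hence the mass threshold 1/2, with the sup bound taking over for \<rho> >
  1.\<close>

definition jmp :: "('x \<Rightarrow> real) \<Rightarrow> 'x \<times> 'x \<Rightarrow> real" where
  "jmp g p = g (fst p) - g (snd p)"

lemma jmp_simps [simp]:
  "jmp (\<lambda>x. 0) p = 0"
  "jmp (\<lambda>x. c) p = 0"
  "jmp (\<lambda>x. f x + g x) p = jmp f p + jmp g p"
  "jmp (\<lambda>x. f x - g x) p = jmp f p - jmp g p"
  "jmp (\<lambda>x. c * f x) p = c * jmp f p"
  by (simp_all add: jmp_def algebra_simps)

text \<open>The squared norm belonging to the form plus the L2 product. Values in
  \<open>ennreal\<close> make it meaningful for functions of infinite norm, so that Fatou, scaling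
  and the quasi-triangle inequality carry no integrability conditions.\<close>

definition energy :: "'x measure \<Rightarrow> ('x \<times> 'x) measure \<Rightarrow> ('x \<Rightarrow> real) \<Rightarrow> ennreal" where
  "energy m J g = (\<integral>\<^sup>+x. ennreal ((g x)\<^sup>2) \<partial>m) + (\<integral>\<^sup>+p. ennreal ((jmp g p)\<^sup>2) \<partial>J)"

text \<open>The closure of the core, described by approximation in energy instead of by Cauchy
  sequences; \<open>closure_dom_eq\<close> identifies it with \<open>closure_dom\<close>. Finite
  energy of the members is a consequence, see \<open>F_fin\<close>.\<close>

definition energy_closure :: "'x measure \<Rightarrow> ('x \<times> 'x) measure \<Rightarrow> ('x \<Rightarrow> real) set \<Rightarrow> ('x \<Rightarrow> real) set" where
  "energy_closure m J D =
     {f \<in> borel_measurable m. \<forall>e>0. \<exists>u\<in>D. energy m J (\<lambda>x. f x - u x) < ennreal e}"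

lemma sq_add_le: "(a + b)\<^sup>2 \<le> 2 * a\<^sup>2 + 2 * (b::real)\<^sup>2"
proof -
  have "0 \<le> (a - b)\<^sup>2" by simp
  then show ?thesis by (simp add: power2_eq_square algebra_simps)
qed

lemma integrable_mult_L2:
  fixes f g :: "'x \<Rightarrow> real"
  assumes [measurable]: "f \<in> borel_measurable M" "g \<in> borel_measurable M"
    and f: "integrable M (\<lambda>x. (f x)\<^sup>2)" and g: "integrable M (\<lambda>x. (g x)\<^sup>2)"
  shows "integrable M (\<lambda>x. f x * g x)"
proof (rule Bochner_Integration.integrable_bound[OF Bochner_Integration.integrable_add[OF f g]])
  have "\<bar>f x * g x\<bar> \<le> (f x)\<^sup>2 + (g x)\<^sup>2" for x
  proof -
    have "0 \<le> (\<bar>f x\<bar> - \<bar>g x\<bar>)\<^sup>2" by simp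
    then have "2 * \<bar>f x * g x\<bar> \<le> (f x)\<^sup>2 + (g x)\<^sup>2"
      by (simp add: power2_diff abs_mult)
    then show ?thesis by linarith
  qed
  then show "AE x in M. norm (f x * g x) \<le> norm ((f x)\<^sup>2 + (g x)\<^sup>2)"
    by (intro AE_I2) simp
qed simp

lemma integral_Cauchy_Schwarz:
  fixes f g :: "'x \<Rightarrow> real"
  assumes [measurable]: "f \<in> borel_measurable M" "g \<in> borel_measurable M"
    and f: "integrable M (\<lambda>x. (f x)\<^sup>2)" and g: "integrable M (\<lambda>x. (g x)\<^sup>2)"
  shows "\<bar>\<integral>x. f x * g x \<partial>M\<bar> \<le> sqrt (\<integral>x. (f x)\<^sup>2 \<partial>M) * sqrt (\<integral>x. (g x)\<^sup>2 \<partial>M)"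
proof -
  have i: "integrable M (\<lambda>x. \<bar>f x\<bar> * \<bar>g x\<bar>)"
    using integrable_mult_L2[OF assms] by (simp flip: abs_mult)
  have "(ennreal (\<integral>x. \<bar>f x\<bar> * \<bar>g x\<bar> \<partial>M))\<^sup>2 = (\<integral>\<^sup>+x. ennreal \<bar>f x\<bar> * ennreal \<bar>g x\<bar> \<partial>M)\<^sup>2"
    using i by (subst nn_integral_eq_integral[symmetric]) (auto simp: ennreal_mult)
  also have "\<dots> \<le> (\<integral>\<^sup>+x. ennreal \<bar>f x\<bar> ^ 2 \<partial>M) * (\<integral>\<^sup>+x. ennreal \<bar>g x\<bar> ^ 2 \<partial>M)"
    by (rule Cauchy_Schwarz_nn_integral) auto
  also have "\<dots> = ennreal ((\<integral>x. (f x)\<^sup>2 \<partial>M) * (\<integral>x. (g x)\<^sup>2 \<partial>M))"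
    using f g by (simp add: ennreal_power nn_integral_eq_integral ennreal_mult)
  finally have "(\<integral>x. \<bar>f x\<bar> * \<bar>g x\<bar> \<partial>M)\<^sup>2 \<le> (\<integral>x. (f x)\<^sup>2 \<partial>M) * (\<integral>x. (g x)\<^sup>2 \<partial>M)"
    by (simp add: ennreal_power ennreal_le_iff)
  then have "(\<integral>x. \<bar>f x\<bar> * \<bar>g x\<bar> \<partial>M) \<le> sqrt ((\<integral>x. (f x)\<^sup>2 \<partial>M) * (\<integral>x. (g x)\<^sup>2 \<partial>M))"
    by (rule real_le_rsqrt)
  moreover have "\<bar>\<integral>x. f x * g x \<partial>M\<bar> \<le> (\<integral>x. \<bar>f x\<bar> * \<bar>g x\<bar> \<partial>M)"
    using integral_abs_bound[of M "\<lambda>x. f x * g x"] by (simp add: abs_mult)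
  ultimately show ?thesis by (simp add: real_sqrt_mult)
qed

lemma nn_integral_Fatou_le:
  fixes u :: "nat \<Rightarrow> 'x \<Rightarrow> ennreal"
  assumes [measurable]: "\<And>n. u n \<in> borel_measurable M"
    and "AE x in M. (\<lambda>n. u n x) \<longlonglongrightarrow> v x"
  shows "(\<integral>\<^sup>+x. v x \<partial>M) \<le> liminf (\<lambda>n. \<integral>\<^sup>+x. u n x \<partial>M)"
proof -
  have "(\<integral>\<^sup>+x. v x \<partial>M) = (\<integral>\<^sup>+x. liminf (\<lambda>n. u n x) \<partial>M)"
    using assms(2) by (intro nn_integral_cong_AE) (auto dest!: lim_imp_Liminf[rotated])
  also have "\<dots> \<le> liminf (\<lambda>n. \<integral>\<^sup>+x. u n x \<partial>M)"
    by (rule nn_integral_liminf) simp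
  finally show ?thesis .
qed

text \<open>Fatou is applied to the two integrals of the energy separately. As the lower limit is
  superadditive, a bound on the sum of the integrals still bounds the sum of their lower
  limits.\<close>

lemma liminf_add_le_const:
  fixes a b :: "nat \<Rightarrow> ennreal"
  assumes "\<And>n. n \<ge> N \<Longrightarrow> a n + b n \<le> c"
  shows "liminf a + liminf b \<le> c"
proof -
  have "liminf a + liminf b = (SUP n. (INF k\<in>{n..}. a k) + (INF k\<in>{n..}. b k))"
    unfolding liminf_SUP_INF
    by (subst ennreal_SUP_add) (auto intro!: incseq_SucI INF_superset_mono)
  also have "\<dots> \<le> c"
  proof (rule SUP_least)
    fix n
    have "(INF k\<in>{n..}. a k) + (INF k\<in>{n..}. b k) \<le> a (max n N) + b (max n N)"
      by (intro add_mono INF_lower) auto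
    also have "\<dots> \<le> c" by (rule assms) simp
    finally show "(INF k\<in>{n..}. a k) + (INF k\<in>{n..}. b k) \<le> c" .
  qed
  finally show ?thesis .
qed

section \<open>Fatou, completeness and dominated convergence for the energy\<close>

locale jump_space = prob_space m for m :: "'x measure" +
  fixes J :: "('x \<times> 'x) measure"
  assumes fst_meas: "fst \<in> measurable J m"
    and snd_meas: "snd \<in> measurable J m"
    and null_J: "null_sets (m \<Otimes>\<^sub>M m) \<subseteq> null_sets J"
begin

text \<open>For a null set N the strips N \<times> space m and space m \<times> N are null for the
  product measure, hence for J. This is how absolute continuity of J does its work.\<close>

lemma AE_fst_snd:
  assumes "AE x in m. P x"
  shows "AE p in J. P (fst p) \<and> P (snd p)"
proof -
  obtain N where N: "N \<in> null_sets m" "{x \<in> space m. \<not> P x} \<subseteq> N"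
    using assms by (auto simp: eventually_ae_filter)
  have "N \<times> space m \<in> null_sets (m \<Otimes>\<^sub>M m)" "space m \<times> N \<in> null_sets (m \<Otimes>\<^sub>M m)"
    using N(1) by (auto simp: null_sets_def emeasure_pair_measure_Times)
  then have "N \<times> space m \<union> space m \<times> N \<in> null_sets J"
    using null_J by (blast intro: null_sets.Un)
  moreover have "{p \<in> space J. \<not> (P (fst p) \<and> P (snd p))} \<subseteq> N \<times> space m \<union> space m \<times> N"
  proof
    fix p assume p: "p \<in> {p \<in> space J. \<not> (P (fst p) \<and> P (snd p))}"
    then have "fst p \<in> space m" "snd p \<in> space m"
      using measurable_space[OF fst_meas, of p] measurable_space[OF snd_meas, of p] by auto
    then show "p \<in> N \<times> space m \<union> space m \<times> N"
      using p N(2) by (cases p) auto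
  qed
  ultimately show ?thesis by (rule AE_I')
qed

lemma jmp_meas [measurable]:
  assumes "g \<in> borel_measurable m"
  shows "jmp g \<in> borel_measurable J"
  unfolding jmp_def
  by (intro borel_measurable_diff measurable_compose[OF fst_meas assms] measurable_compose[OF snd_meas assms])

lemma energy_cong_AE:
  assumes "AE x in m. f x = g x"
  shows "energy m J f = energy m J g"
proof -
  have "AE p in J. f (fst p) = g (fst p) \<and> f (snd p) = g (snd p)"
    by (rule AE_fst_snd) fact
  then show ?thesis
    unfolding energy_def using assms
    by (intro arg_cong2[where f="(+)"] nn_integral_cong_AE) (auto simp: jmp_def)
qed

lemma energy_zero [simp]: "energy m J (\<lambda>x. 0) = 0"
  by (simp add: energy_def)

lemma energy_scale:
  assumes [measurable]: "f \<in> borel_measurable m"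
  shows "energy m J (\<lambda>x. c * f x) = ennreal (c\<^sup>2) * energy m J f"
proof -
  have "ennreal ((c * f x)\<^sup>2) = ennreal (c\<^sup>2) * ennreal ((f x)\<^sup>2)" for x
    by (simp add: power_mult_distrib ennreal_mult)
  moreover have "ennreal ((jmp (\<lambda>x. c * f x) p)\<^sup>2) = ennreal (c\<^sup>2) * ennreal ((jmp f p)\<^sup>2)" for p
    by (simp add: power_mult_distrib ennreal_mult)
  ultimately show ?thesis
    unfolding energy_def by (simp add: nn_integral_cmult distrib_left)
qed

lemma energy_add_le:
  assumes [measurable]: "f \<in> borel_measurable m" "g \<in> borel_measurable m"
  shows "energy m J (\<lambda>x. f x + g x) \<le> 2 * energy m J f + 2 * energy m J g"
proof -
  have *: "ennreal ((a + b)\<^sup>2) \<le> 2 * ennreal (a\<^sup>2) + 2 * ennreal (b\<^sup>2)" for a b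
  proof -
    have "ennreal ((a + b)\<^sup>2) \<le> ennreal (2 * a\<^sup>2 + 2 * b\<^sup>2)"
      by (intro ennreal_leI sq_add_le)
    also have "\<dots> = 2 * ennreal (a\<^sup>2) + 2 * ennreal (b\<^sup>2)"
      by (simp add: ennreal_plus ennreal_mult)
    finally show ?thesis .
  qed
  have "(\<integral>\<^sup>+x. ennreal ((f x + g x)\<^sup>2) \<partial>m) \<le> (\<integral>\<^sup>+x. 2 * ennreal ((f x)\<^sup>2) + 2 * ennreal ((g x)\<^sup>2) \<partial>m)"
    by (intro nn_integral_mono *)
  moreover have "(\<integral>\<^sup>+p. ennreal ((jmp (\<lambda>x. f x + g x) p)\<^sup>2) \<partial>J)
      \<le> (\<integral>\<^sup>+p. 2 * ennreal ((jmp f p)\<^sup>2) + 2 * ennreal ((jmp g p)\<^sup>2) \<partial>J)"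
    by (intro nn_integral_mono) (simp add: *)
  ultimately have "energy m J (\<lambda>x. f x + g x) \<le>
     (\<integral>\<^sup>+x. 2 * ennreal ((f x)\<^sup>2) + 2 * ennreal ((g x)\<^sup>2) \<partial>m) +
     (\<integral>\<^sup>+p. 2 * ennreal ((jmp f p)\<^sup>2) + 2 * ennreal ((jmp g p)\<^sup>2) \<partial>J)"
    unfolding energy_def by (rule add_mono)
  also have "\<dots> = 2 * energy m J f + 2 * energy m J g"
    unfolding energy_def by (simp add: nn_integral_add nn_integral_cmult distrib_left ac_simps)
  finally show ?thesis .
qed

lemma energy_minus: "energy m J (\<lambda>x. f x - g x) = energy m J (\<lambda>x. g x - f x)"
  unfolding energy_def
  by (intro arg_cong2[where f="(+)"] nn_integral_cong arg_cong[where f=ennreal])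
     (simp_all add: power2_commute)

lemma energy_triangle:
  assumes [measurable]: "f \<in> borel_measurable m" "g \<in> borel_measurable m" "h \<in> borel_measurable m"
  shows "energy m J (\<lambda>x. f x - h x) \<le> 2 * energy m J (\<lambda>x. f x - g x) + 2 * energy m J (\<lambda>x. g x - h x)"
  using energy_add_le[of "\<lambda>x. f x - g x" "\<lambda>x. g x - h x"] by simp

lemma energy_Fatou:
  assumes [measurable]: "\<And>n. u n \<in> borel_measurable m"
    and lim: "AE x in m. (\<lambda>n. u n x) \<longlonglongrightarrow> g x"
    and bnd: "\<And>n. n \<ge> N \<Longrightarrow> energy m J (u n) \<le> c"
  shows "energy m J g \<le> c"
proof -
  have J: "AE p in J. (\<lambda>n. u n (fst p)) \<longlonglongrightarrow> g (fst p) \<and> (\<lambda>n. u n (snd p)) \<longlonglongrightarrow> g (snd p)"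
    by (rule AE_fst_snd) fact
  have "energy m J g \<le> liminf (\<lambda>n. \<integral>\<^sup>+x. ennreal ((u n x)\<^sup>2) \<partial>m)
      + liminf (\<lambda>n. \<integral>\<^sup>+p. ennreal ((jmp (u n) p)\<^sup>2) \<partial>J)"
    unfolding energy_def
  proof (intro add_mono nn_integral_Fatou_le)
    show "AE x in m. (\<lambda>n. ennreal ((u n x)\<^sup>2)) \<longlonglongrightarrow> ennreal ((g x)\<^sup>2)"
      using lim by eventually_elim (intro tendsto_intros)
    show "AE p in J. (\<lambda>n. ennreal ((jmp (u n) p)\<^sup>2)) \<longlonglongrightarrow> ennreal ((jmp g p)\<^sup>2)"
      using J by eventually_elim (auto simp: jmp_def intro!: tendsto_intros)
  qed measurable
  also have "\<dots> \<le> c"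
    by (rule liminf_add_le_const) (use bnd in \<open>auto simp: energy_def\<close>)
  finally show ?thesis .
qed

text \<open>Cauchy-Schwarz against the constant 1, which has norm 1 since m is a probability
  measure. The passage to L1 makes the results on almost everywhere convergent subsequences
  available.\<close>

lemma integral_abs_less:
  assumes [measurable]: "h \<in> borel_measurable m" and e: "0 < e" and h: "energy m J h < ennreal (e\<^sup>2)"
  shows "(\<integral>x. \<bar>h x\<bar> \<partial>m) < e"
proof -
  have "(\<integral>\<^sup>+x. ennreal \<bar>h x\<bar> \<partial>m)\<^sup>2 \<le> (\<integral>\<^sup>+x. ennreal \<bar>h x\<bar> ^ 2 \<partial>m) * (\<integral>\<^sup>+x. 1 ^ 2 \<partial>m)"
    using Cauchy_Schwarz_nn_integral[of "\<lambda>x. ennreal \<bar>h x\<bar>" m "\<lambda>_. 1"] by simp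
  also have "\<dots> = (\<integral>\<^sup>+x. ennreal ((h x)\<^sup>2) \<partial>m)"
    by (simp add: ennreal_power emeasure_space_1)
  also have "\<dots> \<le> energy m J h" by (simp add: energy_def)
  also note h
  also have "ennreal (e\<^sup>2) = (ennreal e)\<^sup>2" using e by (simp add: ennreal_power)
  finally have "(\<integral>\<^sup>+x. ennreal \<bar>h x\<bar> \<partial>m) < ennreal e"
    using power_mono[of "ennreal e" "\<integral>\<^sup>+x. ennreal \<bar>h x\<bar> \<partial>m" 2] by (meson linorder_not_le zero_le)
  moreover have "(\<integral>x. \<bar>h x\<bar> \<partial>m) = enn2real (\<integral>\<^sup>+x. ennreal \<bar>h x\<bar> \<partial>m)"
    by (rule integral_eq_nn_integral) auto
  ultimately show ?thesis
    using e by (cases "\<integral>\<^sup>+x. ennreal \<bar>h x\<bar> \<partial>m") (auto simp: ennreal_less_iff)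
qed

lemma energy_finite:
  assumes [measurable]: "h \<in> borel_measurable m" and h: "energy m J h < \<infinity>"
  shows "integrable m (\<lambda>x. (h x)\<^sup>2)" "integrable J (\<lambda>p. (jmp h p)\<^sup>2)"
    "energy m J h = ennreal (jump_form J h h + (\<integral>x. (h x)\<^sup>2 \<partial>m))"
proof -
  have "(\<integral>\<^sup>+x. ennreal ((h x)\<^sup>2) \<partial>m) < \<infinity>" "(\<integral>\<^sup>+p. ennreal ((jmp h p)\<^sup>2) \<partial>J) < \<infinity>"
    using h by (auto simp: energy_def)
  then show a: "integrable m (\<lambda>x. (h x)\<^sup>2)" and b: "integrable J (\<lambda>p. (jmp h p)\<^sup>2)"
    by (auto intro!: integrableI_bounded)
  show "energy m J h = ennreal (jump_form J h h + (\<integral>x. (h x)\<^sup>2 \<partial>m))"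
    using a b by (simp add: energy_def jump_form_def jmp_def nn_integral_eq_integral ennreal_plus add.commute
      flip: power2_eq_square)
qed

text \<open>Riesz-Fischer argument: an energy-Cauchy sequence is L1-Cauchy, so a subsequence
  converges almost everywhere. Fatou along this subsequence, with n fixed, turns the Cauchy bound
  into convergence in energy.\<close>

lemma energy_complete:
  assumes [measurable]: "\<And>n. u n \<in> borel_measurable m" and fin: "\<And>n. energy m J (u n) < \<infinity>"
    and Cau: "\<And>e. e > 0 \<Longrightarrow> \<exists>N. \<forall>n\<ge>N. \<forall>k\<ge>N. energy m J (\<lambda>x. u n x - u k x) < e"
  obtains f r where "f \<in> borel_measurable m" "strict_mono r" "AE x in m. (\<lambda>i. u (r i) x) \<longlonglongrightarrow> f x"
    "(\<lambda>n. energy m J (\<lambda>x. u n x - f x)) \<longlonglongrightarrow> 0"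
proof -
  have int: "integrable m (u n)" for n
    by (rule square_integrable_imp_integrable) (auto intro: energy_finite fin)
  have "\<exists>N. \<forall>i\<ge>N. \<forall>j\<ge>N. (LINT x|m. norm (u i x - u j x)) < e" if e: "e > 0" for e
  proof -
    obtain N where "\<forall>n\<ge>N. \<forall>k\<ge>N. energy m J (\<lambda>x. u n x - u k x) < ennreal (e\<^sup>2)"
      using Cau[of "ennreal (e\<^sup>2)"] e by auto
    then show ?thesis
      using integral_abs_less[OF _ e] by (intro exI[of _ N]) auto
  qed
  then obtain r where r: "strict_mono r" "AE x in m. Cauchy (\<lambda>i. u (r i) x)"
    using cauchy_L1_AE_cauchy_subseq[of m u, OF int] by metis
  define f where "f x = lim (\<lambda>i. u (r i) x)" for x
  have f [measurable]: "f \<in> borel_measurable m"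
    unfolding f_def by (rule borel_measurable_lim_metric) simp
  have lim: "AE x in m. (\<lambda>i. u (r i) x) \<longlonglongrightarrow> f x"
    using r(2) by eventually_elim (auto simp: f_def Cauchy_convergent_iff convergent_LIMSEQ_iff)
  have "(\<lambda>n. energy m J (\<lambda>x. u n x - f x)) \<longlonglongrightarrow> 0"
  proof (rule order_tendstoI)
    fix e :: ennreal assume "0 < e"
    then obtain d where d: "0 < d" "d < e" using dense by blast
    obtain N where N: "\<And>n k. n \<ge> N \<Longrightarrow> k \<ge> N \<Longrightarrow> energy m J (\<lambda>x. u n x - u k x) < d"
      using Cau[OF d(1)] by blast
    have "energy m J (\<lambda>x. u n x - f x) < e" if "n \<ge> N" for n
    proof -
      have "energy m J (\<lambda>x. u n x - f x) \<le> d"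
      proof (rule energy_Fatou[of "\<lambda>k x. u n x - u (r k) x" _ N])
        show "AE x in m. (\<lambda>k. u n x - u (r k) x) \<longlonglongrightarrow> u n x - f x"
          using lim by eventually_elim (intro tendsto_intros)
        show "energy m J (\<lambda>x. u n x - u (r k) x) \<le> d" if "N \<le> k" for k
          using N[OF \<open>n \<ge> N\<close>, of "r k"] seq_suble[OF r(1), of k] that by (auto intro: less_imp_le)
      qed simp
      then show ?thesis using d by simp
    qed
    then show "\<forall>\<^sub>F n in sequentially. energy m J (\<lambda>x. u n x - f x) < e"
      by (auto simp: eventually_sequentially)
  qed simp
  then show ?thesis by (rule that[OF f r(1) lim])
qed

text \<open>Only the u n need majorants: the limit inherits them, and the squared differences are
  then dominated by (2 C)^2 for m and by 4 H for J.\<close>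

lemma energy_dominated:
  assumes [measurable]: "\<And>n. u n \<in> borel_measurable m" "g \<in> borel_measurable m" "H \<in> borel_measurable J"
    and lim: "AE x in m. (\<lambda>n. u n x) \<longlonglongrightarrow> g x"
    and bnd: "\<And>n. AE x in m. \<bar>u n x\<bar> \<le> C"
    and H: "\<And>n. AE p in J. ennreal ((jmp (u n) p)\<^sup>2) \<le> H p" "(\<integral>\<^sup>+p. H p \<partial>J) < \<infinity>"
  shows "(\<lambda>n. energy m J (\<lambda>x. g x - u n x)) \<longlonglongrightarrow> 0"
proof -
  have J: "AE p in J. (\<lambda>n. u n (fst p)) \<longlonglongrightarrow> g (fst p) \<and> (\<lambda>n. u n (snd p)) \<longlonglongrightarrow> g (snd p)"
    by (rule AE_fst_snd) fact
  have limJ: "AE p in J. (\<lambda>n. jmp (u n) p) \<longlonglongrightarrow> jmp g p"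
    using J by eventually_elim (auto simp: jmp_def intro: tendsto_intros)
  have gC: "AE x in m. \<bar>g x\<bar> \<le> C"
  proof -
    have "AE x in m. \<forall>n. \<bar>u n x\<bar> \<le> C" using bnd by (simp add: AE_all_countable)
    then show ?thesis using lim
    proof eventually_elim
      case (elim x)
      then show ?case by (intro LIMSEQ_le_const2[OF tendsto_rabs[OF elim(2)]]) auto
    qed
  qed
  have gH: "AE p in J. ennreal ((jmp g p)\<^sup>2) \<le> H p"
  proof -
    have "AE p in J. \<forall>n. ennreal ((jmp (u n) p)\<^sup>2) \<le> H p" using H(1) by (simp add: AE_all_countable)
    then show ?thesis using limJ
    proof eventually_elim
      case (elim p)
      have "(\<lambda>n. ennreal ((jmp (u n) p)\<^sup>2)) \<longlonglongrightarrow> ennreal ((jmp g p)\<^sup>2)"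
        by (intro tendsto_ennrealI tendsto_power elim(2))
      then show ?case by (rule LIMSEQ_le_const2) (use elim(1) in auto)
    qed
  qed
  have "(\<lambda>n. \<integral>\<^sup>+x. ennreal ((g x - u n x)\<^sup>2) \<partial>m) \<longlonglongrightarrow> (\<integral>\<^sup>+x. 0 \<partial>m)"
  proof (rule nn_integral_dominated_convergence[where w="\<lambda>x. ennreal ((2 * C)\<^sup>2)"])
    show "AE x in m. ennreal ((g x - u j x)\<^sup>2) \<le> ennreal ((2 * C)\<^sup>2)" for j
      using bnd[of j] gC
    proof eventually_elim
      case (elim x)
      then show ?case by (intro ennreal_leI abs_le_square_iff[THEN iffD1]) linarith
    qed
    show "AE x in m. (\<lambda>i. ennreal ((g x - u i x)\<^sup>2)) \<longlonglongrightarrow> 0"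
      using lim
    proof eventually_elim
      case (elim x)
      have "(\<lambda>i. ennreal ((g x - u i x)\<^sup>2)) \<longlonglongrightarrow> ennreal ((g x - g x)\<^sup>2)"
        by (intro tendsto_intros elim)
      then show ?case by simp
    qed
  qed (auto simp: emeasure_space_1)
  moreover have "(\<lambda>n. \<integral>\<^sup>+p. ennreal ((jmp (\<lambda>x. g x - u n x) p)\<^sup>2) \<partial>J) \<longlonglongrightarrow> (\<integral>\<^sup>+x. 0 \<partial>J)"
  proof (rule nn_integral_dominated_convergence[where w="\<lambda>p. 4 * H p"])
    show "AE p in J. ennreal ((jmp (\<lambda>x. g x - u j x) p)\<^sup>2) \<le> 4 * H p" for j
      using H(1)[of j] gH
    proof eventually_elim
      case (elim p)
      let ?a = "jmp g p" and ?b = "jmp (u j) p"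
      have "ennreal ((jmp (\<lambda>x. g x - u j x) p)\<^sup>2) = ennreal ((?a + - ?b)\<^sup>2)"
        by simp
      also have "\<dots> \<le> ennreal (2 * ?a\<^sup>2 + 2 * ?b\<^sup>2)"
        using sq_add_le[of ?a "- ?b"] by (intro ennreal_leI) simp
      also have "\<dots> = 2 * ennreal (?a\<^sup>2) + 2 * ennreal (?b\<^sup>2)"
        by (simp add: ennreal_plus ennreal_mult)
      also have "\<dots> \<le> 2 * H p + 2 * H p"
        using elim by (intro add_mono mult_left_mono) auto
      also have "\<dots> = 4 * H p" by (simp flip: distrib_right)
      finally show ?case .
    qed
    show "(\<integral>\<^sup>+p. 4 * H p \<partial>J) < \<infinity>"
      using H(2) by (simp add: nn_integral_cmult ennreal_mult_less_top)
    show "AE p in J. (\<lambda>i. ennreal ((jmp (\<lambda>x. g x - u i x) p)\<^sup>2)) \<longlonglongrightarrow> 0"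
      using limJ
    proof eventually_elim
      case (elim p)
      have "(\<lambda>i. ennreal ((jmp (\<lambda>x. g x - u i x) p)\<^sup>2))
         \<longlonglongrightarrow> ennreal ((jmp g p - jmp g p)\<^sup>2)"
        unfolding jmp_simps by (intro tendsto_intros elim)
      then show ?case by simp
    qed
  qed auto
  ultimately have "(\<lambda>n. energy m J (\<lambda>x. g x - u n x)) \<longlonglongrightarrow> (\<integral>\<^sup>+x. 0 \<partial>m) + (\<integral>\<^sup>+x. 0 \<partial>J)"
    unfolding energy_def by (rule tendsto_add)
  then show ?thesis by simp
qed

end

text \<open>Reverse triangle inequality in the plane for the points (a, sqrt e) and (b, sqrt e). It
  shows that smoothing the absolute value in this way enlarges no jump.\<close>

lemma sqrt_sq_add_contraction:
  assumes "0 \<le> e"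
  shows "\<bar>sqrt (a\<^sup>2 + e) - sqrt (b\<^sup>2 + e)\<bar> \<le> \<bar>a - b\<bar>"
proof (rule abs_le_square_iff[THEN iffD2])
  have "0 \<le> e * (a - b)\<^sup>2" using assms by simp
  then have "(a * b + e)\<^sup>2 \<le> (a\<^sup>2 + e) * (b\<^sup>2 + e)"
    by (simp add: power2_eq_square algebra_simps)
  then have "a * b + e \<le> sqrt ((a\<^sup>2 + e) * (b\<^sup>2 + e))" by (rule real_le_rsqrt)
  then show "(sqrt (a\<^sup>2 + e) - sqrt (b\<^sup>2 + e))\<^sup>2 \<le> (a - b)\<^sup>2"
    using assms by (simp add: power2_diff real_sqrt_mult)
qed

text \<open>The weight 1/8 fits \<open>energy_triangle\<close> and \<open>energy_add_le\<close>: two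
  errors, each doubled, sum to less than e/2.\<close>

lemma double_add_less:
  assumes "a < ennreal (e / 8)" "b < ennreal (e / 8)" "0 < e"
  shows "2 * a + 2 * b < ennreal e"
proof -
  have "2 * a + 2 * b \<le> 2 * ennreal (e / 8) + 2 * ennreal (e / 8)"
    using assms by (intro add_mono mult_left_mono) auto
  also have "\<dots> = ennreal (2 * (e / 8) + 2 * (e / 8))"
    using assms ennreal_plus[of "2 * (e / 8)" "2 * (e / 8)"] ennreal_mult[of 2 "e / 8"] by simp
  also have "\<dots> < ennreal e" using assms by (simp add: ennreal_less_iff)
  finally show ?thesis .
qed

section \<open>The bilinear jump form on functions of finite energy\<close>

context jump_space
begin

lemma tendsto_energy_iff:
  "(\<lambda>n. energy m J (h n)) \<longlonglongrightarrow> 0 \<longleftrightarrow> (\<forall>e>0. \<exists>N. \<forall>n\<ge>N. energy m J (h n) < ennreal e)"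
proof
  assume l: "(\<lambda>n. energy m J (h n)) \<longlonglongrightarrow> 0"
  show "\<forall>e>0. \<exists>N. \<forall>n\<ge>N. energy m J (h n) < ennreal e"
    using order_tendstoD(2)[OF l] by (auto simp: eventually_sequentially)
next
  assume r: "\<forall>e>0. \<exists>N. \<forall>n\<ge>N. energy m J (h n) < ennreal e"
  show "(\<lambda>n. energy m J (h n)) \<longlonglongrightarrow> 0"
  proof (rule order_tendstoI)
    fix e :: ennreal assume "0 < e"
    then obtain d where d: "0 < d" "d < e" using dense by blast
    then obtain x where x: "d = ennreal x" "0 < x"
      by (cases d) (auto simp: ennreal_zero_less_top top.not_eq_extremum)
    then obtain N where "\<forall>n\<ge>N. energy m J (h n) < d" using r by auto
    then show "\<forall>\<^sub>F n in sequentially. energy m J (h n) < e"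
      using d(2) by (auto simp: eventually_sequentially intro: less_trans)
  qed simp
qed

text \<open>The energy controls the L1 norm. \<open>F_abs\<close> needs the subsequence in order to
  apply dominated convergence to an approximation that is given only in energy.\<close>

lemma energy_AE_subseq:
  assumes [measurable]: "\<And>n. u n \<in> borel_measurable m" "f \<in> borel_measurable m"
    and fin: "\<And>n. energy m J (\<lambda>x. u n x - f x) < \<infinity>"
    and lim: "(\<lambda>n. energy m J (\<lambda>x. u n x - f x)) \<longlonglongrightarrow> 0"
  obtains r where "strict_mono r" "AE x in m. (\<lambda>i. u (r i) x) \<longlonglongrightarrow> f x"
proof -
  have int: "integrable m (\<lambda>x. u n x - f x)" for n
    by (rule square_integrable_imp_integrable) (auto intro: energy_finite fin)
  have "(\<lambda>n. \<integral>x. norm (u n x - f x) \<partial>m) \<longlonglongrightarrow> 0"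
  proof (rule LIMSEQ_I)
    fix e :: real assume e: "0 < e"
    then obtain N where "\<forall>n\<ge>N. energy m J (\<lambda>x. u n x - f x) < ennreal (e\<^sup>2)"
      using lim[unfolded tendsto_energy_iff, rule_format, of "e\<^sup>2"] by auto
    then show "\<exists>N. \<forall>n\<ge>N. norm ((\<integral>x. norm (u n x - f x) \<partial>m) - 0) < e"
      using integral_abs_less[OF _ e] by (intro exI[of _ N]) auto
  qed
  then obtain r where r: "strict_mono r" "AE x in m. (\<lambda>n. u (r n) x - f x) \<longlonglongrightarrow> 0"
    using tendsto_L1_AE_subseq[of m "\<lambda>n x. u n x - f x", OF int] by auto
  have "AE x in m. (\<lambda>i. u (r i) x) \<longlonglongrightarrow> f x"
    using r(2) by (simp add: LIM_zero_iff)
  with r(1) show ?thesis by (rule that)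
qed

lemma finite_energy_add:
  assumes "f \<in> borel_measurable m" "g \<in> borel_measurable m" "energy m J f < \<infinity>" "energy m J g < \<infinity>"
  shows "energy m J (\<lambda>x. f x + g x) < \<infinity>"
  using energy_add_le[OF assms(1,2)] assms(3,4) by (simp add: ennreal_mult_less_top le_less_trans)

lemma finite_energy_scale:
  assumes "f \<in> borel_measurable m" "energy m J f < \<infinity>"
  shows "energy m J (\<lambda>x. c * f x) < \<infinity>"
  using energy_scale[OF assms(1), of c] assms(2) by (simp add: ennreal_mult_less_top)

lemma finite_energy_diff:
  assumes "f \<in> borel_measurable m" "g \<in> borel_measurable m" "energy m J f < \<infinity>" "energy m J g < \<infinity>"
  shows "energy m J (\<lambda>x. f x - g x) < \<infinity>"
  using finite_energy_add[OF assms(1) _ assms(3) finite_energy_scale[OF assms(2,4), of "-1"]] assms(2) by simp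

lemma jump_form_jmp: "jump_form J u v = (\<integral>p. jmp u p * jmp v p \<partial>J)"
  by (simp add: jump_form_def jmp_def)

lemma integrable_jmp_mult:
  assumes [measurable]: "f \<in> borel_measurable m" "g \<in> borel_measurable m"
    and "energy m J f < \<infinity>" "energy m J g < \<infinity>"
  shows "integrable J (\<lambda>p. jmp f p * jmp g p)"
  by (rule integrable_mult_L2) (use assms energy_finite in auto)

lemma jump_form_linear:
  assumes [measurable]: "f \<in> borel_measurable m" "g \<in> borel_measurable m" "h \<in> borel_measurable m"
    and fin: "energy m J f < \<infinity>" "energy m J g < \<infinity>" "energy m J h < \<infinity>"
  shows "jump_form J (\<lambda>x. a * f x + b * g x) h = a * jump_form J f h + b * jump_form J g h"
proof -
  have "jump_form J (\<lambda>x. a * f x + b * g x) h = (\<integral>p. a * (jmp f p * jmp h p) + b * (jmp g p * jmp h p) \<partial>J)"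
    by (simp add: jump_form_jmp algebra_simps)
  also have "\<dots> = a * jump_form J f h + b * jump_form J g h"
    using integrable_jmp_mult[of f h] integrable_jmp_mult[of g h] fin
    by (subst Bochner_Integration.integral_add) (auto simp: jump_form_jmp)
  finally show ?thesis .
qed

lemma jump_form_commute: "jump_form J f g = jump_form J g f"
  by (simp add: jump_form_def mult.commute)

lemma jump_form_nonneg: "0 \<le> jump_form J f f"
  by (simp add: jump_form_def)

lemma jump_form_le_energy:
  assumes "f \<in> borel_measurable m" "energy m J f < \<infinity>"
  shows "jump_form J f f \<le> enn2real (energy m J f)"
  using energy_finite(3)[OF assms] jump_form_nonneg[of f] by (simp del: ennreal_plus)

lemma jump_form_Cauchy_Schwarz:
  assumes [measurable]: "f \<in> borel_measurable m" "g \<in> borel_measurable m"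
    and fin: "energy m J f < \<infinity>" "energy m J g < \<infinity>"
  shows "\<bar>jump_form J f g\<bar> \<le> sqrt (enn2real (energy m J f)) * sqrt (enn2real (energy m J g))"
proof -
  have "\<bar>jump_form J f g\<bar> \<le> sqrt (jump_form J f f) * sqrt (jump_form J g g)"
    using integral_Cauchy_Schwarz[of "jmp f" J "jmp g"] energy_finite(2) fin
    by (simp add: jump_form_jmp power2_eq_square)
  also have "\<dots> \<le> sqrt (enn2real (energy m J f)) * sqrt (enn2real (energy m J g))"
    using fin by (intro mult_mono real_sqrt_le_mono jump_form_le_energy) (auto simp: jump_form_nonneg)
  finally show ?thesis .
qed

lemma jump_form_tendsto:
  assumes [measurable]: "\<And>n. u n \<in> borel_measurable m" "\<And>n. v n \<in> borel_measurable m"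
      "f \<in> borel_measurable m" "g \<in> borel_measurable m"
    and fin: "\<And>n. energy m J (u n) < \<infinity>" "\<And>n. energy m J (v n) < \<infinity>" "energy m J f < \<infinity>" "energy m J g < \<infinity>"
    and u: "(\<lambda>n. energy m J (\<lambda>x. u n x - f x)) \<longlonglongrightarrow> 0"
    and v: "(\<lambda>n. energy m J (\<lambda>x. v n x - g x)) \<longlonglongrightarrow> 0"
  shows "(\<lambda>n. jump_form J (u n) (v n)) \<longlonglongrightarrow> jump_form J f g"
proof -
  define N where "N h = sqrt (enn2real (energy m J h))" for h
  let ?a = "\<lambda>n x. u n x - f x" and ?b = "\<lambda>n x. v n x - g x"
  have fa: "energy m J (?a n) < \<infinity>" and fb: "energy m J (?b n) < \<infinity>" for n
    by (intro finite_energy_diff fin; simp)+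
  have "(\<lambda>n. enn2real (energy m J (?a n))) \<longlonglongrightarrow> enn2real 0" "(\<lambda>n. enn2real (energy m J (?b n))) \<longlonglongrightarrow> enn2real 0"
    using u v by (auto intro!: tendsto_enn2real)
  from this[THEN tendsto_real_sqrt]
  have "(\<lambda>n. N (?a n)) \<longlonglongrightarrow> sqrt (enn2real 0)" "(\<lambda>n. N (?b n)) \<longlonglongrightarrow> sqrt (enn2real 0)"
    unfolding N_def .
  then have Na: "(\<lambda>n. N (?a n)) \<longlonglongrightarrow> 0" and Nb: "(\<lambda>n. N (?b n)) \<longlonglongrightarrow> 0" by simp_all
  have ab: "(\<lambda>n. N (?a n) * N (?b n) + N f * N (?b n) + N (?a n) * N g) \<longlonglongrightarrow> 0 * 0 + N f * 0 + 0 * N g"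
    by (intro tendsto_intros Na Nb)
  have le: "norm (jump_form J (u n) (v n) - jump_form J f g) \<le> N (?a n) * N (?b n) + N f * N (?b n) + N (?a n) * N g" for n
  proof -
    have i: "integrable J (\<lambda>p. jmp (?a n) p * jmp (?b n) p)" "integrable J (\<lambda>p. jmp f p * jmp (?b n) p)"
       "integrable J (\<lambda>p. jmp (?a n) p * jmp g p)" "integrable J (\<lambda>p. jmp f p * jmp g p)"
      "integrable J (\<lambda>p. jmp (u n) p * jmp (v n) p)"
      by (rule integrable_jmp_mult; use fa fb fin in simp)+
    have "jump_form J (u n) (v n) - jump_form J f g = (\<integral>p. jmp (u n) p * jmp (v n) p - jmp f p * jmp g p \<partial>J)"
      using i by (simp add: jump_form_jmp)
    \<comment> \<open>With a = u n - f and b = v n - g the identity is (f + a)(g + b) - f g = a b +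
      f b + a g for the jumps; each term tends to 0 by Cauchy-Schwarz.\<close>
    also have "\<dots> = (\<integral>p. jmp (?a n) p * jmp (?b n) p + jmp f p * jmp (?b n) p + jmp (?a n) p * jmp g p \<partial>J)"
      by (intro Bochner_Integration.integral_cong) (simp_all add: algebra_simps)
    also have "\<dots> = jump_form J (?a n) (?b n) + jump_form J f (?b n) + jump_form J (?a n) g"
      unfolding jump_form_jmp
      by (intro trans[OF Bochner_Integration.integral_add] arg_cong2[where f="(+)"] Bochner_Integration.integrable_add i refl)
    finally show ?thesis
      using jump_form_Cauchy_Schwarz[of "?a n" "?b n"] jump_form_Cauchy_Schwarz[of f "?b n"]
        jump_form_Cauchy_Schwarz[of "?a n" g] fa fb fin
      unfolding N_def by simp
  qed
  have "(\<lambda>n. jump_form J (u n) (v n) - jump_form J f g) \<longlonglongrightarrow> 0"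
    by (rule Lim_null_comparison[OF always_eventually[OF allI[OF le]]]) (use ab in simp)
  then show ?thesis by (simp add: LIM_zero_iff)
qed

end

section \<open>The energy closure is a vector lattice\<close>

locale jump_core = jump_space +
  fixes D :: "('a \<Rightarrow> real) set"
  assumes D_meas: "u \<in> D \<Longrightarrow> u \<in> borel_measurable m"
    and D_fin: "u \<in> D \<Longrightarrow> energy m J u < \<infinity>"
    and D_bdd: "u \<in> D \<Longrightarrow> \<exists>C. \<forall>x\<in>space m. \<bar>u x\<bar> \<le> C"
    and D_lin: "u \<in> D \<Longrightarrow> v \<in> D \<Longrightarrow> (\<lambda>x. a * u x + b * v x) \<in> D"
    and D_const: "(\<lambda>x. c) \<in> D"
    and D_sqrt: "u \<in> D \<Longrightarrow> 0 < e \<Longrightarrow> (\<lambda>x. sqrt ((u x)\<^sup>2 + e)) \<in> D"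
begin

abbreviation "F \<equiv> energy_closure m J D"

lemma F_meas: "f \<in> F \<Longrightarrow> f \<in> borel_measurable m"
  by (simp add: energy_closure_def)

lemma F_approx: "f \<in> F \<Longrightarrow> 0 < e \<Longrightarrow> \<exists>u\<in>D. energy m J (\<lambda>x. f x - u x) < ennreal e"
  by (simp add: energy_closure_def)

lemma D_subset_F: "u \<in> D \<Longrightarrow> u \<in> F"
  using D_meas by (auto simp: energy_closure_def intro!: bexI[of _ u])

lemma F_fin:
  assumes f: "f \<in> F" shows "energy m J f < \<infinity>"
proof -
  obtain u where u: "u \<in> D" "energy m J (\<lambda>x. f x - u x) < ennreal 1"
    using F_approx[OF f, of 1] by auto
  then have "energy m J (\<lambda>x. (f x - u x) + u x) < \<infinity>"
    using F_meas[OF f] D_meas[OF u(1)] D_fin[OF u(1)]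
    by (intro finite_energy_add) (auto intro: less_trans[OF _ ennreal_less_top[of 1]])
  then show ?thesis by simp
qed

lemma F_closed:
  assumes f [measurable]: "f \<in> borel_measurable m"
    and *: "\<And>e. 0 < e \<Longrightarrow> \<exists>g\<in>F. energy m J (\<lambda>x. f x - g x) < ennreal e"
  shows "f \<in> F"
  unfolding energy_closure_def
proof (intro CollectI conjI f allI impI)
  fix e :: real assume e: "0 < e"
  obtain g where g: "g \<in> F" "energy m J (\<lambda>x. f x - g x) < ennreal (e / 8)"
    using *[of "e / 8"] e by auto
  obtain u where u: "u \<in> D" "energy m J (\<lambda>x. g x - u x) < ennreal (e / 8)"
    using F_approx[OF g(1), of "e / 8"] e by auto
  have "energy m J (\<lambda>x. f x - u x) \<le> 2 * energy m J (\<lambda>x. f x - g x) + 2 * energy m J (\<lambda>x. g x - u x)"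
    by (intro energy_triangle f F_meas g D_meas u)
  also have "\<dots> < ennreal e" by (intro double_add_less g u e)
  finally show "\<exists>u\<in>D. energy m J (\<lambda>x. f x - u x) < ennreal e" using u(1) by blast
qed

lemma F_closed_lim:
  assumes "f \<in> borel_measurable m" "\<And>n. g n \<in> F" "(\<lambda>n. energy m J (\<lambda>x. f x - g n x)) \<longlonglongrightarrow> 0"
  shows "f \<in> F"
proof (rule F_closed[OF assms(1)])
  fix e :: real assume "0 < e"
  then obtain N where "\<forall>n\<ge>N. energy m J (\<lambda>x. f x - g n x) < ennreal e"
    using assms(3) unfolding tendsto_energy_iff by blast
  then show "\<exists>g\<in>F. energy m J (\<lambda>x. f x - g x) < ennreal e" using assms(2) by blast
qed

lemma F_cong_AE:
  assumes f: "f \<in> F" and g: "g \<in> borel_measurable m" and fg: "AE x in m. f x = g x"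
  shows "g \<in> F"
proof (rule F_closed[OF g])
  fix e :: real assume "0 < e"
  have "energy m J (\<lambda>x. g x - f x) = energy m J (\<lambda>x. 0)"
    by (rule energy_cong_AE) (use fg in auto)
  then show "\<exists>h\<in>F. energy m J (\<lambda>x. g x - h x) < ennreal e"
    using f \<open>0 < e\<close> by (intro bexI[of _ f]) auto
qed

lemma F_add:
  assumes f: "f \<in> F" and g: "g \<in> F" shows "(\<lambda>x. f x + g x) \<in> F"
proof -
  note [measurable] = F_meas[OF f] F_meas[OF g]
  show ?thesis
  proof (rule F_closed)
    fix e :: real assume e: "0 < e"
    obtain u where u: "u \<in> D" "energy m J (\<lambda>x. f x - u x) < ennreal (e / 8)"
      using F_approx[OF f, of "e / 8"] e by auto
    obtain v where v: "v \<in> D" "energy m J (\<lambda>x. g x - v x) < ennreal (e / 8)"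
      using F_approx[OF g, of "e / 8"] e by auto
    note [measurable] = D_meas[OF u(1)] D_meas[OF v(1)]
    have "energy m J (\<lambda>x. f x + g x - (u x + v x)) = energy m J (\<lambda>x. (f x - u x) + (g x - v x))"
      by (simp add: algebra_simps)
    also have "\<dots> \<le> 2 * energy m J (\<lambda>x. f x - u x) + 2 * energy m J (\<lambda>x. g x - v x)"
      by (rule energy_add_le) simp_all
    also have "\<dots> < ennreal e" by (intro double_add_less u v e)
    finally show "\<exists>h\<in>F. energy m J (\<lambda>x. f x + g x - h x) < ennreal e"
      using D_subset_F[OF D_lin[OF u(1) v(1), of 1 1]] by (intro bexI[of _ "\<lambda>x. u x + v x"]) auto
  qed simp
qed

lemma F_const: "(\<lambda>x. c) \<in> F"
  by (rule D_subset_F[OF D_const])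

lemma F_scale:
  assumes f: "f \<in> F" shows "(\<lambda>x. c * f x) \<in> F"
proof -
  note [measurable] = F_meas[OF f]
  show ?thesis
  proof (cases "c = 0")
    case True then show ?thesis using F_const[of 0] by simp
  next
    case False
    show ?thesis
    proof (rule F_closed)
      fix e :: real assume e: "0 < e"
      obtain u where u: "u \<in> D" "energy m J (\<lambda>x. f x - u x) < ennreal (e / c\<^sup>2)"
        using F_approx[OF f, of "e / c\<^sup>2"] e False by auto
      note [measurable] = D_meas[OF u(1)]
      have "energy m J (\<lambda>x. c * f x - c * u x) = ennreal (c\<^sup>2) * energy m J (\<lambda>x. f x - u x)"
        using energy_scale[of "\<lambda>x. f x - u x" c] by (simp add: algebra_simps)
      also have "\<dots> < ennreal (c\<^sup>2) * ennreal (e / c\<^sup>2)"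
        using u False by (intro ennreal_mult_strict_left_mono) auto
      also have "\<dots> = ennreal e" using e False by (simp add: ennreal_mult[symmetric])
      finally show "\<exists>h\<in>F. energy m J (\<lambda>x. c * f x - h x) < ennreal e"
        using D_subset_F[OF D_lin[OF u(1) u(1), of c 0]] by (intro bexI[of _ "\<lambda>x. c * u x"]) auto
    qed simp
  qed
qed

lemma F_diff: "f \<in> F \<Longrightarrow> g \<in> F \<Longrightarrow> (\<lambda>x. f x - g x) \<in> F"
  using F_add[of f "\<lambda>x. -1 * g x"] F_scale[of g "-1"] by simp

lemma F_dominated:
  assumes u: "\<And>n. u n \<in> F" and [measurable]: "g \<in> borel_measurable m" "H \<in> borel_measurable J"
    and "AE x in m. (\<lambda>n. u n x) \<longlonglongrightarrow> g x"
    and "\<And>n. AE x in m. \<bar>u n x\<bar> \<le> C"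
    and "\<And>n. AE p in J. ennreal ((jmp (u n) p)\<^sup>2) \<le> H p" "(\<integral>\<^sup>+p. H p \<partial>J) < \<infinity>"
  shows "g \<in> F"
  by (rule F_closed_lim[OF assms(2) u energy_dominated[OF F_meas[OF u] assms(2-7)]])

text \<open>The core is closed under u |-> sqrt(u^2 + e) but need not contain absolute values. For e
  = 1/(n + 1) these functions tend to the absolute value, and by the contraction property the jumps
  of u dominate theirs.\<close>

lemma D_abs:
  assumes u: "u \<in> D" shows "(\<lambda>x. \<bar>u x\<bar>) \<in> F"
proof -
  note [measurable] = D_meas[OF u]
  obtain C where C: "\<And>x. x \<in> space m \<Longrightarrow> \<bar>u x\<bar> \<le> C" using D_bdd[OF u] by blast
  show ?thesis
  proof (rule F_dominated[where u="\<lambda>n x. sqrt ((u x)\<^sup>2 + 1 / Suc n)" and H="\<lambda>p. ennreal ((jmp u p)\<^sup>2)" and C="C + 1"])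
    show "(\<lambda>x. sqrt ((u x)\<^sup>2 + 1 / Suc n)) \<in> F" for n
      by (intro D_subset_F D_sqrt u) simp
    show "AE x in m. (\<lambda>n. sqrt ((u x)\<^sup>2 + 1 / Suc n)) \<longlonglongrightarrow> \<bar>u x\<bar>"
    proof (rule AE_I2)
      fix x
      have "(\<lambda>n. sqrt ((u x)\<^sup>2 + 1 / Suc n)) \<longlonglongrightarrow> sqrt ((u x)\<^sup>2 + 0)"
        using LIMSEQ_inverse_real_of_nat by (intro tendsto_intros) (simp add: inverse_eq_divide)
      then show "(\<lambda>n. sqrt ((u x)\<^sup>2 + 1 / Suc n)) \<longlonglongrightarrow> \<bar>u x\<bar>" by simp
    qed
    show "AE x in m. \<bar>sqrt ((u x)\<^sup>2 + 1 / Suc n)\<bar> \<le> C + 1" for n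
    proof (rule AE_I2)
      fix x assume "x \<in> space m"
      have "sqrt ((u x)\<^sup>2 + 1 / Suc n) \<le> sqrt ((u x)\<^sup>2) + sqrt (1 / Suc n)"
        by (intro sqrt_add_le_add_sqrt) auto
      also have "\<dots> \<le> C + 1"
        using C[OF \<open>x \<in> space m\<close>] by (intro add_mono) auto
      finally show "\<bar>sqrt ((u x)\<^sup>2 + 1 / Suc n)\<bar> \<le> C + 1" by simp
    qed
    show "AE p in J. ennreal ((jmp (\<lambda>x. sqrt ((u x)\<^sup>2 + 1 / Suc n)) p)\<^sup>2) \<le> ennreal ((jmp u p)\<^sup>2)" for n
      by (intro AE_I2 ennreal_leI abs_le_square_iff[THEN iffD1])
         (simp add: jmp_def sqrt_sq_add_contraction)
    show "(\<integral>\<^sup>+p. ennreal ((jmp u p)\<^sup>2) \<partial>J) < \<infinity>"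
      using D_fin[OF u] by (simp add: energy_def)
  qed simp_all
qed

lemma F_seq:
  assumes f: "f \<in> F"
  obtains u where "\<And>n. u n \<in> D" "(\<lambda>n. energy m J (\<lambda>x. u n x - f x)) \<longlonglongrightarrow> 0"
proof -
  have "\<exists>u\<in>D. energy m J (\<lambda>x. f x - u x) < ennreal (1 / Suc n)" for n
    by (rule F_approx[OF f]) simp
  then obtain u where u: "\<And>n. u n \<in> D" "\<And>n. energy m J (\<lambda>x. f x - u n x) < ennreal (1 / Suc n)"
    by metis
  have "(\<lambda>n. energy m J (\<lambda>x. u n x - f x)) \<longlonglongrightarrow> 0"
    unfolding tendsto_energy_iff
  proof (intro allI impI)
    fix e :: real assume "0 < e"
    then obtain N where N: "1 / Suc N < e" using nat_approx_posE by metis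
    have "energy m J (\<lambda>x. u n x - f x) < ennreal e" if "n \<ge> N" for n
    proof -
      have "energy m J (\<lambda>x. u n x - f x) < ennreal (1 / Suc n)"
        using u(2)[of n] by (simp add: energy_minus[of "u n"])
      also have "\<dots> \<le> ennreal e"
      proof (rule ennreal_leI)
        have "1 / Suc n \<le> 1 / Suc N" using that by (intro divide_left_mono) auto
        then show "1 / Suc n \<le> e" using N by simp
      qed
      finally show ?thesis .
    qed
    then show "\<exists>N. \<forall>n\<ge>N. energy m J (\<lambda>x. u n x - f x) < ennreal e" by blast
  qed
  then show ?thesis by (rule that[OF u(1)])
qed

text \<open>Taking absolute values contracts the jumps of a single function but not those of a
  difference: even if f - u is constant, |f| - |u| may jump. So |u n| \<rightarrow> |f| in energy
  does not follow directly from u n \<rightarrow> f; it takes almost everywhere convergence and a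
  domination argument.\<close>

lemma F_abs:
  assumes f: "f \<in> F" shows "(\<lambda>x. \<bar>f x\<bar>) \<in> F"
proof -
  note [measurable] = F_meas[OF f]
  obtain w where w: "\<And>n. w n \<in> D" "(\<lambda>n. energy m J (\<lambda>x. w n x - f x)) \<longlonglongrightarrow> 0"
    using F_seq[OF f] by metis
  have wf: "energy m J (\<lambda>x. w n x - f x) < \<infinity>" for n
    by (intro finite_energy_diff D_meas D_fin w F_meas F_fin f)
  obtain r where r: "strict_mono r" "AE x in m. (\<lambda>i. w (r i) x) \<longlonglongrightarrow> f x"
    by (rule energy_AE_subseq[OF D_meas[OF w(1)] F_meas[OF f] wf w(2)])
  define u where "u n = w (r n)" for n
  have u: "u n \<in> D" for n by (simp add: u_def w)
  have ulim: "(\<lambda>n. energy m J (\<lambda>x. u n x - f x)) \<longlonglongrightarrow> 0"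
    using LIMSEQ_subseq_LIMSEQ[OF w(2) r(1)] by (simp add: u_def comp_def)
  have AEu: "AE x in m. (\<lambda>i. u i x) \<longlonglongrightarrow> f x" using r(2) by (simp add: u_def)
  have [measurable]: "u n \<in> borel_measurable m" for n by (intro D_meas u)
  \<comment> \<open>No fixed function dominates \<open>a n\<close>, but its excess over \<open>b n\<close> (which tends to 0 in \<open>L\<^sup>1\<close>) is dominated.\<close>
  define a where "a n p = (jmp (\<lambda>x. \<bar>f x\<bar> - \<bar>u n x\<bar>) p)\<^sup>2" for n p
  define b where "b n p = 4 * (jmp (\<lambda>x. u n x - f x) p)\<^sup>2" for n p
  have [measurable]: "a n \<in> borel_measurable J" "b n \<in> borel_measurable J" for n
    unfolding a_def b_def by measurable
  have "(\<lambda>n. \<integral>\<^sup>+p. ennreal (max 0 (a n p - b n p)) \<partial>J) \<longlonglongrightarrow> (\<integral>\<^sup>+p. 0 \<partial>J)"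
  \<comment> \<open>Origin of the constants: a n is at most 2 jmp(f)^2 + 2 jmp(u n)^2, and jmp(u
    n)^2 is at most 2 jmp(u n - f)^2 + 2 jmp(f)^2. In total this is 6 jmp(f)^2 plus 4 jmp(u n -
    f)^2, and the latter is b n.\<close>
  proof (rule nn_integral_dominated_convergence[where w="\<lambda>p. 6 * ennreal ((jmp f p)\<^sup>2)"])
    show "AE p in J. ennreal (max 0 (a n p - b n p)) \<le> 6 * ennreal ((jmp f p)\<^sup>2)" for n
    proof (rule AE_I2)
      fix p
      let ?s = "jmp (\<lambda>x. \<bar>f x\<bar>) p" and ?t = "jmp (\<lambda>x. \<bar>u n x\<bar>) p"
      have s: "?s\<^sup>2 \<le> (jmp f p)\<^sup>2" and t: "?t\<^sup>2 \<le> (jmp (u n) p)\<^sup>2"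
        by (auto simp: jmp_def abs_le_square_iff[symmetric])
      have "a n p \<le> 2 * ?s\<^sup>2 + 2 * ?t\<^sup>2"
        using sq_add_le[of ?s "- ?t"] by (simp add: a_def)
      also have "\<dots> \<le> 2 * (jmp f p)\<^sup>2 + 2 * (jmp (u n) p)\<^sup>2" using s t by simp
      also have "(jmp (u n) p)\<^sup>2 \<le> 2 * (jmp (\<lambda>x. u n x - f x) p)\<^sup>2 + 2 * (jmp f p)\<^sup>2"
        using sq_add_le[of "jmp (\<lambda>x. u n x - f x) p" "jmp f p"] by simp
      finally have "a n p - b n p \<le> 6 * (jmp f p)\<^sup>2" by (simp add: b_def)
      then have "ennreal (max 0 (a n p - b n p)) \<le> ennreal (6 * (jmp f p)\<^sup>2)"
        by (intro ennreal_leI) simp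
      then show "ennreal (max 0 (a n p - b n p)) \<le> 6 * ennreal ((jmp f p)\<^sup>2)"
        by (simp add: ennreal_mult)
    qed
    show "(\<integral>\<^sup>+p. 6 * ennreal ((jmp f p)\<^sup>2) \<partial>J) < \<infinity>"
      using F_fin[OF f] by (simp add: nn_integral_cmult ennreal_mult_less_top energy_def)
    show "AE p in J. (\<lambda>n. ennreal (max 0 (a n p - b n p))) \<longlonglongrightarrow> 0"
      using AE_fst_snd[OF AEu]
    proof eventually_elim
      case (elim p)
      have "(\<lambda>n. ennreal (max 0 (a n p - b n p))) \<longlonglongrightarrow> ennreal (max 0
         ((\<bar>f (fst p)\<bar> - \<bar>f (fst p)\<bar> - (\<bar>f (snd p)\<bar> - \<bar>f (snd p)\<bar>))\<^sup>2
           - 4 * (f (fst p) - f (fst p) - (f (snd p) - f (snd p)))\<^sup>2))"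
        unfolding a_def b_def jmp_def using elim by (intro tendsto_intros) auto
      then show ?case by simp
    qed
  qed simp_all
  then have "(\<lambda>n. (\<integral>\<^sup>+p. ennreal (max 0 (a n p - b n p)) \<partial>J) + 4 * energy m J (\<lambda>x. u n x - f x)) \<longlonglongrightarrow> 0 + 4 * 0"
    by (intro tendsto_add ennreal_tendsto_cmult ulim) auto
  then have lim: "(\<lambda>n. (\<integral>\<^sup>+p. ennreal (max 0 (a n p - b n p)) \<partial>J) + 4 * energy m J (\<lambda>x. u n x - f x)) \<longlonglongrightarrow> 0" by simp
  have "energy m J (\<lambda>x. \<bar>f x\<bar> - \<bar>u n x\<bar>) \<le> (\<integral>\<^sup>+p. ennreal (max 0 (a n p - b n p)) \<partial>J) + 4 * energy m J (\<lambda>x. u n x - f x)" for n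
  proof -
    have 1: "(\<integral>\<^sup>+x. ennreal ((\<bar>f x\<bar> - \<bar>u n x\<bar>)\<^sup>2) \<partial>m) \<le> 4 * (\<integral>\<^sup>+x. ennreal ((u n x - f x)\<^sup>2) \<partial>m)"
    proof -
      have "(\<bar>f x\<bar> - \<bar>u n x\<bar>)\<^sup>2 \<le> (u n x - f x)\<^sup>2" for x by (simp flip: abs_le_square_iff)
      moreover have "(u n x - f x)\<^sup>2 \<le> 4 * (u n x - f x)\<^sup>2" for x by simp
      ultimately have "(\<bar>f x\<bar> - \<bar>u n x\<bar>)\<^sup>2 \<le> 4 * (u n x - f x)\<^sup>2" for x by (rule order_trans)
      then have "(\<integral>\<^sup>+x. ennreal ((\<bar>f x\<bar> - \<bar>u n x\<bar>)\<^sup>2) \<partial>m) \<le> (\<integral>\<^sup>+x. ennreal (4 * (u n x - f x)\<^sup>2) \<partial>m)"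
        by (intro nn_integral_mono ennreal_leI)
      then show ?thesis by (simp add: ennreal_mult nn_integral_cmult)
    qed
    have "(\<integral>\<^sup>+p. ennreal (a n p) \<partial>J) \<le> (\<integral>\<^sup>+p. ennreal (max 0 (a n p - b n p)) + ennreal (b n p) \<partial>J)"
    proof (rule nn_integral_mono)
      fix p
      have "ennreal (a n p) \<le> ennreal (max 0 (a n p - b n p) + b n p)" by (intro ennreal_leI) simp
      then show "ennreal (a n p) \<le> ennreal (max 0 (a n p - b n p)) + ennreal (b n p)"
        by (simp add: b_def ennreal_plus)
    qed
    also have "\<dots> = (\<integral>\<^sup>+p. ennreal (max 0 (a n p - b n p)) \<partial>J) + (\<integral>\<^sup>+p. ennreal (b n p) \<partial>J)"
      by (rule nn_integral_add) simp_all
    also have "(\<integral>\<^sup>+p. ennreal (b n p) \<partial>J) = 4 * (\<integral>\<^sup>+p. ennreal ((jmp (\<lambda>x. u n x - f x) p)\<^sup>2) \<partial>J)"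
      by (simp add: b_def ennreal_mult nn_integral_cmult)
    finally have 2: "(\<integral>\<^sup>+p. ennreal (a n p) \<partial>J) \<le> (\<integral>\<^sup>+p. ennreal (max 0 (a n p - b n p)) \<partial>J) + 4 * (\<integral>\<^sup>+p. ennreal ((jmp (\<lambda>x. u n x - f x) p)\<^sup>2) \<partial>J)" .
    show ?thesis
      using add_mono[OF 1 2] unfolding energy_def a_def by (simp add: distrib_left ac_simps)
  qed
  then have "(\<lambda>n. energy m J (\<lambda>x. \<bar>f x\<bar> - \<bar>u n x\<bar>)) \<longlonglongrightarrow> 0"
    by (intro tendsto_sandwich[OF always_eventually always_eventually tendsto_const lim]) auto
  then show ?thesis
    by (rule F_closed_lim[where g="\<lambda>n x. \<bar>u n x\<bar>", rotated 2]) (auto intro!: D_abs u)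
qed

lemma F_max:
  assumes "f \<in> F" "g \<in> F" shows "(\<lambda>x. max (f x) (g x)) \<in> F"
proof -
  have "(\<lambda>x. (1/2) * ((f x + g x) + \<bar>f x - g x\<bar>)) \<in> F"
    by (intro F_scale F_add F_abs F_diff assms)
  also have "(\<lambda>x. (1/2) * ((f x + g x) + \<bar>f x - g x\<bar>)) = (\<lambda>x. max (f x) (g x))"
    by (auto simp: fun_eq_iff max_def)
  finally show ?thesis .
qed

lemma F_min:
  assumes "f \<in> F" "g \<in> F" shows "(\<lambda>x. min (f x) (g x)) \<in> F"
proof -
  have "(\<lambda>x. (1/2) * ((f x + g x) - \<bar>f x - g x\<bar>)) \<in> F"
    by (intro F_scale F_add F_abs F_diff assms)
  also have "(\<lambda>x. (1/2) * ((f x + g x) - \<bar>f x - g x\<bar>)) = (\<lambda>x. min (f x) (g x))"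
    by (auto simp: fun_eq_iff min_def)
  finally show ?thesis .
qed

end

section \<open>The closure of a jump form\<close>

lemma ennreal_pos_realE:
  assumes "0 < (e::ennreal)"
  obtains d where "0 < d" "ennreal d < e"
proof -
  obtain d where d: "0 < d" "d < e" using dense[OF assms] by blast
  then show ?thesis
    by (cases d) (auto intro!: that)
qed

lemma integrable_sq_diff:
  fixes f g :: "'x \<Rightarrow> real"
  assumes [measurable]: "f \<in> borel_measurable M" "g \<in> borel_measurable M"
    and f: "integrable M (\<lambda>x. (f x)\<^sup>2)" and g: "integrable M (\<lambda>x. (g x)\<^sup>2)"
  shows "integrable M (\<lambda>x. (f x - g x)\<^sup>2)"
proof (rule Bochner_Integration.integrable_bound)
  show "integrable M (\<lambda>x. 2 * (f x)\<^sup>2 + 2 * (g x)\<^sup>2)" using f g by simp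
  show "AE x in M. norm ((f x - g x)\<^sup>2) \<le> norm (2 * (f x)\<^sup>2 + 2 * (g x)\<^sup>2)"
    using sq_add_le[of "f _" "- g _"] by (intro AE_I2) simp
qed simp

lemma integral_sq_triangle:
  fixes f g h :: "'x \<Rightarrow> real"
  assumes [measurable]: "f \<in> borel_measurable M" "g \<in> borel_measurable M" "h \<in> borel_measurable M"
    and f: "integrable M (\<lambda>x. (f x)\<^sup>2)" and g: "integrable M (\<lambda>x. (g x)\<^sup>2)" and h: "integrable M (\<lambda>x. (h x)\<^sup>2)"
  shows "(\<integral>x. (f x - h x)\<^sup>2 \<partial>M) \<le> 2 * (\<integral>x. (f x - g x)\<^sup>2 \<partial>M) + 2 * (\<integral>x. (g x - h x)\<^sup>2 \<partial>M)"
proof -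
  have i: "integrable M (\<lambda>x. (f x - h x)\<^sup>2)" "integrable M (\<lambda>x. (f x - g x)\<^sup>2)" "integrable M (\<lambda>x. (g x - h x)\<^sup>2)"
    by (intro integrable_sq_diff assms)+
  have "(\<integral>x. (f x - h x)\<^sup>2 \<partial>M) \<le> (\<integral>x. 2 * (f x - g x)\<^sup>2 + 2 * (g x - h x)\<^sup>2 \<partial>M)"
  proof (rule integral_mono)
    show "(f x - h x)\<^sup>2 \<le> 2 * (f x - g x)\<^sup>2 + 2 * (g x - h x)\<^sup>2" for x
      using sq_add_le[of "f x - g x" "g x - h x"] by simp
  qed (use i in auto)
  also have "\<dots> = 2 * (\<integral>x. (f x - g x)\<^sup>2 \<partial>M) + 2 * (\<integral>x. (g x - h x)\<^sup>2 \<partial>M)"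
    using i by simp
  finally show ?thesis .
qed

context jump_core
begin

lemma F_subset_L2: "F \<subseteq> L2 m"
  using F_meas F_fin energy_finite(1) by (auto simp: L2_def)

text \<open>Formulated for a subspace V and any E that agrees with \<open>jump_form\<close> on it,
  in order to cover both the core with \<open>jump_form\<close> and the closure with
  \<open>closure_form\<close>.\<close>

lemma sym_form_subspace:
  assumes "V \<subseteq> F" "(\<lambda>x. 0) \<in> V" "\<And>u v a b. u \<in> V \<Longrightarrow> v \<in> V \<Longrightarrow> (\<lambda>x. a * u x + b * v x) \<in> V"
    and E: "\<And>u v. u \<in> V \<Longrightarrow> v \<in> V \<Longrightarrow> E u v = jump_form J u v"
  shows "sym_form m V E"
proof -
  have VF: "u \<in> borel_measurable m" "energy m J u < \<infinity>" if "u \<in> V" for u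
    using assms(1) that F_meas F_fin by auto
  show ?thesis
    unfolding sym_form_def
  proof (intro conjI ballI allI)
    show "V \<subseteq> L2 m" using assms(1) F_subset_L2 by blast
    show "(\<lambda>x. 0) \<in> V" by fact
    fix u assume u: "u \<in> V"
    show "0 \<le> E u u" using jump_form_nonneg[of u] by (simp add: E u)
    fix v assume v: "v \<in> V"
    show "(\<lambda>x. a * u x + b * v x) \<in> V" for a b by (rule assms(3)[OF u v])
    show "E u v = E v u" by (simp add: E u v jump_form_commute[of u])
    fix w a b assume w: "w \<in> V"
    show "E (\<lambda>x. a * u x + b * v x) w = a * E u w + b * E v w"
      using jump_form_linear[OF VF(1)[OF u] VF(1)[OF v] VF(1)[OF w] VF(2)[OF u] VF(2)[OF v] VF(2)[OF w]]
      by (simp add: E u v w assms(3))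
  qed
qed

lemma D_sq_integrable: "u \<in> D \<Longrightarrow> integrable m (\<lambda>x. (u x)\<^sup>2)"
  by (rule energy_finite(1)[OF D_meas D_fin])

lemma D_diff: "u \<in> D \<Longrightarrow> v \<in> D \<Longrightarrow> (\<lambda>x. u x - v x) \<in> D"
  using D_lin[of u v 1 "-1"] by simp

text \<open>L2 convergence and the form-Cauchy property together make u Cauchy in energy, so
  completeness yields an energy limit g. An energy limit is an L2 limit, hence g = f almost
  everywhere. The case f = 0 is closability.\<close>

lemma approx_seq_energy:
  assumes f: "f \<in> L2 m" and ap: "approx_seq m D (jump_form J) u f"
  shows "(\<lambda>n. energy m J (\<lambda>x. u n x - f x)) \<longlonglongrightarrow> 0"
proof -
  have [measurable]: "f \<in> borel_measurable m" and fi: "integrable m (\<lambda>x. (f x)\<^sup>2)"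
    using f by (auto simp: L2_def)
  have u: "u n \<in> D" for n using ap by (simp add: approx_seq_def)
  have [measurable]: "u n \<in> borel_measurable m" for n by (rule D_meas[OF u])
  define l where "l n = (\<integral>x. (u n x - f x)\<^sup>2 \<partial>m)" for n
  have "(\<lambda>n. L2dist m (u n) f) \<longlonglongrightarrow> 0" using ap by (simp add: approx_seq_def)
  then have "(\<lambda>n. (L2dist m (u n) f)\<^sup>2) \<longlonglongrightarrow> 0\<^sup>2" by (rule tendsto_power)
  moreover have "(L2dist m (u n) f)\<^sup>2 = l n" for n by (simp add: L2dist_def l_def)
  ultimately have l: "l \<longlonglongrightarrow> 0" by simp
  have Cau: "\<exists>N. \<forall>n\<ge>N. \<forall>k\<ge>N. energy m J (\<lambda>x. u n x - u k x) < e" if e: "0 < e" for e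
  proof -
    obtain d where d: "0 < d" "ennreal d < e" by (rule ennreal_pos_realE[OF e])
    obtain N1 where N1: "\<And>n k. n \<ge> N1 \<Longrightarrow> k \<ge> N1 \<Longrightarrow> jump_form J (\<lambda>x. u n x - u k x) (\<lambda>x. u n x - u k x) < d / 2"
      using ap d(1) unfolding approx_seq_def form_cauchy_def diff_fun_def by (meson half_gt_zero)
    \<comment> \<open>The L2 part will be at most 2 (d/8) + 2 (d/8) = d/2; the form part uses up the
      other half.\<close>
    obtain N2 where N2: "\<And>n. n \<ge> N2 \<Longrightarrow> l n < d / 8"
      using order_tendstoD(2)[OF l, of "d / 8"] d(1) by (auto simp: eventually_sequentially)
    have "energy m J (\<lambda>x. u n x - u k x) < e" if n: "n \<ge> max N1 N2" and k: "k \<ge> max N1 N2" for n k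
    proof -
      have "(\<integral>x. (u n x - u k x)\<^sup>2 \<partial>m) \<le> 2 * l n + 2 * l k"
        using integral_sq_triangle[of "u n" m f "u k"] u fi D_sq_integrable
        by (simp add: l_def power2_commute[of "f _"])
      then have "jump_form J (\<lambda>x. u n x - u k x) (\<lambda>x. u n x - u k x) + (\<integral>x. (u n x - u k x)\<^sup>2 \<partial>m) < d"
        using N1[of n k] N2[of n] N2[of k] n k by auto
      then have "energy m J (\<lambda>x. u n x - u k x) < ennreal d"
        using d(1) energy_finite(3)[OF D_meas D_fin, OF D_diff D_diff, OF u u u u, of n k]
        by (simp add: ennreal_less_iff jump_form_nonneg del: ennreal_plus)
      then show ?thesis using d(2) by simp
    qed
    then show ?thesis by blast
  qed
  obtain g r where g [measurable]: "g \<in> borel_measurable m"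
    and glim: "(\<lambda>n. energy m J (\<lambda>x. u n x - g x)) \<longlonglongrightarrow> 0"
    by (rule energy_complete[OF D_meas[OF u] D_fin[OF u] Cau])
  have "(\<integral>\<^sup>+x. ennreal ((f x - g x)\<^sup>2) \<partial>m) \<le> 0"
  \<comment> \<open>The squared L2 distance of f and g is a constant below a sequence that tends to
    0.\<close>
  proof (rule LIMSEQ_le_const)
    show "(\<lambda>n. 2 * ennreal (l n) + 2 * energy m J (\<lambda>x. u n x - g x)) \<longlonglongrightarrow> 0"
    proof -
      have "(\<lambda>n. 2 * ennreal (l n) + 2 * energy m J (\<lambda>x. u n x - g x)) \<longlonglongrightarrow> 2 * ennreal 0 + 2 * 0"
        using l glim by (intro tendsto_add ennreal_tendsto_cmult tendsto_ennrealI) auto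
      then show ?thesis by simp
    qed
    have "(\<integral>\<^sup>+x. ennreal ((f x - g x)\<^sup>2) \<partial>m) \<le> 2 * ennreal (l n) + 2 * energy m J (\<lambda>x. u n x - g x)" for n
    proof -
      have "(\<integral>\<^sup>+x. ennreal ((f x - g x)\<^sup>2) \<partial>m) \<le> (\<integral>\<^sup>+x. ennreal (2 * (u n x - f x)\<^sup>2 + 2 * (u n x - g x)\<^sup>2) \<partial>m)"
      proof (intro nn_integral_mono ennreal_leI)
        show "(f x - g x)\<^sup>2 \<le> 2 * (u n x - f x)\<^sup>2 + 2 * (u n x - g x)\<^sup>2" for x
          using sq_add_le[of "f x - u n x" "u n x - g x"] by (simp add: power2_commute[of "f x" "u n x"])
      qed
      also have "\<dots> = 2 * (\<integral>\<^sup>+x. ennreal ((u n x - f x)\<^sup>2) \<partial>m) + 2 * (\<integral>\<^sup>+x. ennreal ((u n x - g x)\<^sup>2) \<partial>m)"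
        by (simp add: ennreal_plus ennreal_mult nn_integral_add nn_integral_cmult)
      also have "(\<integral>\<^sup>+x. ennreal ((u n x - f x)\<^sup>2) \<partial>m) = ennreal (l n)"
        unfolding l_def using u fi D_sq_integrable by (intro nn_integral_eq_integral integrable_sq_diff) auto
      also have "(\<integral>\<^sup>+x. ennreal ((u n x - g x)\<^sup>2) \<partial>m) \<le> energy m J (\<lambda>x. u n x - g x)"
        by (simp add: energy_def)
      finally show ?thesis by (simp add: add_left_mono mult_left_mono)
    qed
    then show "\<exists>N. \<forall>n\<ge>N. (\<integral>\<^sup>+x. ennreal ((f x - g x)\<^sup>2) \<partial>m) \<le> 2 * ennreal (l n) + 2 * energy m J (\<lambda>x. u n x - g x)"
      by blast
  qed
  then have "AE x in m. ennreal ((f x - g x)\<^sup>2) = 0"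
    by (subst nn_integral_0_iff_AE[symmetric]) auto
  then have "AE x in m. f x = g x" by (simp add: ennreal_eq_0_iff power2_eq_square[symmetric])
  then have "energy m J (\<lambda>x. u n x - f x) = energy m J (\<lambda>x. u n x - g x)" for n
    by (intro energy_cong_AE) auto
  then show ?thesis using glim by simp
qed

text \<open>Converse of \<open>approx_seq_energy\<close>: the energy of a difference bounds its L2
  part and its form part separately.\<close>

lemma energy_approx_seq:
  assumes f: "f \<in> F" and u: "\<And>n. u n \<in> D" and lim: "(\<lambda>n. energy m J (\<lambda>x. u n x - f x)) \<longlonglongrightarrow> 0"
  shows "approx_seq m D (jump_form J) u f"
  unfolding approx_seq_def form_cauchy_def diff_fun_def
proof (intro conjI allI impI u)
  note [measurable] = F_meas[OF f] D_meas[OF u]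
  have fin: "energy m J (\<lambda>x. u n x - f x) < \<infinity>" for n
    by (intro finite_energy_diff F_meas F_fin D_meas D_fin f u)
  have L2: "(L2dist m (u n) f) \<le> sqrt (enn2real (energy m J (\<lambda>x. u n x - f x)))" for n
    using energy_finite(3)[OF _ fin[of n]] jump_form_nonneg[of "\<lambda>x. u n x - f x"]
    by (simp add: L2dist_def del: ennreal_plus)
  have "(\<lambda>n. enn2real (energy m J (\<lambda>x. u n x - f x))) \<longlonglongrightarrow> enn2real 0"
    by (rule tendsto_enn2real) (use lim in auto)
  from tendsto_real_sqrt[OF this]
  have "(\<lambda>n. sqrt (enn2real (energy m J (\<lambda>x. u n x - f x)))) \<longlonglongrightarrow> 0" by simp
  then show "(\<lambda>n. L2dist m (u n) f) \<longlonglongrightarrow> 0"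
    by (rule Lim_null_comparison[OF always_eventually, rotated]) (use L2 in \<open>auto simp: L2dist_def\<close>)
  fix e :: real assume e: "0 < e"
  obtain N where N: "\<And>n. n \<ge> N \<Longrightarrow> energy m J (\<lambda>x. u n x - f x) < ennreal (e / 8)"
    using lim[unfolded tendsto_energy_iff, rule_format, of "e / 8"] e by auto
  have "jump_form J (\<lambda>x. u n x - u k x) (\<lambda>x. u n x - u k x) < e" if "n \<ge> N" "k \<ge> N" for n k
  proof -
    have fin': "energy m J (\<lambda>x. u n x - u k x) < \<infinity>" by (intro D_fin D_diff u)
    have "energy m J (\<lambda>x. u n x - u k x) \<le> 2 * energy m J (\<lambda>x. u n x - f x) + 2 * energy m J (\<lambda>x. f x - u k x)"
      by (rule energy_triangle) simp_all
    also have "\<dots> < ennreal e"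
      using N that e by (intro double_add_less) (auto simp: energy_minus[of f])
    finally have "enn2real (energy m J (\<lambda>x. u n x - u k x)) < e"
      using fin' e by (cases "energy m J (\<lambda>x. u n x - u k x)") (auto simp: ennreal_less_iff)
    then show ?thesis
      using jump_form_le_energy[OF _ fin'] by simp
  qed
  then show "\<exists>N. \<forall>n\<ge>N. \<forall>k\<ge>N. jump_form J (\<lambda>x. u n x - u k x) (\<lambda>x. u n x - u k x) < e" by blast
qed

lemma closure_dom_eq: "closure_dom m D (jump_form J) = F"
proof (intro equalityI subsetI)
  fix f assume "f \<in> closure_dom m D (jump_form J)"
  then obtain u where f: "f \<in> L2 m" and u: "approx_seq m D (jump_form J) u f"
    by (auto simp: closure_dom_def)
  show "f \<in> F"
  proof (rule F_closed_lim)
    show "f \<in> borel_measurable m" using f by (simp add: L2_def)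
    show "u n \<in> F" for n using u by (auto simp: approx_seq_def intro: D_subset_F)
    show "(\<lambda>n. energy m J (\<lambda>x. f x - u n x)) \<longlonglongrightarrow> 0"
      using approx_seq_energy[OF f u] by (simp add: energy_minus[of f])
  qed
next
  fix f assume f: "f \<in> F"
  obtain u where "\<And>n. u n \<in> D" "(\<lambda>n. energy m J (\<lambda>x. u n x - f x)) \<longlonglongrightarrow> 0"
    using F_seq[OF f] by metis
  then have "approx_seq m D (jump_form J) u f" by (rule energy_approx_seq[OF f])
  then show "f \<in> closure_dom m D (jump_form J)"
    using F_subset_L2 f by (auto simp: closure_dom_def)
qed

text \<open>The definite description has at most one value because approximating sequences for f and
  for g exist, and has this value because the form is continuous in energy.\<close>

lemma closure_form_eq:
  assumes f: "f \<in> F" and g: "g \<in> F"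
  shows "closure_form m D (jump_form J) f g = jump_form J f g"
  unfolding closure_form_def
proof (rule the_equality)
  have *: "(\<lambda>n. jump_form J (u n) (v n)) \<longlonglongrightarrow> jump_form J f g"
    if "approx_seq m D (jump_form J) u f" "approx_seq m D (jump_form J) v g" for u v
  proof (rule jump_form_tendsto)
    have "u n \<in> D" "v n \<in> D" for n using that by (auto simp: approx_seq_def)
    then show "u n \<in> borel_measurable m" "v n \<in> borel_measurable m" "energy m J (u n) < \<infinity>" "energy m J (v n) < \<infinity>" for n
      using D_meas D_fin by auto
    show "(\<lambda>n. energy m J (\<lambda>x. u n x - f x)) \<longlonglongrightarrow> 0" "(\<lambda>n. energy m J (\<lambda>x. v n x - g x)) \<longlonglongrightarrow> 0"
      using that f g F_subset_L2 by (auto intro!: approx_seq_energy)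
  qed (intro F_meas F_fin f g)+
  then show "\<forall>u v. approx_seq m D (jump_form J) u f \<and> approx_seq m D (jump_form J) v g \<longrightarrow>
      (\<lambda>n. jump_form J (u n) (v n)) \<longlonglongrightarrow> jump_form J f g" by blast
  fix c assume c: "\<forall>u v. approx_seq m D (jump_form J) u f \<and> approx_seq m D (jump_form J) v g \<longrightarrow>
      (\<lambda>n. jump_form J (u n) (v n)) \<longlonglongrightarrow> c"
  obtain u where "\<And>n. u n \<in> D" "(\<lambda>n. energy m J (\<lambda>x. u n x - f x)) \<longlonglongrightarrow> 0" using F_seq[OF f] by metis
  then have u: "approx_seq m D (jump_form J) u f" by (rule energy_approx_seq[OF f])
  obtain v where "\<And>n. v n \<in> D" "(\<lambda>n. energy m J (\<lambda>x. v n x - g x)) \<longlonglongrightarrow> 0" using F_seq[OF g] by metis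
  then have v: "approx_seq m D (jump_form J) v g" by (rule energy_approx_seq[OF g])
  show "c = jump_form J f g"
    by (rule LIMSEQ_unique[of "\<lambda>n. jump_form J (u n) (v n)"]) (use c u v * in auto)
qed

lemma closable_jump_form: "closable_form m D (jump_form J)"
  unfolding closable_form_def
proof (intro conjI allI impI)
  show "sym_form m D (jump_form J)"
    by (rule sym_form_subspace) (auto intro: D_subset_F D_const D_lin)
  fix u assume u: "(\<forall>n. u n \<in> D) \<and> (\<lambda>n. L2dist m (u n) (\<lambda>x. 0)) \<longlonglongrightarrow> 0 \<and> form_cauchy (jump_form J) u"
  then have ap: "approx_seq m D (jump_form J) u (\<lambda>x. 0)" by (simp add: approx_seq_def)
  have z: "(\<lambda>x. 0) \<in> F" by (rule F_const)
  then have l: "(\<lambda>n. energy m J (\<lambda>x. u n x - 0)) \<longlonglongrightarrow> 0"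
    using F_subset_L2 by (intro approx_seq_energy[OF _ ap]) auto
  have "(\<lambda>n. jump_form J (u n) (u n)) \<longlonglongrightarrow> jump_form J (\<lambda>x. 0) (\<lambda>x. 0)"
    by (rule jump_form_tendsto[OF _ _ _ _ _ _ _ _ l l]) (use u D_meas D_fin in auto)
  then show "(\<lambda>n. jump_form J (u n) (u n)) \<longlonglongrightarrow> 0" by (simp add: jump_form_def)
qed

abbreviation "EF \<equiv> closure_form m D (jump_form J)"

lemma E1_eq:
  assumes f: "f \<in> F"
  shows "ennreal (E1 m EF f f) = energy m J f" "E1 m EF f f = enn2real (energy m J f)"
proof -
  have "0 \<le> E1 m EF f f"
    using closure_form_eq[OF f f] jump_form_nonneg[of f] by (simp add: E1_def)
  moreover show *: "ennreal (E1 m EF f f) = energy m J f"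
    using energy_finite(3)[OF F_meas[OF f] F_fin[OF f]] closure_form_eq[OF f f]
    by (simp add: E1_def power2_eq_square)
  ultimately show "E1 m EF f f = enn2real (energy m J f)" by (simp flip: *)
qed

text \<open>Density in L2 stays a premise, as it depends on how rich the core is. The rest follows
  from completeness and the lattice operations; for the contraction property, truncation to [0, 1]
  diminishes every single jump.\<close>

lemma dirichlet_form_closure:
  assumes dense: "\<And>f e. f \<in> L2 m \<Longrightarrow> 0 < e \<Longrightarrow> \<exists>g\<in>F. L2dist m f g < e"
  shows "dirichlet_form m (closure_dom m D (jump_form J)) EF"
  unfolding dirichlet_form_def closure_dom_eq
proof (intro conjI ballI allI impI)
  show "sym_form m F EF"
    by (rule sym_form_subspace) (auto intro: F_const F_add F_scale closure_form_eq)
  show "v \<in> F" if "u \<in> F" "v \<in> L2 m" "AE x in m. u x = v x" for u v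
    using that by (auto simp: L2_def intro: F_cong_AE)
  show "EF u u = 0" if u: "u \<in> F" and z: "AE x in m. u x = 0" for u
  proof -
    have "energy m J u = 0" using energy_cong_AE[OF z] by simp
    then show ?thesis
      using jump_form_le_energy[OF F_meas[OF u] F_fin[OF u]] jump_form_nonneg[of u] closure_form_eq[OF u u] by simp
  qed
  show "\<exists>g\<in>F. L2dist m f g < e" if "f \<in> L2 m" "0 < e" for f e using dense that by blast
  show "\<exists>f\<in>F. (\<lambda>n. E1 m EF (diff_fun (u n) f) (diff_fun (u n) f)) \<longlonglongrightarrow> 0"
    if "(\<forall>n. u n \<in> F) \<and> form_cauchy (E1 m EF) u" for u
  proof -
    have u: "u n \<in> F" for n using that by simp
    have Cau: "\<exists>N. \<forall>n\<ge>N. \<forall>k\<ge>N. energy m J (\<lambda>x. u n x - u k x) < e" if e: "0 < e" for e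
    proof -
      obtain d where d: "0 < d" "ennreal d < e" by (rule ennreal_pos_realE[OF e])
      obtain N where N: "\<And>n k. n \<ge> N \<Longrightarrow> k \<ge> N \<Longrightarrow> E1 m EF (\<lambda>x. u n x - u k x) (\<lambda>x. u n x - u k x) < d"
        using \<open>(\<forall>n. u n \<in> F) \<and> form_cauchy (E1 m EF) u\<close> d(1)
        unfolding form_cauchy_def diff_fun_def by meson
      have "energy m J (\<lambda>x. u n x - u k x) < e" if "n \<ge> N" "k \<ge> N" for n k
      proof -
        have "energy m J (\<lambda>x. u n x - u k x) \<le> ennreal d"
          using N[OF that] by (simp add: E1_eq(1)[OF F_diff[OF u u], symmetric] ennreal_leI)
        then show ?thesis using d(2) by simp
      qed
      then show ?thesis by blast
    qed
    obtain f r where f: "f \<in> borel_measurable m" and lim: "(\<lambda>n. energy m J (\<lambda>x. u n x - f x)) \<longlonglongrightarrow> 0"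
      by (rule energy_complete[OF F_meas[OF u] F_fin[OF u] Cau])
    have fF: "f \<in> F"
      by (rule F_closed_lim[OF f u]) (use lim in \<open>simp add: energy_minus[of f]\<close>)
    have "(\<lambda>n. enn2real (energy m J (\<lambda>x. u n x - f x))) \<longlonglongrightarrow> enn2real 0"
      by (rule tendsto_enn2real) (use lim in auto)
    then show ?thesis
      using fF by (intro bexI[of _ f]) (simp_all add: diff_fun_def E1_eq(2)[OF F_diff[OF u fF]])
  qed
  fix u assume u: "u \<in> F"
  let ?c = "\<lambda>x. min 1 (max 0 (u x))"
  show c: "?c \<in> F" by (intro F_min F_max F_const u)
  show "EF ?c ?c \<le> EF u u"
    unfolding closure_form_eq[OF c c] closure_form_eq[OF u u] jump_form_jmp
  proof (rule integral_mono)
    show "integrable J (\<lambda>p. jmp ?c p * jmp ?c p)" "integrable J (\<lambda>p. jmp u p * jmp u p)"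
      by (intro integrable_jmp_mult F_meas F_fin c u)+
    fix p
    have "\<bar>jmp ?c p\<bar> \<le> \<bar>jmp u p\<bar>" unfolding jmp_def by (simp add: min_def max_def abs_if)
    then show "jmp ?c p * jmp ?c p \<le> jmp u p * jmp u p"
      by (simp add: abs_le_square_iff power2_eq_square)
  qed
qed

end

section \<open>Jump forms on metric spaces\<close>

lemma sets_borel_of: "sets (borel_of T) = sigma_sets (topspace T) {U. openin T U}"
  unfolding borel_of_def by (rule sets_measure_of) (auto dest: openin_subset)

lemma space_borel_of: "space (borel_of T) = topspace T"
  unfolding borel_of_def by (rule space_measure_of) (auto dest: openin_subset)

lemma openin_in_borel_of: "openin T U \<Longrightarrow> U \<in> sets (borel_of T)"
  by (simp add: sets_borel_of sigma_sets.Basic)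

lemma continuous_map_measurable:
  assumes "continuous_map X Y f" "sets M = sets (borel_of X)" "sets N = sets (borel_of Y)"
  shows "f \<in> measurable M N"
proof -
  have sM: "space M = topspace X" and sN: "space N = topspace Y"
    using assms(2,3)[THEN sets_eq_imp_space_eq] by (auto simp: space_borel_of)
  show ?thesis
  proof (rule measurable_sigma_sets)
    show "sets N = sigma_sets (topspace Y) {U. openin Y U}" using assms(3) by (simp add: sets_borel_of)
    show "{U. openin Y U} \<subseteq> Pow (topspace Y)" by (auto dest: openin_subset)
    show "f \<in> space M \<rightarrow> topspace Y" using assms(1) by (auto simp: sM continuous_map_def)
    fix U assume "U \<in> {U. openin Y U}"
    then have "openin X {x \<in> topspace X. f x \<in> U}" using assms(1) by (auto simp: continuous_map_def)
    moreover have "f -` U \<inter> space M = {x \<in> topspace X. f x \<in> U}" by (auto simp: sM)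
    ultimately show "f -` U \<inter> space M \<in> sets M" by (simp add: assms(2) openin_in_borel_of)
  qed
qed

lemma sets_borel_of_euclidean: "sets (borel_of euclidean) = sets borel"
  by (simp add: borel_of_def borel_def)

lemma continuous_map_borel_measurable:
  fixes f :: "'x \<Rightarrow> 'b::topological_space"
  assumes "continuous_map X euclidean f" "sets M = sets (borel_of X)"
  shows "f \<in> borel_measurable M"
  by (rule continuous_map_measurable[OF assms]) (simp add: sets_borel_of_euclidean)

section \<open>Running minima and bounded Lipschitz functions\<close>

primrec run_min :: "(nat \<Rightarrow> real) \<Rightarrow> nat \<Rightarrow> real" where
  "run_min a 0 = a 0"
| "run_min a (Suc n) = min (run_min a n) (a (Suc n))"

lemma run_min_le: "i \<le> n \<Longrightarrow> run_min a n \<le> a i"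
proof (induction n)
  case (Suc n) then show ?case by (cases "i = Suc n") (auto simp: min_le_iff_disj)
qed simp

lemma run_min_greatest: "(\<And>i. i \<le> n \<Longrightarrow> c \<le> a i) \<Longrightarrow> c \<le> run_min a n"
  by (induction n) auto

lemma run_min_attained: "\<exists>i\<le>n. run_min a n = a i"
proof (induction n)
  case (Suc n)
  then show ?case by (auto simp: min_def le_Suc_eq)
qed simp

lemma run_min_lipschitz: "(\<And>i. i \<le> n \<Longrightarrow> \<bar>a i - b i\<bar> \<le> c) \<Longrightarrow> \<bar>run_min a n - run_min b n\<bar> \<le> c"
proof (induction n)
  case (Suc n)
  have "\<bar>run_min a n - run_min b n\<bar> \<le> c" "\<bar>a (Suc n) - b (Suc n)\<bar> \<le> c" using Suc by auto
  then show ?case by (auto simp: min_def)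
qed simp

lemma run_min_abs_le:
  assumes "\<And>i. i \<le> n \<Longrightarrow> \<bar>a i\<bar> \<le> c" shows "\<bar>run_min a n\<bar> \<le> c"
  using run_min_attained[of n a] assms by auto

text \<open>The premises say that c is the infimum of the a i. Countable infima of functions are
  always approached through \<open>run_min\<close>, because its recursion carries closure under
  binary minima over by induction.\<close>

lemma run_min_tendsto:
  assumes lo: "\<And>i. c \<le> a i" and hi: "\<And>e. 0 < e \<Longrightarrow> \<exists>i. a i \<le> c + e"
  shows "run_min a \<longlonglongrightarrow> c"
proof (rule LIMSEQ_I)
  fix e :: real assume "0 < e"
  then obtain i where i: "a i \<le> c + e / 2" using hi[of "e / 2"] by auto
  have "norm (run_min a n - c) < e" if "n \<ge> i" for n
    using run_min_le[OF that, of a] i run_min_greatest[of n c a, OF lo] \<open>0 < e\<close> by simp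
  then show "\<exists>N. \<forall>n\<ge>N. norm (run_min a n - c) < e" by blast
qed

text \<open>A single constant for the sup bound and the Lipschitz bound, so that one majorant
  depending on C controls the jumps of the whole class.\<close>

definition blip :: "'x set \<Rightarrow> ('x \<Rightarrow> 'x \<Rightarrow> real) \<Rightarrow> real \<Rightarrow> ('x \<Rightarrow> real) \<Rightarrow> bool" where
  "blip S d C g \<longleftrightarrow> (\<forall>x\<in>S. \<bar>g x\<bar> \<le> C) \<and> (\<forall>x\<in>S. \<forall>y\<in>S. \<bar>g x - g y\<bar> \<le> C * d x y)"

context Metric_space
begin

lemma blip_continuous:
  assumes g: "blip M d C g"
  shows "continuous_map mtopology euclideanreal g"
  unfolding continuous_map_def
proof (intro conjI allI impI)
  fix U :: "real set" assume "openin euclideanreal U"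
  then have U: "open U" by simp
  show "openin mtopology {x \<in> topspace mtopology. g x \<in> U}"
    unfolding openin_mtopology
  proof (intro conjI allI impI)
    fix x assume "x \<in> {x \<in> topspace mtopology. g x \<in> U}"
    then have x: "x \<in> M" "g x \<in> U" by auto
    obtain e where e: "0 < e" "\<And>t. \<bar>t - g x\<bar> < e \<Longrightarrow> t \<in> U"
      using U x(2) by (auto simp: open_dist dist_real_def)
    \<comment> \<open>The radius e / (|C| + 1) is positive whatever the value of C.\<close>
    have "g y \<in> U" if "y \<in> M" "d x y < e / (\<bar>C\<bar> + 1)" for y
    proof (rule e(2))
      have "\<bar>g y - g x\<bar> \<le> C * d x y"
        using g x(1) that(1) by (auto simp: blip_def commute)
      also have "\<dots> \<le> (\<bar>C\<bar> + 1) * d x y" by (intro mult_right_mono) auto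
      also have "\<dots> < e" using that(2) by (simp add: field_simps add_pos_nonneg)
      finally show "\<bar>g y - g x\<bar> < e" .
    qed
    then show "\<exists>r>0. mball x r \<subseteq> {x \<in> topspace mtopology. g x \<in> U}"
      using e(1) by (intro exI[of _ "e / (\<bar>C\<bar> + 1)"]) (auto simp: mball_def)
  qed auto
qed auto

lemma d_min_lipschitz:
  assumes "x \<in> M" "y \<in> M" "z \<in> M"
  shows "\<bar>min 1 (d x z) - min 1 (d y z)\<bar> \<le> d x y"
  using triangle[OF assms] triangle[OF assms(2,1,3)] commute[of x y] by (auto simp: min_def)

lemma blip_d_min: "z \<in> M \<Longrightarrow> blip M d 1 (\<lambda>x. min 1 (d x z))"
  using d_min_lipschitz nonneg by (auto simp: blip_def)

end

locale metric_jump = prob_space m + Metric_space S d for m :: "'x measure" and S :: "'x set" and d :: "'x \<Rightarrow> 'x \<Rightarrow> real" +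
  fixes J :: "('x \<times> 'x) measure" and D :: "('x \<Rightarrow> real) set"
  assumes sets_m: "sets m = sets (borel_of mtopology)"
    and sets_J: "sets J = sets (borel_of (prod_topology mtopology mtopology))"
    and ac_J: "null_sets (m \<Otimes>\<^sub>M m) \<subseteq> null_sets J"
    and d_int: "(\<integral>\<^sup>+p. ennreal (min 1 ((d (fst p) (snd p))\<^sup>2)) \<partial>J) < \<infinity>"
    and blip_D: "u \<in> D \<Longrightarrow> \<exists>C. blip S d C u"
    and lin_D: "u \<in> D \<Longrightarrow> v \<in> D \<Longrightarrow> (\<lambda>x. a * u x + b * v x) \<in> D"
    and const_D: "(\<lambda>x. c) \<in> D"
    and sqrt_D: "u \<in> D \<Longrightarrow> 0 < e \<Longrightarrow> (\<lambda>x. sqrt ((u x)\<^sup>2 + e)) \<in> D"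
begin

lemma space_m: "space m = S"
  using sets_eq_imp_space_eq[OF sets_m] by (simp add: space_borel_of)

lemma space_J: "space J = S \<times> S"
  using sets_eq_imp_space_eq[OF sets_J] by (simp add: space_borel_of)

lemma S_nonempty: "S \<noteq> {}"
  using not_empty space_m by simp

sublocale jump_space m J
proof
  show "fst \<in> measurable J m" "snd \<in> measurable J m"
    by (rule continuous_map_measurable[OF _ sets_J sets_m]; rule continuous_map_fst continuous_map_snd)+
  show "null_sets (m \<Otimes>\<^sub>M m) \<subseteq> null_sets J" by (rule ac_J)
qed

lemma blip_meas: "blip S d C g \<Longrightarrow> g \<in> borel_measurable m"
  by (rule continuous_map_borel_measurable[OF blip_continuous sets_m])

lemma d_meas [measurable]: "(\<lambda>p. d (fst p) (snd p)) \<in> borel_measurable J"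
proof -
  have "continuous_map (prod_topology mtopology mtopology) euclidean (\<lambda>(x, y). d x y)"
    using continuous_map_metric[of "metric (S, d)"] by (simp add: mtopology_of)
  then have "(\<lambda>(x, y). d x y) \<in> borel_measurable J"
    by (rule continuous_map_borel_measurable[OF _ sets_J])
  then show ?thesis by (simp only: case_prod_unfold)
qed

text \<open>The common integrable majorant for the squared jumps of the class
  \<open>blip S d C\<close>: a jump is at most 2 C by the sup bound and at most C d by the Lipschitz
  bound, hence at most 2 C min(1, d).\<close>

definition dom :: "real \<Rightarrow> 'x \<times> 'x \<Rightarrow> ennreal" where
  "dom C p = ennreal (4 * C\<^sup>2) * ennreal (min 1 ((d (fst p) (snd p))\<^sup>2))"

lemma dom_meas [measurable]: "dom C \<in> borel_measurable J"
  unfolding dom_def by measurable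

lemma dom_int: "(\<integral>\<^sup>+p. dom C p \<partial>J) < \<infinity>"
  unfolding dom_def using d_int by (simp add: nn_integral_cmult ennreal_mult_less_top)

lemma jmp_dom:
  assumes g: "blip S d C g" and p: "p \<in> space J"
  shows "ennreal ((jmp g p)\<^sup>2) \<le> dom C p"
proof -
  obtain x y where p': "p = (x, y)" "x \<in> S" "y \<in> S" using p by (auto simp: space_J)
  have C: "0 \<le> C" and b: "\<bar>g x\<bar> \<le> C" "\<bar>g y\<bar> \<le> C" "\<bar>g x - g y\<bar> \<le> C * d x y"
    using g p' by (auto simp: blip_def dest: bspec[of _ _ x])
  have "\<bar>g x - g y\<bar> \<le> 2 * C * min 1 (d x y)"
  proof (cases "d x y \<le> 1")
    case True
    have "C * d x y \<le> 2 * (C * d x y)" using C by simp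
    with True b show ?thesis by (simp add: min_def)
  qed (use b in \<open>simp add: min_def\<close>)
  then have "(g x - g y)\<^sup>2 \<le> (2 * C * min 1 (d x y))\<^sup>2"
    using C by (intro abs_le_square_iff[THEN iffD1]) simp
  also have "\<dots> = 4 * C\<^sup>2 * min 1 ((d x y)\<^sup>2)"
    using power_le_one_iff[of "d x y" 2] by (auto simp: min_def power_mult_distrib)
  finally show ?thesis
    by (simp add: p' jmp_def dom_def ennreal_mult[symmetric] ennreal_leI)
qed

lemma blip_energy: "blip S d C g \<Longrightarrow> energy m J g < \<infinity>"
proof -
  assume g: "blip S d C g"
  have "(\<integral>\<^sup>+x. ennreal ((g x)\<^sup>2) \<partial>m) \<le> (\<integral>\<^sup>+x. ennreal (C\<^sup>2) \<partial>m)"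
  proof (rule nn_integral_mono)
    fix x assume "x \<in> space m"
    then have "\<bar>g x\<bar> \<le> C" using g by (auto simp: blip_def space_m)
    then show "ennreal ((g x)\<^sup>2) \<le> ennreal (C\<^sup>2)"
      by (intro ennreal_leI abs_le_square_iff[THEN iffD1]) simp
  qed
  then have "(\<integral>\<^sup>+x. ennreal ((g x)\<^sup>2) \<partial>m) < \<infinity>"
    by (rule le_less_trans) (simp add: emeasure_space_1)
  moreover have "(\<integral>\<^sup>+p. ennreal ((jmp g p)\<^sup>2) \<partial>J) \<le> (\<integral>\<^sup>+p. dom C p \<partial>J)"
    by (intro nn_integral_mono jmp_dom[OF g])
  then have "(\<integral>\<^sup>+p. ennreal ((jmp g p)\<^sup>2) \<partial>J) < \<infinity>"
    using dom_int le_less_trans by blast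
  ultimately show ?thesis by (simp add: energy_def)
qed

sublocale jump_core m J D
proof
  fix u assume "u \<in> D"
  then obtain C where C: "blip S d C u" using blip_D by blast
  show "u \<in> borel_measurable m" "energy m J u < \<infinity>" by (rule blip_meas[OF C] blip_energy[OF C])+
  show "\<exists>C. \<forall>x\<in>space m. \<bar>u x\<bar> \<le> C" using C by (auto simp: blip_def space_m)
qed (rule lin_D const_D sqrt_D; assumption)+

text \<open>Pointwise convergence suffices, since the common constant C yields the common majorant
  \<open>dom C\<close>. This is how the domain is enlarged beyond the core.\<close>

lemma blip_lim:
  assumes g: "\<And>n. g n \<in> F" "\<And>n. blip S d C (g n)" and lim: "\<And>x. x \<in> S \<Longrightarrow> (\<lambda>n. g n x) \<longlonglongrightarrow> h x"
  shows "h \<in> F" "blip S d C h"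
proof -
  have [measurable]: "h \<in> borel_measurable m"
    by (rule borel_measurable_LIMSEQ_real[OF _ F_meas[OF g(1)]]) (use lim in \<open>simp add: space_m\<close>)
  show "h \<in> F"
  proof (rule F_dominated[where u=g and H="dom C" and C=C])
    show "g n \<in> F" for n by (rule g)
    show "AE x in m. (\<lambda>n. g n x) \<longlonglongrightarrow> h x" using lim by (intro AE_I2) (simp add: space_m)
    show "AE x in m. \<bar>g n x\<bar> \<le> C" for n using g(2)[of n] by (intro AE_I2) (simp add: space_m blip_def)
    show "AE p in J. ennreal ((jmp (g n) p)\<^sup>2) \<le> dom C p" for n by (intro AE_I2 jmp_dom g)
    show "(\<integral>\<^sup>+p. dom C p \<partial>J) < \<infinity>" by (rule dom_int)
  qed simp_all
  show "blip S d C h"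
    unfolding blip_def
  proof (intro conjI ballI)
    fix x assume x: "x \<in> S"
    show "\<bar>h x\<bar> \<le> C"
      by (rule LIMSEQ_le_const2[OF tendsto_rabs[OF lim[OF x]]]) (use g(2) x in \<open>auto simp: blip_def\<close>)
    fix y assume y: "y \<in> S"
    show "\<bar>h x - h y\<bar> \<le> C * d x y"
      by (rule LIMSEQ_le_const2[OF tendsto_rabs[OF tendsto_diff[OF lim[OF x] lim[OF y]]]])
         (use g(2) x y in \<open>auto simp: blip_def\<close>)
  qed
qed

lemma F_run_min:
  assumes "\<And>i. g i \<in> F" shows "(\<lambda>x. run_min (\<lambda>i. g i x) n) \<in> F"
  by (induction n) (auto intro: assms F_min)

lemma blip_run_min:
  assumes "\<And>i. blip S d C (g i)" shows "blip S d C (\<lambda>x. run_min (\<lambda>i. g i x) n)"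
  using assms unfolding blip_def by (auto intro!: run_min_abs_le run_min_lipschitz)

end

section \<open>Bounded Lipschitz functions belong to the domain\<close>

locale metric_jump_rich = metric_jump +
  fixes y :: "nat \<Rightarrow> 'a"
  assumes y_in: "y n \<in> S"
    and y_dense: "x \<in> S \<Longrightarrow> 0 < e \<Longrightarrow> \<exists>n. d x (y n) < e"
    and d_min_F: "z \<in> S \<Longrightarrow> (\<lambda>x. min 1 (d x z)) \<in> F"
begin

text \<open>McShane's formula with truncated distances: g x is the infimum over the dense sequence
  of g(y i) + 2 C min(1, d(x, y i)). The slope is 2 C instead of C because beyond distance 1 the
  truncated term has to outweigh the full oscillation 2 C of g.\<close>

lemma blip_in_F:
  assumes g: "blip S d C g" shows "g \<in> F"
proof (rule blip_lim(1))
  obtain z where z: "z \<in> S" using S_nonempty by blast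
  have C: "0 \<le> C" using g z unfolding blip_def by (meson abs_ge_zero order_trans)
  let ?h = "\<lambda>i x. g (y i) + 2 * C * min 1 (d x (y i))"
  show "(\<lambda>x. run_min (\<lambda>i. ?h i x) n) \<in> F" for n
    by (intro F_run_min F_add F_const F_scale d_min_F y_in)
  \<comment> \<open>The sup bound is C + 2 C; the Lipschitz constant 2 C is smaller than
    that.\<close>
  have b: "blip S d (3 * C) (?h i)" for i
    unfolding blip_def
  proof (intro conjI ballI)
    fix x assume x: "x \<in> S"
    have "0 \<le> min 1 (d x (y i))" "min 1 (d x (y i)) \<le> 1" by auto
    then have "0 \<le> 2 * C * min 1 (d x (y i))" "2 * C * min 1 (d x (y i)) \<le> 2 * C"
      using C by (auto intro: mult_left_le)
    moreover have "\<bar>g (y i)\<bar> \<le> C" using g y_in by (auto simp: blip_def)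
    ultimately show "\<bar>?h i x\<bar> \<le> 3 * C" by linarith
    fix x' assume x': "x' \<in> S"
    have "\<bar>?h i x - ?h i x'\<bar> = 2 * C * \<bar>min 1 (d x (y i)) - min 1 (d x' (y i))\<bar>"
      using C by (simp add: abs_mult flip: right_diff_distrib)
    also have "\<dots> \<le> 2 * C * d x x'" using C by (intro mult_left_mono d_min_lipschitz x x' y_in) auto
    also have "\<dots> \<le> 3 * C * d x x'" using C by (intro mult_right_mono) auto
    finally show "\<bar>?h i x - ?h i x'\<bar> \<le> 3 * C * d x x'" .
  qed
  show "blip S d (3 * C) (\<lambda>x. run_min (\<lambda>i. ?h i x) n)" for n by (rule blip_run_min[OF b])
  fix x assume x: "x \<in> S"
  have le: "\<bar>g x - g (y i)\<bar> \<le> 2 * C * min 1 (d x (y i))" for i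
  proof -
    have "\<bar>g x\<bar> \<le> C" "\<bar>g (y i)\<bar> \<le> C" "\<bar>g x - g (y i)\<bar> \<le> C * d x (y i)"
      using g x y_in by (auto simp: blip_def)
    moreover have "C * d x (y i) \<le> 2 * (C * d x (y i))" using C by simp
    ultimately show ?thesis by (auto simp: min_def)
  qed
  show "(\<lambda>n. run_min (\<lambda>i. ?h i x) n) \<longlonglongrightarrow> g x"
  proof (rule run_min_tendsto)
    show "g x \<le> ?h i x" for i using le[of i] by linarith
    fix e :: real assume e: "0 < e"
    \<comment> \<open>The i-th function exceeds g x by at most 4 C min(1, d(x, y i)): once 2 C from
      g(y i) - g x, once from the added term. The summand 1 covers C = 0.\<close>
    obtain i where i: "d x (y i) < e / (4 * C + 1)" using y_dense[OF x, of "e / (4 * C + 1)"] e C by auto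
    have "4 * C * min 1 (d x (y i)) \<le> (4 * C + 1) * d x (y i)" using C by (intro mult_mono) auto
    also have "\<dots> \<le> e" using i C by (simp add: field_simps)
    finally have "?h i x \<le> g x + e" using le[of i] by linarith
    then show "\<exists>i. ?h i x \<le> g x + e" by blast
  qed
qed

end

text \<open>At an index where the smaller of the two minima is attained, the larger minimum lies
  below its own sequence, so the gap there is at least as large. Hence the jump of a running minimum
  is dominated by the jump of one of its members.\<close>

lemma run_min_diff_attained: "\<exists>i\<le>n. \<bar>run_min a n - run_min b n\<bar> \<le> \<bar>a i - b i\<bar>"
proof -
  obtain i where i: "i \<le> n" "run_min b n = b i" using run_min_attained by blast
  obtain j where j: "j \<le> n" "run_min a n = a j" using run_min_attained by blast
  show ?thesis
  proof (cases "run_min b n \<le> run_min a n")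
    case True
    then show ?thesis using run_min_le[OF i(1), of a] i by (intro exI[of _ i]) auto
  next
    case False
    then show ?thesis using run_min_le[OF j(1), of b] j by (intro exI[of _ j]) auto
  qed
qed

lemma ennreal_le_suminf: "f i \<le> (\<Sum>i. f i :: ennreal)"
  using sum_le_suminf[of f "{i}"] by simp

section \<open>Density in L2\<close>

context metric_jump_rich
begin

text \<open>For a vanishing jump measure the form norm is the \<open>L\<^sup>2\<close>-norm, so density in \<open>L\<^sup>2\<close> is the statement that every
  \<open>L\<^sup>2\<close>-function then lies in the domain.\<close>

lemma bounded_lim_in_F_null:
  assumes J0: "emeasure J (space J) = 0" and g: "\<And>n. g n \<in> F" "\<And>n x. x \<in> S \<Longrightarrow> \<bar>g n x\<bar> \<le> C"
    and lim: "\<And>x. x \<in> S \<Longrightarrow> (\<lambda>n. g n x) \<longlonglongrightarrow> h x"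
  shows "h \<in> F"
proof (rule F_dominated[where u=g and H="\<lambda>_. \<infinity>" and C=C])
  show "h \<in> borel_measurable m"
    by (rule borel_measurable_LIMSEQ_real[OF _ F_meas[OF g(1)]]) (use lim in \<open>simp add: space_m\<close>)
  show "(\<integral>\<^sup>+p. \<infinity> \<partial>J) < \<infinity>" using J0 by simp
qed (use g lim in \<open>auto simp: space_m\<close>)

text \<open>With \<delta> the distance to the complement, min(1, n \<delta>) is bounded Lipschitz
  and tends to the indicator. The Lipschitz constants grow with n, so \<open>blip_lim\<close> does
  not apply and the limit is taken for a vanishing J.\<close>

lemma indicator_open_in_F_null:
  assumes J0: "emeasure J (space J) = 0" and U: "openin mtopology U"
  shows "indicat_real U \<in> F"
\<comment> \<open>An empty complement has no distance function; in that case the indicator is 1 on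
  the space.\<close>
proof (cases "S - U = {}")
  case True
  have "U = S" using True openin_subset[OF U] by auto
  then have "indicat_real U x = 1" if "x \<in> S" for x using that by simp
  then show ?thesis
    using U by (intro F_cong_AE[OF F_const[of 1]] AE_I2) (auto simp: space_m sets_m intro!: borel_measurable_indicator openin_in_borel_of)
next
  case False
  define \<delta> where "\<delta> x = (INF z\<in>S - U. d x z)" for x
  have bdd: "bdd_below (d x ` (S - U))" for x by (rule bdd_belowI2[of _ 0]) simp
  have pos: "0 \<le> \<delta> x" for x unfolding \<delta>_def using False by (intro cINF_greatest) auto
  have tri: "\<delta> x \<le> \<delta> x' + d x x'" if "x \<in> S" "x' \<in> S" for x x'
  proof -
    have "\<delta> x - d x x' \<le> \<delta> x'"
      unfolding \<delta>_def[of x']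
    proof (rule cINF_greatest[OF False])
      fix z assume z: "z \<in> S - U"
      have "\<delta> x \<le> d x z" unfolding \<delta>_def using bdd z by (intro cINF_lower) auto
      also have "\<dots> \<le> d x x' + d x' z" using that z by (intro triangle) auto
      finally show "\<delta> x - d x x' \<le> d x' z" by simp
    qed
    then show ?thesis by simp
  qed
  have lip: "\<bar>\<delta> x - \<delta> x'\<bar> \<le> d x x'" if "x \<in> S" "x' \<in> S" for x x'
    using tri[OF that] tri[OF that(2,1)] commute[of x x'] by auto
  show ?thesis
  proof (rule bounded_lim_in_F_null[OF J0, where g="\<lambda>n x. min 1 (real n * \<delta> x)" and C=1])
    fix n
    have "blip S d (real n + 1) (\<lambda>x. min 1 (real n * \<delta> x))"
      unfolding blip_def
    proof (intro conjI ballI)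
      fix x assume x: "x \<in> S"
      show "\<bar>min 1 (real n * \<delta> x)\<bar> \<le> real n + 1" using pos[of x] by (auto simp: min_def)
      fix x' assume x': "x' \<in> S"
      have "\<bar>min 1 (real n * \<delta> x) - min 1 (real n * \<delta> x')\<bar> \<le> \<bar>real n * \<delta> x - real n * \<delta> x'\<bar>"
        by (auto simp: min_def)
      also have "\<dots> = real n * \<bar>\<delta> x - \<delta> x'\<bar>" by (simp add: abs_mult flip: right_diff_distrib)
      also have "\<dots> \<le> (real n + 1) * d x x'" using lip[OF x x'] by (intro mult_mono) auto
      finally show "\<bar>min 1 (real n * \<delta> x) - min 1 (real n * \<delta> x')\<bar> \<le> (real n + 1) * d x x'" .
    qed
    then show "(\<lambda>x. min 1 (real n * \<delta> x)) \<in> F" by (rule blip_in_F)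
    show "\<bar>min 1 (real n * \<delta> x)\<bar> \<le> 1" for x using pos[of x] by (auto simp: min_def)
  next
    fix x assume x: "x \<in> S"
    show "(\<lambda>n. min 1 (real n * \<delta> x)) \<longlonglongrightarrow> indicat_real U x"
    proof (cases "x \<in> U")
      case True
      then obtain r where r: "0 < r" "mball x r \<subseteq> U" using U unfolding openin_mtopology by blast
      have "r \<le> \<delta> x" unfolding \<delta>_def
        using r(2) x by (intro cINF_greatest[OF False]) (force simp: mball_def)
      with r have \<delta>: "0 < \<delta> x" by simp
      obtain N where N: "1 / \<delta> x < real N" using reals_Archimedean2 by blast
      have "min 1 (real n * \<delta> x) = 1" if "n \<ge> N" for n
      proof -
        have "1 / \<delta> x \<le> real n" using N that by linarith
        then show ?thesis using \<delta> by (simp add: field_simps min_def)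
      qed
      then have "\<forall>\<^sub>F n in sequentially. min 1 (real n * \<delta> x) = 1"
        by (auto simp: eventually_sequentially)
      then show ?thesis using True by (simp add: tendsto_eventually)
    next
      case False
      then have "\<delta> x \<le> d x x" unfolding \<delta>_def using bdd x by (intro cINF_lower) auto
      then have "\<delta> x = 0" using pos[of x] x by simp
      then show ?thesis using False by simp
    qed
  qed
qed

text \<open>Induction over the generation of the Borel sets: complements through 1 - 1_A, countable
  unions as bounded limits of finite maxima.\<close>

lemma indicator_in_F_null:
  assumes J0: "emeasure J (space J) = 0" and A: "A \<in> sets m"
  shows "indicat_real A \<in> F"
proof -
  have "A \<in> sigma_sets S {U. openin mtopology U}"
    using A by (simp add: sets_m sets_borel_of)
  then show ?thesis
  proof induction
    case (Basic U)
    then show ?case using indicator_open_in_F_null[OF J0] by simp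
  next
    case Empty
    then show ?case using F_const[of 0] by simp
  next
    case (Compl A)
    then have "A \<in> sets m" by (simp add: sets_m sets_borel_of)
    moreover have "(\<lambda>x. 1 - indicat_real A x) \<in> F" by (intro F_diff F_const Compl)
    ultimately show ?case
      by (rule_tac F_cong_AE[OF \<open>(\<lambda>x. 1 - indicat_real A x) \<in> F\<close>])
         (auto simp: space_m[symmetric] indicator_def intro!: AE_I2)
  next
    case (Union A)
    have fin: "indicat_real (\<Union>i\<le>n. A i) \<in> F" for n
    proof (induction n)
      case 0
      show ?case using Union(2)[of 0] by simp
    next
      case (Suc n)
      have "(\<lambda>x. max (indicat_real (\<Union>i\<le>n. A i) x) (indicat_real (A (Suc n)) x)) \<in> F"
        by (intro F_max Suc Union)
      moreover have "(\<lambda>x. max (indicat_real (\<Union>i\<le>n. A i) x) (indicat_real (A (Suc n)) x)) = indicat_real (\<Union>i\<le>Suc n. A i)"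
        by (auto simp: fun_eq_iff indicator_def atMost_Suc)
      ultimately show ?case by simp
    qed
    show ?case
    proof (rule bounded_lim_in_F_null[OF J0 fin, where C=1])
      show "(\<lambda>n. indicat_real (\<Union>i\<le>n. A i) x) \<longlonglongrightarrow> indicat_real (\<Union>i. A i) x" for x
      proof -
        have "incseq (\<lambda>n. \<Union>i\<le>n. A i)" by (rule incseq_SucI) (auto simp: atMost_Suc)
        moreover have "(\<Union>n. \<Union>i\<le>n. A i) = (\<Union>i. A i)" by auto
        ultimately show ?thesis using LIMSEQ_indicator_incseq[of "\<lambda>n. \<Union>i\<le>n. A i" x] by simp
      qed
    qed (auto simp: indicator_def)
  qed
qed

text \<open>For vanishing J, convergence in energy is convergence in L2. Simple functions with
  values of modulus at most 2 |f| approximate f, and the squared errors are dominated by (3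
  |f|)^2.\<close>

lemma L2_in_F_null:
  assumes J0: "emeasure J (space J) = 0" and f: "f \<in> L2 m"
  shows "f \<in> F"
proof -
  have [measurable]: "f \<in> borel_measurable m" and fi: "integrable m (\<lambda>x. (f x)\<^sup>2)"
    using f by (auto simp: L2_def)
  obtain s where s: "\<And>i. simple_function m (s i)" "\<And>x. x \<in> space m \<Longrightarrow> (\<lambda>i. s i x) \<longlonglongrightarrow> f x"
      "\<And>i x. x \<in> space m \<Longrightarrow> \<bar>s i x\<bar> \<le> 2 * \<bar>f x\<bar>"
    using borel_measurable_implies_sequence_metric[of f m 0] by (simp add: dist_real_def) metis
  have [measurable]: "s i \<in> borel_measurable m" for i by (rule borel_measurable_simple_function[OF s(1)])
  have sF: "s i \<in> F" for i
  proof -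
    have "(\<lambda>x. \<Sum>c\<in>C. c * indicat_real (s i -` {c} \<inter> space m) x) \<in> F" if "finite C" for C
      using that
    proof induction
      case empty show ?case using F_const[of 0] by simp
    next
      case (insert c C)
      have "indicat_real (s i -` {c} \<inter> space m) \<in> F"
        by (rule indicator_in_F_null[OF J0]) simp
      then show ?case unfolding sum.insert[OF insert(1,2)] by (intro F_add F_scale insert.IH)
    qed
    then have "(\<lambda>x. \<Sum>c\<in>s i ` space m. c * indicat_real (s i -` {c} \<inter> space m) x) \<in> F"
      using simple_functionD(1)[OF s(1)] by blast
    then show ?thesis
    proof (rule F_cong_AE[OF _ _ AE_I2])
      fix x assume x: "x \<in> space m"
      have "(\<Sum>c\<in>s i ` space m. c * indicat_real (s i -` {c} \<inter> space m) x) = (\<Sum>c\<in>s i ` space m. if c = s i x then c else 0)"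
        using x by (intro sum.cong) (auto simp: indicator_def)
      also have "\<dots> = s i x" using x simple_functionD(1)[OF s(1)] by (simp add: sum.delta')
      finally show "(\<Sum>c\<in>s i ` space m. c * indicat_real (s i -` {c} \<inter> space m) x) = s i x" .
    qed simp
  qed
  have "(\<lambda>i. \<integral>\<^sup>+x. ennreal ((f x - s i x)\<^sup>2) \<partial>m) \<longlonglongrightarrow> (\<integral>\<^sup>+x. 0 \<partial>m)"
  proof (rule nn_integral_dominated_convergence[where w="\<lambda>x. ennreal (9 * (f x)\<^sup>2)"])
    show "AE x in m. ennreal ((f x - s j x)\<^sup>2) \<le> ennreal (9 * (f x)\<^sup>2)" for j
    proof (intro AE_I2 ennreal_leI)
      fix x assume "x \<in> space m"
      then have "\<bar>f x - s j x\<bar> \<le> \<bar>3 * f x\<bar>" using s(3)[of x j] by linarith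
      then show "(f x - s j x)\<^sup>2 \<le> 9 * (f x)\<^sup>2" by (simp add: abs_le_square_iff power_mult_distrib)
    qed
    show "AE x in m. (\<lambda>i. ennreal ((f x - s i x)\<^sup>2)) \<longlonglongrightarrow> 0"
    proof (rule AE_I2)
      fix x assume "x \<in> space m"
      then have "(\<lambda>i. ennreal ((f x - s i x)\<^sup>2)) \<longlonglongrightarrow> ennreal ((f x - f x)\<^sup>2)"
        by (intro tendsto_intros s)
      then show "(\<lambda>i. ennreal ((f x - s i x)\<^sup>2)) \<longlonglongrightarrow> 0" by simp
    qed
    show "(\<integral>\<^sup>+x. ennreal (9 * (f x)\<^sup>2) \<partial>m) < \<infinity>"
      using fi by (simp add: nn_integral_eq_integral)
  qed simp_all
  moreover have "(\<integral>\<^sup>+p. g p \<partial>J) = 0" for g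
  proof -
    have "AE p in J. g p = 0" using J0 by (intro AE_I'[of "space J"]) auto
    then show ?thesis by (subst nn_integral_cong_AE[where v="\<lambda>_. 0"]) auto
  qed
  ultimately have "(\<lambda>i. energy m J (\<lambda>x. f x - s i x)) \<longlonglongrightarrow> 0"
    by (simp add: energy_def)
  then show ?thesis by (rule F_closed_lim[OF _ sF, rotated]) simp
qed

text \<open>Replacing J by \<open>null_measure J\<close> can only lower energies, so the truncated
  distances stay in the closure and the preceding results apply. The approximant they give is taken
  from the core D, which is the same for both jump measures.\<close>

lemma L2_dense:
  assumes f: "f \<in> L2 m" and e: "0 < e"
  shows "\<exists>g\<in>F. L2dist m f g < e"
proof -
  have en: "energy m (null_measure J) h \<le> energy m J h" for h
    by (simp add: energy_def)
  interpret N: metric_jump m S d "null_measure J" D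
  proof unfold_locales
    show "null_sets (m \<Otimes>\<^sub>M m) \<subseteq> null_sets (null_measure J)"
      using null_J by (auto simp: null_sets_def)
  qed (auto simp: sets_m sets_J blip_D lin_D const_D sqrt_D)
  interpret N: metric_jump_rich m S d "null_measure J" D y
  proof unfold_locales
    fix z assume "z \<in> S"
    then have z: "(\<lambda>x. min 1 (d x z)) \<in> F" by (rule d_min_F)
    show "(\<lambda>x. min 1 (d x z)) \<in> energy_closure m (null_measure J) D"
      using F_meas[OF z] F_approx[OF z] le_less_trans[OF en] by (fastforce simp: energy_closure_def)
  qed (use y_in y_dense in auto)
  have "f \<in> energy_closure m (null_measure J) D"
    by (rule N.L2_in_F_null[OF _ f]) simp
  then obtain u where u: "u \<in> D" "energy m (null_measure J) (\<lambda>x. f x - u x) < ennreal (e\<^sup>2)"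
    using e unfolding energy_closure_def by (auto dest!: spec[of _ "e\<^sup>2"])
  have [measurable]: "f \<in> borel_measurable m" "u \<in> borel_measurable m"
    using f D_meas[OF u(1)] by (auto simp: L2_def)
  have "integrable m (\<lambda>x. (f x - u x)\<^sup>2)"
    using f D_sq_integrable[OF u(1)] by (intro integrable_sq_diff) (auto simp: L2_def)
  then have "(\<integral>x. (f x - u x)\<^sup>2 \<partial>m) < e\<^sup>2"
    using u(2) by (simp add: energy_def nn_integral_eq_integral ennreal_less_iff)
  then have "L2dist m f u < e" unfolding L2dist_def using e by (intro real_less_lsqrt) auto
  then show ?thesis using D_subset_F[OF u(1)] by blast
qed

lemma energy_mono:
  assumes "\<And>x. x \<in> S \<Longrightarrow> \<bar>f x\<bar> \<le> \<bar>g x\<bar>" "\<And>p. p \<in> S \<times> S \<Longrightarrow> \<bar>jmp f p\<bar> \<le> \<bar>jmp g p\<bar>"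
  shows "energy m J f \<le> energy m J g"
  unfolding energy_def
  by (intro add_mono nn_integral_mono ennreal_leI abs_le_square_iff[THEN iffD1] assms) (auto simp: space_m space_J)

text \<open>The squared jump of a supremum is at most the sum of the squared jumps, which dominates the finite suprema.\<close>

lemma sup_in_F:
  assumes b: "\<And>j. b j \<in> F" "\<And>j x. x \<in> S \<Longrightarrow> 0 \<le> b j x" "\<And>j x. x \<in> S \<Longrightarrow> b j x \<le> 1"
    and fin: "(\<Sum>j. energy m J (b j)) < \<infinity>"
  obtains f where "f \<in> F" "\<And>j x. x \<in> S \<Longrightarrow> b j x \<le> f x" "energy m J f \<le> (\<Sum>j. energy m J (b j))"
proof -
  have [measurable]: "b j \<in> borel_measurable m" for j by (rule F_meas[OF b(1)])
  \<comment> \<open>The finite suprema, written as negated running minima in order to reuse the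
    results on \<open>run_min\<close>.\<close>
  define a where "a n x = - 1 * run_min (\<lambda>i. - 1 * b i x) n" for n x
  define f where "f x = (SUP j. b j x)" for x
  have bdd: "bdd_above (range (\<lambda>j. b j x))" if "x \<in> S" for x
    using b(3)[OF that] by (auto intro!: bdd_aboveI)
  have aF: "a n \<in> F" for n unfolding a_def by (intro F_scale F_run_min b(1))
  note [measurable] = F_meas[OF aF]
  have up: "b j x \<le> f x" if "x \<in> S" for j x unfolding f_def by (rule cSUP_upper[OF _ bdd[OF that]]) simp
  have lim: "(\<lambda>n. a n x) \<longlonglongrightarrow> f x" if x: "x \<in> S" for x
  proof -
    have "run_min (\<lambda>i. - 1 * b i x) \<longlonglongrightarrow> - f x"
    proof (rule run_min_tendsto)
      show "- f x \<le> - 1 * b i x" for i using up[OF x] by simp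
      fix e :: real assume "0 < e"
      then have "f x - e < f x" by simp
      then obtain i where "f x - e < b i x" unfolding f_def using less_cSUP_iff[OF _ bdd[OF x]] by auto
      then show "\<exists>i. - 1 * b i x \<le> - f x + e" by (intro exI[of _ i]) simp
    qed
    from tendsto_minus[OF this] show ?thesis by (simp add: a_def)
  qed
  have [measurable]: "f \<in> borel_measurable m"
    by (rule borel_measurable_LIMSEQ_real[of m a]) (use lim in \<open>simp_all add: space_m\<close>)
  define H where "H p = (\<Sum>j. ennreal ((jmp (b j) p)\<^sup>2))" for p
  have [measurable]: "H \<in> borel_measurable J" unfolding H_def by measurable
  have aH: "ennreal ((jmp (a n) p)\<^sup>2) \<le> H p" for n p
  proof -
    obtain i where "\<bar>run_min (\<lambda>i. - 1 * b i (fst p)) n - run_min (\<lambda>i. - 1 * b i (snd p)) n\<bar> \<le> \<bar>- 1 * b i (fst p) - - 1 * b i (snd p)\<bar>"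
      using run_min_diff_attained by blast
    then have "\<bar>jmp (a n) p\<bar> \<le> \<bar>jmp (b i) p\<bar>" by (simp add: jmp_def a_def abs_minus_commute)
    then have "ennreal ((jmp (a n) p)\<^sup>2) \<le> ennreal ((jmp (b i) p)\<^sup>2)"
      by (intro ennreal_leI abs_le_square_iff[THEN iffD1])
    also have "\<dots> \<le> H p" unfolding H_def by (rule ennreal_le_suminf)
    finally show ?thesis .
  qed
  have aB: "ennreal ((a n x)\<^sup>2) \<le> (\<Sum>j. ennreal ((b j x)\<^sup>2))" for n x
  proof -
    obtain i where "run_min (\<lambda>i. - 1 * b i x) n = - 1 * b i x" using run_min_attained by blast
    then have "ennreal ((a n x)\<^sup>2) = ennreal ((b i x)\<^sup>2)" by (simp add: a_def)
    also have "\<dots> \<le> (\<Sum>j. ennreal ((b j x)\<^sup>2))" by (rule ennreal_le_suminf)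
    finally show ?thesis .
  qed
  have sum: "(\<integral>\<^sup>+x. (\<Sum>j. ennreal ((b j x)\<^sup>2)) \<partial>m) + (\<integral>\<^sup>+p. H p \<partial>J) = (\<Sum>j. energy m J (b j))"
    unfolding H_def energy_def by (simp add: nn_integral_suminf suminf_add)
  have en: "energy m J (a n) \<le> (\<Sum>j. energy m J (b j))" for n
  proof -
    have "energy m J (a n) \<le> (\<integral>\<^sup>+x. (\<Sum>j. ennreal ((b j x)\<^sup>2)) \<partial>m) + (\<integral>\<^sup>+p. H p \<partial>J)"
      unfolding energy_def by (intro add_mono nn_integral_mono aB aH)
    then show ?thesis unfolding sum .
  qed
  have ab: "\<bar>a n x\<bar> \<le> 1" if "x \<in> S" for n x
    unfolding a_def using b(2,3)[OF that] run_min_abs_le[of n "\<lambda>i. - 1 * b i x" 1] by simp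
  have "f \<in> F"
  proof (rule F_dominated[where u=a and H=H and C=1])
    show "AE p in J. ennreal ((jmp (a n) p)\<^sup>2) \<le> H p" for n by (intro AE_I2 aH)
    have "(\<integral>\<^sup>+p. H p \<partial>J) \<le> (\<Sum>j. energy m J (b j))" unfolding sum[symmetric] by simp
    then show "(\<integral>\<^sup>+p. H p \<partial>J) < \<infinity>" using fin by (rule le_less_trans)
  qed (use aF ab lim in \<open>auto simp: space_m\<close>)
  moreover have "energy m J f \<le> (\<Sum>j. energy m J (b j))"
    by (rule energy_Fatou[of a f 0]) (use lim en in \<open>auto simp: space_m\<close>)
  ultimately show ?thesis using up that by blast
qed

section \<open>Capacity, compact nests and quasi-regularity\<close>

lemma cap1_le_energy:
  assumes "f \<in> F" "openin mtopology U" "A \<subseteq> U" "\<And>x. x \<in> U \<Longrightarrow> 1 \<le> f x"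
  shows "cap1 m mtopology F EF A \<le> energy m J f"
proof -
  have "cap1 m mtopology F EF A \<le> ennreal (E1 m EF f f)"
    unfolding cap1_def
    by (rule INF_lower2[where i=U]) (use assms in \<open>auto intro!: INF_lower AE_I2\<close>)
  then show ?thesis by (simp add: E1_eq(1)[OF assms(1)])
qed

lemma cap1_empty: "cap1 m mtopology F EF {} = 0"
  using cap1_le_energy[OF F_const[of 0], of "{}" "{}"] by simp

text \<open>The constant nest consisting of the whole space will do: its complement is empty and has
  capacity 0.\<close>

lemma continuous_quasi_continuous:
  assumes "continuous_map mtopology euclideanreal g"
  shows "quasi_continuous m mtopology F EF g"
  unfolding quasi_continuous_def
proof (intro exI[of _ "\<lambda>k. S"] conjI allI)
  show "nest m mtopology F EF (\<lambda>k. S)"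
    using closedin_topspace[of mtopology] by (simp add: nest_def incseq_def cap1_empty)
  show "continuous_map (subtopology mtopology S) euclideanreal g"
    using assms by (rule continuous_map_from_subtopology)
qed

text \<open>w n is the truncated distance to the first n + 1 dense points and tends to 0 in energy.
  Along a fast subsequence, K k collects the points with w (N j) \<le> 2^-j for all j \<ge> k. It is
  closed and totally bounded, hence compact by completeness. Off K k the supremum of min(1, 2^j w (N
  j)) over j \<ge> k reaches 1, and its energy is at most 2^-k.\<close>

lemma compact_nest:
  assumes compl: mcomplete
  shows "\<exists>K. nest m mtopology F EF K \<and> (\<forall>k. compactin mtopology (K k))"
proof -
  define w where "w n x = run_min (\<lambda>i. min 1 (d x (y i))) n" for n x
  have wb: "blip S d 1 (w n)" for n
    unfolding w_def by (intro blip_run_min blip_d_min y_in)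
  have wF: "w n \<in> F" for n by (rule blip_in_F[OF wb])
  have w0: "0 \<le> w n x" for n x unfolding w_def by (rule run_min_greatest) simp
  have lim: "(\<lambda>n. w n x) \<longlonglongrightarrow> 0" if x: "x \<in> S" for x
    unfolding w_def
  proof (rule run_min_tendsto)
    fix e :: real assume "0 < e"
    then obtain i where "d x (y i) < e" using y_dense[OF x] by blast
    then show "\<exists>i. min 1 (d x (y i)) \<le> 0 + e" by (intro exI[of _ i]) simp
  qed simp
  have "(\<lambda>n. energy m J (\<lambda>x. 0 - w n x)) \<longlonglongrightarrow> 0"
  proof (rule energy_dominated[where H="dom 1" and C=1])
    show "AE p in J. ennreal ((jmp (w n) p)\<^sup>2) \<le> dom 1 p" for n by (intro AE_I2 jmp_dom wb)
  qed (use lim wF wb dom_int in \<open>auto simp: space_m blip_def F_meas\<close>)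
  then have en: "(\<lambda>n. energy m J (w n)) \<longlonglongrightarrow> 0"
    by (simp only: energy_minus[of "\<lambda>x. 0"] diff_zero)
  \<comment> \<open>The factor 2^j multiplies the energy by 4^j, which a large n compensates as j is
    fixed.\<close>
  have "\<exists>n. energy m J (\<lambda>x. 2 ^ j * w n x) < ennreal ((1/2) ^ Suc j)" for j
  proof -
    have "(\<lambda>n. ennreal ((2 ^ j)\<^sup>2) * energy m J (w n)) \<longlonglongrightarrow> ennreal ((2 ^ j)\<^sup>2) * 0"
      by (intro ennreal_tendsto_cmult en) simp
    then have "(\<lambda>n. energy m J (\<lambda>x. 2 ^ j * w n x)) \<longlonglongrightarrow> 0"
      by (simp add: energy_scale[OF F_meas[OF wF]])
    from order_tendstoD(2)[OF this, of "ennreal ((1/2) ^ Suc j)"] show ?thesis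
      by (auto simp: eventually_sequentially)
  qed
  then obtain N where N: "\<And>j. energy m J (\<lambda>x. 2 ^ j * w (N j) x) < ennreal ((1/2) ^ Suc j)" by metis
  define b where "b j x = min 1 (2 ^ j * w (N j) x)" for j x
  have bF: "b j \<in> F" for j unfolding b_def by (intro F_min F_const F_scale wF)
  have b01: "0 \<le> b j x" "b j x \<le> 1" for j x unfolding b_def using w0 by auto
  have ben: "energy m J (b j) \<le> ennreal ((1/2) ^ Suc j)" for j
  proof -
    have "energy m J (b j) \<le> energy m J (\<lambda>x. 2 ^ j * w (N j) x)"
    proof (rule energy_mono)
      show "\<bar>b j x\<bar> \<le> \<bar>2 ^ j * w (N j) x\<bar>" for x unfolding b_def using w0[of "N j" x] by (auto simp: min_def)
      show "\<bar>jmp (b j) p\<bar> \<le> \<bar>jmp (\<lambda>x. 2 ^ j * w (N j) x) p\<bar>" for p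
        unfolding b_def jmp_def by (auto simp: min_def)
    qed
    then show ?thesis using N[of j] by simp
  qed
  define K where "K k = {x \<in> S. \<forall>j\<ge>k. w (N j) x \<le> (1/2) ^ j}" for k
  have Kclosed: "closedin mtopology (K k)" for k
  proof -
    have "closedin mtopology (\<Inter>j\<in>{k..}. {x \<in> topspace mtopology. w (N j) x \<in> {..(1/2) ^ j}})"
      by (intro closedin_INT closedin_continuous_map_preimage[OF blip_continuous[OF wb]]) auto
    also have "(\<Inter>j\<in>{k..}. {x \<in> topspace mtopology. w (N j) x \<in> {..(1/2) ^ j}}) = K k"
      by (auto simp: K_def)
    finally show ?thesis .
  qed
  have Kcompact: "compactin mtopology (K k)" for k
  proof -
    have "mtotally_bounded (K k)"
      unfolding mtotally_bounded_def
    proof (intro allI impI)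
      fix e :: real assume e: "0 < e"
      obtain j0 where "(1/2::real) ^ j0 < min 1 (e / 2)" using real_arch_pow_inv[of "min 1 (e/2)" "1/2"] e by auto
      moreover have "(1/2::real) ^ max j0 k \<le> (1/2) ^ j0" by (rule power_decreasing) auto
      ultimately obtain j where j: "j \<ge> k" "(1/2::real) ^ j < min 1 (e / 2)" by (metis le_less_trans max.cobounded2)
      \<comment> \<open>\<open>mtotally_bounded\<close> asks for centres inside K k. So y i is
        replaced by a point of K k within e/2 of it, if there is one, and balls of radius e still
        cover.\<close>
      define z where "z i = (SOME x. x \<in> K k \<and> d x (y i) < e / 2)" for i
      let ?I = "{i. i \<le> N j \<and> (\<exists>x. x \<in> K k \<and> d x (y i) < e / 2)}"
      have z: "z i \<in> K k" "d (z i) (y i) < e / 2" if "i \<in> ?I" for i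
        using someI_ex[of "\<lambda>x. x \<in> K k \<and> d x (y i) < e / 2"] that unfolding z_def by auto
      have "K k \<subseteq> (\<Union>x\<in>z ` ?I. mball x e)"
      proof
        fix x assume x: "x \<in> K k"
        then have "w (N j) x < min 1 (e / 2)" using j by (auto simp: K_def)
        moreover obtain i where i: "i \<le> N j" "w (N j) x = min 1 (d x (y i))"
          using run_min_attained unfolding w_def by blast
        ultimately have di: "d x (y i) < e / 2" by (auto simp: min_def split: if_splits)
        then have iI: "i \<in> ?I" using x i by blast
        have xS: "x \<in> S" "z i \<in> S" using x z(1)[OF iI] by (auto simp: K_def)
        have "d (z i) x \<le> d (z i) (y i) + d (y i) x" by (intro triangle xS y_in)
        also have "\<dots> < e" using z(2)[OF iI] di commute[of x "y i"] by simp
        finally show "x \<in> (\<Union>x\<in>z ` ?I. mball x e)" using iI xS by (auto simp: mball_def)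
      qed
      moreover have "finite (z ` ?I)" by simp
      moreover have "z ` ?I \<subseteq> K k" using z(1) by auto
      ultimately show "\<exists>L. finite L \<and> L \<subseteq> K k \<and> K k \<subseteq> (\<Union>x\<in>L. mball x e)" by blast
    qed
    then show ?thesis
      using mtotally_bounded_eq_compact_closure_of[OF compl] closure_of_closedin[OF Kclosed[of k]] by simp
  qed
  have cap: "cap1 m mtopology F EF (S - K k) \<le> ennreal ((1/2) ^ k)" for k
  proof -
    \<comment> \<open>The exponent \<open>Suc j\<close> in the choice of N makes the tail from k on
      sum to exactly 2^-k.\<close>
    have "(\<lambda>j. (1/2::real) ^ k * (1/2) ^ Suc j) sums ((1/2) ^ k * 1)"
      by (intro sums_mult power_half_series)
    then have s: "(\<lambda>j. (1/2::real) ^ Suc (k + j)) sums (1/2) ^ k" by (simp add: power_add mult.left_commute)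
    have "(\<Sum>j. energy m J (b (k + j))) \<le> (\<Sum>j. ennreal ((1/2) ^ Suc (k + j)))"
      by (intro suminf_le ben) auto
    also have "\<dots> = ennreal ((1/2) ^ k)"
      using s by (subst suminf_ennreal2) (auto simp: sums_iff)
    finally have le: "(\<Sum>j. energy m J (b (k + j))) \<le> ennreal ((1/2) ^ k)" .
    then have "(\<Sum>j. energy m J (b (k + j))) < \<infinity>" by (rule le_less_trans) simp
    then obtain f where f: "f \<in> F" "\<And>j x. x \<in> S \<Longrightarrow> b (k + j) x \<le> f x"
        "energy m J f \<le> (\<Sum>j. energy m J (b (k + j)))"
      using sup_in_F[of "\<lambda>j. b (k + j)", OF bF b01] by metis
    have "1 \<le> f x" if x: "x \<in> S - K k" for x
    proof -
      obtain j where j: "j \<ge> k" "(1/2) ^ j < w (N j) x" using x by (auto simp: K_def not_le)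
      have "1 = 2 ^ j * (1/2::real) ^ j" by (simp flip: power_mult_distrib)
      also have "\<dots> < 2 ^ j * w (N j) x" using j(2) by simp
      finally have "b (k + (j - k)) x = 1" using j(1) by (simp add: b_def)
      then show ?thesis using f(2)[of x "j - k"] x by simp
    qed
    \<comment> \<open>The complement is open, so it is its own open neighbourhood in the definition
      of the capacity.\<close>
    moreover have "openin mtopology (S - K k)" using Kclosed[of k] by (simp add: closedin_def)
    ultimately have "cap1 m mtopology F EF (S - K k) \<le> energy m J f"
      by (intro cap1_le_energy f(1)) auto
    then show ?thesis using f(3) le by order
  qed
  have "nest m mtopology F EF K"
    unfolding nest_def
  proof (intro conjI allI Kclosed)
    show "incseq K" by (rule incseq_SucI) (auto simp: K_def)
    have "(\<lambda>k. ennreal ((1/2) ^ k)) \<longlonglongrightarrow> ennreal 0"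
      by (intro tendsto_ennrealI LIMSEQ_power_zero) simp
    then have l: "(\<lambda>k. ennreal ((1/2) ^ k)) \<longlonglongrightarrow> 0" by simp
    have "(\<lambda>k. cap1 m mtopology F EF (S - K k)) \<longlonglongrightarrow> 0"
      by (rule tendsto_sandwich[OF always_eventually always_eventually[OF allI[OF cap]] tendsto_const l]) simp
    then show "(\<lambda>k. cap1 m mtopology F EF (topspace mtopology - K k)) \<longlonglongrightarrow> 0" by simp
  qed
  with Kcompact show ?thesis by blast
qed

theorem quasi_regular_dirichlet_form:
  assumes compl: mcomplete
  shows "closable_form m D (jump_form J)" "dirichlet_form m (closure_dom m D (jump_form J)) EF"
    "quasi_regular m mtopology (closure_dom m D (jump_form J)) EF"
proof -
  show "closable_form m D (jump_form J)" by (rule closable_jump_form)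
  show "dirichlet_form m (closure_dom m D (jump_form J)) EF"
    by (rule dirichlet_form_closure[OF L2_dense])
  show "quasi_regular m mtopology (closure_dom m D (jump_form J)) EF"
    unfolding quasi_regular_def closure_dom_eq
  proof (intro conjI)
    show "\<exists>K. nest m mtopology F EF K \<and> (\<forall>k. compactin mtopology (K k))"
      by (rule compact_nest[OF compl])
    show "\<exists>D0\<subseteq>F. (\<forall>f\<in>F. \<forall>e>0. \<exists>g\<in>D0. sqrt (E1 m EF (diff_fun f g) (diff_fun f g)) < e) \<and>
        (\<forall>g\<in>D0. has_qc_version m mtopology F EF g)"
    \<comment> \<open>The core itself serves: it is dense in energy by construction of the closure
      and consists of continuous functions.\<close>
    proof (intro exI[of _ D] conjI ballI allI impI)
      show "D \<subseteq> F" using D_subset_F by blast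
      fix f and e :: real assume f: "f \<in> F" and e: "0 < e"
      obtain g where g: "g \<in> D" "energy m J (\<lambda>x. f x - g x) < ennreal (e\<^sup>2)"
        using F_approx[OF f, of "e\<^sup>2"] e by auto
      have fg: "(\<lambda>x. f x - g x) \<in> F" by (intro F_diff f D_subset_F g)
      have "enn2real (energy m J (\<lambda>x. f x - g x)) < e\<^sup>2"
        using g(2) by (cases "energy m J (\<lambda>x. f x - g x)") (auto simp: ennreal_less_iff)
      then have "sqrt (E1 m EF (diff_fun f g) (diff_fun f g)) < e"
        using e unfolding diff_fun_def E1_eq(2)[OF fg] by (intro real_less_lsqrt) auto
      then show "\<exists>g\<in>D. sqrt (E1 m EF (diff_fun f g) (diff_fun f g)) < e" using g(1) by blast
    next
      fix g assume "g \<in> D"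
      then obtain C where "blip S d C g" using blip_D by blast
      then show "has_qc_version m mtopology F EF g"
        unfolding has_qc_version_def
        by (intro exI[of _ g] conjI continuous_quasi_continuous blip_continuous) auto
    qed
    show "\<exists>(u::nat \<Rightarrow> 'a \<Rightarrow> real) v N. (\<forall>n. u n \<in> F \<and> quasi_continuous m mtopology F EF (v n) \<and> (AE x in m. v n x = u n x)) \<and>
        N \<subseteq> topspace mtopology \<and> cap1 m mtopology F EF N = 0 \<and>
        (\<forall>x\<in>topspace mtopology - N. \<forall>y\<in>topspace mtopology - N. x \<noteq> y \<longrightarrow> (\<exists>n. v n x \<noteq> v n y))"
    \<comment> \<open>Truncated distances to the dense sequence are continuous and separate all
      points, so the exceptional set is empty.\<close>
    proof (intro exI[of _ "\<lambda>n x. min 1 (d x (y n))"] exI[of _ "{}"] conjI allI ballI impI)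
      fix n
      show "(\<lambda>x. min 1 (d x (y n))) \<in> F" by (intro d_min_F y_in)
      show "quasi_continuous m mtopology F EF (\<lambda>x. min 1 (d x (y n)))"
        by (intro continuous_quasi_continuous blip_continuous[OF blip_d_min] y_in)
      show "AE x in m. min 1 (d x (y n)) = min 1 (d x (y n))" by simp
    next
      fix x z assume "x \<in> topspace mtopology - {}" "z \<in> topspace mtopology - {}" and ne: "x \<noteq> z"
      then have xz: "x \<in> S" "z \<in> S" by auto
      then have dp: "0 < d x z" using ne by simp
      \<comment> \<open>With r = min(1, d x z), the point y n is closer than r/2 to x and therefore
        farther than r/2 from z; as r/2 < 1, truncation keeps the two values apart.\<close>
      then obtain n where n: "d x (y n) < min 1 (d x z) / 2" using y_dense[OF xz(1), of "min 1 (d x z) / 2"] by auto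
      have "d x z \<le> d x (y n) + d (y n) z" by (intro triangle xz y_in)
      then have "min 1 (d x (y n)) \<noteq> min 1 (d z (y n))"
        using n commute[of z "y n"] by (auto simp: min_def split: if_splits)
      then show "\<exists>n. min 1 (d x (y n)) \<noteq> min 1 (d z (y n))" by blast
    qed (auto simp: cap1_empty)
  qed
qed

end

section \<open>The total variation metric\<close>

text \<open>The V n are the finite unions from a countable basis. Outer regularity encloses A in an
  open U with small excess, and continuity from below replaces U by a finite union. The sequence is
  fixed before the measure, because it is applied to a measure that depends on the pair of measures
  under comparison.\<close>

lemma countable_open_approximation:
  "\<exists>V::nat \<Rightarrow> 'a::polish_space set. (\<forall>n. open (V n)) \<and>
     (\<forall>M A e. sets M = sets borel \<longrightarrow> finite_measure M \<longrightarrow> A \<in> sets borel \<longrightarrow> 0 < e \<longrightarrow>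
        (\<exists>n. measure M ((A - V n) \<union> (V n - A)) < e))"
proof -
  obtain B :: "'a set set" where B: "countable B" "topological_basis B" using ex_countable_basis by blast
  define W where "W = {F. F \<subseteq> B \<and> finite F}"
  have W: "countable W" "W \<noteq> {}"
    unfolding W_def using countable_Collect_finite_subset[OF B(1)] by (auto simp: conj_commute)
  define V where "V n = \<Union> (from_nat_into W n)" for n
  have Vopen: "open (V n)" for n
    unfolding V_def using from_nat_into[OF W(2), of n] topological_basis_open[OF B(2)]
    by (auto simp: W_def intro!: open_Union)
  have ap: "\<exists>n. measure M ((A - V n) \<union> (V n - A)) < e"
    if sM: "sets M = sets borel" and fM: "finite_measure M" and A: "A \<in> sets borel" and e: "0 < e" for M A e
  proof -
    interpret finite_measure M by fact
    note [measurable_cong] = sM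
    have "emeasure M A < emeasure M A + ennreal (e / 2)"
      using e by (simp add: emeasure_eq_measure ennreal_less_iff flip: ennreal_plus)
    then have "(INF U \<in> {U. A \<subseteq> U \<and> open U}. emeasure M U) < emeasure M A + ennreal (e / 2)"
      using outer_regular[OF sM _ A] by simp
    then obtain U where U: "A \<subseteq> U" "open U" "emeasure M U < emeasure M A + ennreal (e / 2)"
      unfolding INF_less_iff by blast
    have UM [measurable]: "U \<in> sets M" "A \<in> sets M" using U(2) A sM by auto
    have "measure M U < measure M A + e / 2"
      using U(3) e by (simp add: emeasure_eq_measure ennreal_less_iff flip: ennreal_plus)
    then have UA: "measure M (U - A) < e / 2" using U(1) by (simp add: finite_measure_Diff)
    obtain B' where B': "B' \<subseteq> B" "U = \<Union> B'" using B(2) U(2) unfolding topological_basis_def by metis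
    \<comment> \<open>Inserting {} makes the enumeration legitimate for an empty B'. It is removed
      again below, because {} may not belong to the basis.\<close>
    define Q where "Q n = \<Union> (from_nat_into (insert {} B') ` {..n})" for n
    have cB': "countable (insert {} B')" using B' B(1) countable_subset by auto
    have el: "from_nat_into (insert {} B') i \<in> insert {} B'" for i by (rule from_nat_into) simp
    have "incseq Q" unfolding Q_def by (rule incseq_SucI) (auto simp: atMost_Suc)
    have QU: "(\<Union>n. Q n) = U"
    proof -
      have "(\<Union>n. Q n) = \<Union> (range (from_nat_into (insert {} B')))" by (auto simp: Q_def)
      also have "\<dots> = \<Union> (insert {} B')" using cB' by (simp only: range_from_nat_into[OF insert_not_empty])
      finally show ?thesis using B'(2) by simp
    qed
    have Qopen: "open (Q n)" for n
    proof -
      have "open X" if "X \<in> insert {} B'" for X using that B'(1) topological_basis_open[OF B(2)] by auto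
      then show ?thesis unfolding Q_def using el by (intro open_Union) auto
    qed
    then have "range Q \<subseteq> sets M" using sM by auto
    then have "(\<lambda>n. measure M (Q n)) \<longlonglongrightarrow> measure M U"
      using finite_Lim_measure_incseq[OF _ \<open>incseq Q\<close>] by (simp add: QU)
    then have "\<forall>\<^sub>F n in sequentially. measure M U - e / 2 < measure M (Q n)"
      using e by (intro order_tendstoD) auto
    then obtain n where n: "measure M U - e / 2 < measure M (Q n)" by (auto simp: eventually_sequentially)
    have [measurable]: "Q n \<in> sets M" using Qopen sM by auto
    have "Q n \<subseteq> U" using QU by blast
    then have UQ: "measure M (U - Q n) < e / 2" using n by (simp add: finite_measure_Diff)
    have "from_nat_into (insert {} B') ` {..n} - {{}} \<in> W" using el B'(1) by (auto simp: W_def)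
    then obtain k where "from_nat_into W k = from_nat_into (insert {} B') ` {..n} - {{}}"
      using from_nat_into_surj[OF W(1)] by blast
    then have Vk: "V k = Q n" by (auto simp: V_def Q_def)
    have "measure M ((A - V k) \<union> (V k - A)) \<le> measure M ((U - A) \<union> (U - Q n))"
      using U(1) \<open>Q n \<subseteq> U\<close> by (intro finite_measure_mono) (auto simp: Vk)
    also have "\<dots> \<le> measure M (U - A) + measure M (U - Q n)" by (rule measure_Un_le) auto
    also have "\<dots> < e" using UA UQ by simp
    finally show ?thesis by blast
  qed
  show ?thesis using Vopen ap by blast
qed

text \<open>Real-valued form of the derivative; for the finite measures considered nothing is lost,
  since theirs is finite almost everywhere.\<close>

definition dens :: "'a measure \<Rightarrow> 'a measure \<Rightarrow> 'a \<Rightarrow> real" where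
  "dens lam \<mu> x = enn2real (RN_deriv lam \<mu> x)"

lemma rho_var_dens: "rho_var lam \<mu> \<nu> = (\<integral>x. \<bar>dens lam \<mu> x - dens lam \<nu> x\<bar> \<partial>lam)"
  by (simp add: rho_var_def dens_def)

locale ac_space = sigma_finite_measure lam for lam :: "'a::polish_space measure" +
  assumes sets_lam [measurable_cong]: "sets lam = sets borel"
begin

lemma space_lam [simp]: "space lam = UNIV"
  using sets_eq_imp_space_eq[OF sets_lam] by simp

abbreviation "ac \<equiv> ac_part lam fin_measures"

lemma acD:
  assumes "\<mu> \<in> ac"
  shows "sets \<mu> = sets borel" "finite_measure \<mu>" "absolutely_continuous lam \<mu>" "space \<mu> = UNIV"
  using assms sets_eq_imp_space_eq[of \<mu> borel] by (auto simp: ac_part_def fin_measures_def)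

lemma dens_meas [measurable]: "dens lam \<mu> \<in> borel_measurable lam"
  unfolding dens_def by measurable

lemma dens_nonneg [simp]: "0 \<le> dens lam \<mu> x"
  by (simp add: dens_def)

lemma density_dens:
  assumes \<mu>: "\<mu> \<in> ac"
  shows "density lam (\<lambda>x. ennreal (dens lam \<mu> x)) = \<mu>"
proof -
  interpret \<mu>: finite_measure \<mu> using acD[OF \<mu>] by simp
  have "AE x in lam. RN_deriv lam \<mu> x \<noteq> \<infinity>"
    by (rule RN_deriv_finite) (use acD[OF \<mu>] sets_lam in \<open>auto intro: \<mu>.sigma_finite_measure_axioms\<close>)
  then have "density lam (\<lambda>x. ennreal (dens lam \<mu> x)) = density lam (RN_deriv lam \<mu>)"
    by (intro density_cong) (auto simp: dens_def less_top elim!: AE_mp)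
  also have "\<dots> = \<mu>" by (rule density_RN_deriv) (use acD[OF \<mu>] sets_lam in auto)
  finally show ?thesis .
qed

lemma integral_ac:
  fixes f :: "'a \<Rightarrow> real"
  assumes \<mu>: "\<mu> \<in> ac" and [measurable]: "f \<in> borel_measurable borel"
  shows "(\<integral>x. f x \<partial>\<mu>) = (\<integral>x. dens lam \<mu> x * f x \<partial>lam)"
  using integral_density[of f lam "dens lam \<mu>"] by (simp add: density_dens[OF \<mu>])

lemma integrable_dens:
  assumes \<mu>: "\<mu> \<in> ac" shows "integrable lam (dens lam \<mu>)"
proof -
  interpret \<mu>: finite_measure \<mu> using acD[OF \<mu>] by simp
  have "(\<integral>\<^sup>+x. ennreal (dens lam \<mu> x) \<partial>lam) = emeasure \<mu> UNIV"
    using emeasure_density[of "\<lambda>x. ennreal (dens lam \<mu> x)" lam UNIV] density_dens[OF \<mu>] sets_lam by simp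
  then show ?thesis
    by (intro integrableI_nonneg) (auto simp: \<mu>.emeasure_finite less_top[symmetric])
qed

lemma density_in_ac:
  assumes g: "integrable lam g" and nn: "\<And>x. 0 \<le> g x"
  shows "density lam (\<lambda>x. ennreal (g x)) \<in> ac"
    "AE x in lam. dens lam (density lam (\<lambda>x. ennreal (g x))) x = g x"
proof -
  have [measurable]: "g \<in> borel_measurable lam" using g by simp
  have "emeasure (density lam (\<lambda>x. ennreal (g x))) UNIV = ennreal (\<integral>x. g x \<partial>lam)"
    using g nn by (subst emeasure_density) (auto simp: nn_integral_eq_integral sets_lam)
  then have "finite_measure (density lam (\<lambda>x. ennreal (g x)))"
    by (intro finite_measureI) (simp add: space_lam)
  then show "density lam (\<lambda>x. ennreal (g x)) \<in> ac"
    by (simp add: ac_part_def fin_measures_def sets_lam absolutely_continuousI_density)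
  have "AE x in lam. ennreal (g x) = RN_deriv lam (density lam (\<lambda>x. ennreal (g x))) x"
    by (rule RN_deriv_unique) auto
  then show "AE x in lam. dens lam (density lam (\<lambda>x. ennreal (g x))) x = g x"
  proof eventually_elim
    case (elim x)
    then show ?case using nn[of x] by (simp add: dens_def flip: elim)
  qed
qed

lemma Metric_space_ac: "Metric_space ac (rho_var lam)"
proof
  show "0 \<le> rho_var lam \<mu> \<nu>" for \<mu> \<nu> by (simp add: rho_var_dens)
  show "rho_var lam \<mu> \<nu> = rho_var lam \<nu> \<mu>" for \<mu> \<nu> by (simp add: rho_var_dens abs_minus_commute)
next
  fix \<mu> \<nu> assume \<mu>: "\<mu> \<in> ac" and \<nu>: "\<nu> \<in> ac"
  have i: "integrable lam (\<lambda>x. \<bar>dens lam \<mu> x - dens lam \<nu> x\<bar>)"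
    using integrable_dens[OF \<mu>] integrable_dens[OF \<nu>] by simp
  show "(rho_var lam \<mu> \<nu> = 0) = (\<mu> = \<nu>)"
  proof
    assume "rho_var lam \<mu> \<nu> = 0"
    then have "AE x in lam. \<bar>dens lam \<mu> x - dens lam \<nu> x\<bar> = 0"
      using integral_nonneg_eq_0_iff_AE[OF i] by (simp add: rho_var_dens)
    then have "density lam (\<lambda>x. ennreal (dens lam \<mu> x)) = density lam (\<lambda>x. ennreal (dens lam \<nu> x))"
      by (intro density_cong) auto
    then show "\<mu> = \<nu>" by (simp add: density_dens \<mu> \<nu>)
  qed (simp add: rho_var_dens)
  fix \<xi> assume \<xi>: "\<xi> \<in> ac"
  have "rho_var lam \<mu> \<xi> \<le> (\<integral>x. \<bar>dens lam \<mu> x - dens lam \<nu> x\<bar> + \<bar>dens lam \<nu> x - dens lam \<xi> x\<bar> \<partial>lam)"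
    unfolding rho_var_dens using \<mu> \<nu> \<xi> by (intro integral_mono) (auto simp: integrable_dens)
  also have "\<dots> = rho_var lam \<mu> \<nu> + rho_var lam \<nu> \<xi>"
    unfolding rho_var_dens using \<mu> \<nu> \<xi> by (intro Bochner_Integration.integral_add) (auto simp: integrable_dens)
  finally show "rho_var lam \<mu> \<xi> \<le> rho_var lam \<mu> \<nu> + rho_var lam \<nu> \<xi>" .
qed

lemma integrable_dens_mult:
  assumes \<mu>: "\<mu> \<in> ac" and [measurable]: "f \<in> borel_measurable borel" and f: "\<And>x. \<bar>f x\<bar> \<le> C"
  shows "integrable lam (\<lambda>x. dens lam \<mu> x * f x)"
proof (rule Bochner_Integration.integrable_bound)
  show "integrable lam (\<lambda>x. C * dens lam \<mu> x)" using integrable_dens[OF \<mu>] by simp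
  have "\<bar>dens lam \<mu> x * f x\<bar> \<le> \<bar>C * dens lam \<mu> x\<bar>" for x
  proof -
    have "dens lam \<mu> x * \<bar>f x\<bar> \<le> dens lam \<mu> x * \<bar>C\<bar>"
      using f[of x] by (intro mult_left_mono) auto
    then show ?thesis by (simp add: abs_mult mult.commute)
  qed
  then show "AE x in lam. norm (dens lam \<mu> x * f x) \<le> norm (C * dens lam \<mu> x)" by simp
qed measurable

lemma integral_diff_le_rho_var:
  assumes \<mu>: "\<mu> \<in> ac" and \<nu>: "\<nu> \<in> ac" and [measurable]: "f \<in> borel_measurable borel" and f: "\<And>x. \<bar>f x\<bar> \<le> 1"
  shows "\<bar>(\<integral>x. f x \<partial>\<mu>) - (\<integral>x. f x \<partial>\<nu>)\<bar> \<le> rho_var lam \<mu> \<nu>"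
proof -
  have i: "integrable lam (\<lambda>x. dens lam \<mu> x * f x)" "integrable lam (\<lambda>x. dens lam \<nu> x * f x)"
    by (rule integrable_dens_mult[OF _ _ f]; use \<mu> \<nu> in simp)+
  have "\<bar>(\<integral>x. f x \<partial>\<mu>) - (\<integral>x. f x \<partial>\<nu>)\<bar> = \<bar>\<integral>x. dens lam \<mu> x * f x - dens lam \<nu> x * f x \<partial>lam\<bar>"
    using i by (simp add: integral_ac \<mu> \<nu>)
  also have "\<dots> \<le> (\<integral>x. \<bar>dens lam \<mu> x * f x - dens lam \<nu> x * f x\<bar> \<partial>lam)" by (rule integral_abs_bound)
  also have "\<dots> \<le> rho_var lam \<mu> \<nu>"
    unfolding rho_var_dens
  proof (rule integral_mono)
    fix x
    have "\<bar>dens lam \<mu> x * f x - dens lam \<nu> x * f x\<bar> = \<bar>dens lam \<mu> x - dens lam \<nu> x\<bar> * \<bar>f x\<bar>"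
      by (simp add: abs_mult flip: left_diff_distrib)
    also have "\<dots> \<le> \<bar>dens lam \<mu> x - dens lam \<nu> x\<bar> * 1" by (intro mult_left_mono f) simp
    finally show "\<bar>dens lam \<mu> x * f x - dens lam \<nu> x * f x\<bar> \<le> \<bar>dens lam \<mu> x - dens lam \<nu> x\<bar>" by simp
  qed (use i integrable_dens \<mu> \<nu> in auto)
  finally show ?thesis .
qed

text \<open>The distance is attained by the sign function 2 1_A - 1 of the Hahn set A = {b \<le> a}.
  Passing from A to V n changes the integral by at most twice the mass of the symmetric difference
  under the measure with density a + b, and this mass can be made less than e/2.\<close>

lemma rho_var_approx:
  fixes V :: "nat \<Rightarrow> 'a set"
  assumes V: "\<And>n. open (V n)"
      "\<And>M A e. sets M = sets borel \<Longrightarrow> finite_measure M \<Longrightarrow> A \<in> sets borel \<Longrightarrow> 0 < e \<Longrightarrow>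
        \<exists>n. measure M ((A - V n) \<union> (V n - A)) < e"
    and \<mu>: "\<mu> \<in> ac" and \<nu>: "\<nu> \<in> ac" and e: "0 < e"
  shows "\<exists>n. rho_var lam \<mu> \<nu> - e \<le> (\<integral>x. 2 * indicat_real (V n) x - 1 \<partial>\<mu>) - (\<integral>x. 2 * indicat_real (V n) x - 1 \<partial>\<nu>)"
proof -
  define a where "a = dens lam \<mu>"
  define b where "b = dens lam \<nu>"
  have [measurable]: "a \<in> borel_measurable borel" "b \<in> borel_measurable borel"
    unfolding a_def b_def using dens_meas measurable_cong_sets[OF sets_lam refl] by auto
  have nn: "0 \<le> a x" "0 \<le> b x" for x by (auto simp: a_def b_def)
  have i: "integrable lam a" "integrable lam b" by (auto simp: a_def b_def integrable_dens \<mu> \<nu>)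
  define A where "A = {x. b x \<le> a x}"
  have [measurable]: "A \<in> sets borel" unfolding A_def by measurable
  define M where "M = density lam (\<lambda>x. ennreal (a x + b x))"
  have M: "M \<in> ac" unfolding M_def by (rule density_in_ac) (use i nn in auto)
  obtain n where n: "measure M ((A - V n) \<union> (V n - A)) < e / 2"
    using V(2)[of M A "e / 2"] acD[OF M] e by auto
  have Vn [measurable]: "V n \<in> sets borel" using V(1) by simp
  have bnd: "\<bar>2 * indicat_real (V n) x - 1\<bar> \<le> 1" "\<bar>2 * indicat_real A x - 1\<bar> \<le> 1" for x
    by (auto simp: indicator_def)
  let ?T = "(A - V n) \<union> (V n - A)"
  have iA: "integrable lam (\<lambda>x. a x * (2 * indicat_real A x - 1))" "integrable lam (\<lambda>x. b x * (2 * indicat_real A x - 1))"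
    "integrable lam (\<lambda>x. a x * (2 * indicat_real (V n) x - 1))" "integrable lam (\<lambda>x. b x * (2 * indicat_real (V n) x - 1))"
    unfolding a_def b_def by (intro integrable_dens_mult[where C=1] \<mu> \<nu> bnd; measurable)+
  have iT: "integrable lam (\<lambda>x. (a x + b x) * indicat_real ?T x)"
    by (intro integrable_real_mult_indicator) (use i in auto)
  have "rho_var lam \<mu> \<nu> = (\<integral>x. a x * (2 * indicat_real A x - 1) - b x * (2 * indicat_real A x - 1) \<partial>lam)"
    unfolding rho_var_dens by (intro Bochner_Integration.integral_cong) (auto simp: A_def a_def b_def indicator_def)
  also have "\<dots> \<le> (\<integral>x. (a x * (2 * indicat_real (V n) x - 1) - b x * (2 * indicat_real (V n) x - 1)) + 2 * ((a x + b x) * indicat_real ?T x) \<partial>lam)"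
  proof (rule integral_mono)
    fix x
    show "a x * (2 * indicat_real A x - 1) - b x * (2 * indicat_real A x - 1) \<le>
      (a x * (2 * indicat_real (V n) x - 1) - b x * (2 * indicat_real (V n) x - 1)) + 2 * ((a x + b x) * indicat_real ?T x)"
      using nn[of x] by (auto simp: indicator_def)
  qed (use iA iT in auto)
  also have "\<dots> = (\<integral>x. a x * (2 * indicat_real (V n) x - 1) \<partial>lam) - (\<integral>x. b x * (2 * indicat_real (V n) x - 1) \<partial>lam)
      + 2 * (\<integral>x. (a x + b x) * indicat_real ?T x \<partial>lam)"
    using iA iT by simp
  also have "(\<integral>x. (a x + b x) * indicat_real ?T x \<partial>lam) = measure M ?T"
  proof -
    have "(\<integral>x. indicat_real ?T x \<partial>M) = (\<integral>x. (a x + b x) * indicat_real ?T x \<partial>lam)"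
      unfolding M_def using nn by (subst integral_density) auto
    then show ?thesis using acD(4)[OF M] by simp
  qed
  also have "(\<integral>x. a x * (2 * indicat_real (V n) x - 1) \<partial>lam) = (\<integral>x. 2 * indicat_real (V n) x - 1 \<partial>\<mu>)"
    unfolding a_def by (subst integral_ac[OF \<mu>]) auto
  also have "(\<integral>x. b x * (2 * indicat_real (V n) x - 1) \<partial>lam) = (\<integral>x. 2 * indicat_real (V n) x - 1 \<partial>\<nu>)"
    unfolding b_def by (subst integral_ac[OF \<nu>]) auto
  finally show ?thesis using n by (intro exI[of _ n]) linarith
qed

end

section \<open>Separability and completeness of the total variation distance\<close>

context ac_space
begin

text \<open>Rational combinations of indicators of V i \<inter> E j are dense, by induction over
  integrable functions. Intersecting with sets E j of finite measure keeps the indicators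
  integrable, as an open set may have infinite measure.\<close>

lemma L1_separable:
  "\<exists>h::nat \<Rightarrow> 'a \<Rightarrow> real. (\<forall>n. integrable lam (h n)) \<and>
     (\<forall>f e. integrable lam f \<longrightarrow> 0 < e \<longrightarrow> (\<exists>n. (\<integral>x. \<bar>f x - h n x\<bar> \<partial>lam) < e))"
proof -
  obtain V :: "nat \<Rightarrow> 'a set" where Vo: "\<And>n. open (V n)"
    and V: "\<And>M A e. sets M = sets borel \<Longrightarrow> finite_measure M \<Longrightarrow> A \<in> sets borel \<Longrightarrow> 0 < e \<Longrightarrow>
        \<exists>n. measure M ((A - V n) \<union> (V n - A)) < e"
    using countable_open_approximation by metis
  obtain E where E: "range E \<subseteq> sets lam" "(\<Union>i. E i) = space lam" "\<And>i. emeasure lam (E i) \<noteq> \<infinity>" "incseq E"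
    using sigma_finite_incseq by metis
  have [measurable]: "E j \<in> sets lam" "V i \<in> sets lam" for i j using E(1) Vo sets_lam by auto
  \<comment> \<open>Combinations are coded by lists of triples. The type of these lists is
    countable, so \<open>from_nat\<close> enumerates them, and appending lists adds the
    functions.\<close>
  define hl :: "(rat \<times> nat \<times> nat) list \<Rightarrow> 'a \<Rightarrow> real"
    where "hl l x = (\<Sum>(q, i, j)\<leftarrow>l. real_of_rat q * indicat_real (V i \<inter> E j) x)" for l x
  have fin: "emeasure lam (E j \<inter> T) < \<infinity>" "emeasure lam (T \<inter> E j) < \<infinity>" for T j
    using emeasure_mono[of "E j \<inter> T" "E j" lam] emeasure_mono[of "T \<inter> E j" "E j" lam] E(3)[of j]
    by (auto simp: less_top le_less_trans)
  have hl_int: "integrable lam (hl l)" for l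
  proof (induction l)
    case Nil show ?case by (simp add: hl_def)
  next
    case (Cons t l)
    obtain q i j where t: "t = (q, i, j)" by (cases t) auto
    have "hl (t # l) = (\<lambda>x. real_of_rat q * indicat_real (V i \<inter> E j) x + hl l x)"
      by (auto simp: hl_def t)
    moreover have "integrable lam (\<lambda>x. real_of_rat q * indicat_real (V i \<inter> E j) x)"
      using fin(2)[of "V i" j] by (intro integrable_mult_right integrable_real_indicator) auto
    ultimately show ?case using Cons by simp
  qed
  have hl_append: "hl (l @ l') x = hl l x + hl l' x" for l l' x by (simp add: hl_def)
  define P where "P f \<longleftrightarrow> (\<forall>e>0. \<exists>l. (\<integral>x. \<bar>f x - hl l x\<bar> \<partial>lam) < e)" for f
  have "P f" if "integrable lam f" for f
    using that
  proof (induction rule: integrable_induct)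
    case (base A c)
    have [measurable]: "A \<in> sets lam" by fact
    show ?case unfolding P_def
    proof (intro allI impI)
      fix e :: real assume e: "0 < e"
      \<comment> \<open>Two set errors below d, one from cutting A down to E j and one from
        replacing A by V i, cost at most (|c| + 1) 2 d = e/2; rounding c to a rational adds
        e/4.\<close>
      define d where "d = e / (4 * (\<bar>c\<bar> + 1))"
      have d: "0 < d" using e by (simp add: d_def)
      have "(\<lambda>j. measure lam (A \<inter> E j)) \<longlonglongrightarrow> measure lam (\<Union>j. A \<inter> E j)"
        using E(4) base(2) by (intro Lim_measure_incseq) (auto simp: incseq_def E(2) simp flip: Int_UN_distrib)
      also have "(\<Union>j. A \<inter> E j) = A" using E(2) by (simp flip: Int_UN_distrib)
      finally have "\<forall>\<^sub>F j in sequentially. measure lam A - d < measure lam (A \<inter> E j)"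
        using d by (intro order_tendstoD) auto
      then obtain j where j: "measure lam A - d < measure lam (A \<inter> E j)" by (auto simp: eventually_sequentially)
      have "measure lam (A - E j) = measure lam A - measure lam (A \<inter> E j)"
        using base(2) measure_Diff[of lam A "A \<inter> E j"] by (simp add: Diff_Int)
      then have j1: "measure lam (A - E j) < d" using j by simp
      \<comment> \<open>The open approximation is available for finite measures, hence for the
        restriction of \<open>lam\<close> to E j.\<close>
      define M where "M = density lam (indicator (E j))"
      have eM: "emeasure M X = emeasure lam (E j \<inter> X)" if "X \<in> sets lam" for X
        unfolding M_def using that by (intro emeasure_restricted) auto
      have "finite_measure M" by (rule finite_measureI) (use eM[of UNIV] E(3)[of j] sets_lam in \<open>simp add: M_def\<close>)
      then obtain i where i: "measure M ((A - V i) \<union> (V i - A)) < d"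
        using V[of M A d] d sets_lam base(1) by (auto simp: M_def)
      let ?T = "(A - V i) \<union> (V i - A)"
      have i1: "measure lam (E j \<inter> ?T) < d" using i eM[of ?T] by (simp add: measure_def)
      obtain q where q: "\<bar>c - real_of_rat q\<bar> < e / (4 * (measure lam (E j) + 1))"
      proof -
        have "0 < e / (4 * (measure lam (E j) + 1))" using e by (simp add: add_nonneg_pos)
        then obtain r where r: "r \<in> \<rat>" "c < r" "r < c + e / (4 * (measure lam (E j) + 1))"
          using Rats_dense_in_real[of c "c + e / (4 * (measure lam (E j) + 1))"] by auto
        from r(1) obtain q where "r = real_of_rat q" by (rule Rats_cases)
        then show ?thesis using r(2,3) by (intro that[of q]) (simp add: abs_real_def)
      qed
      have fA: "emeasure lam (A - E j) < \<infinity>" using base(2) emeasure_mono[of "A - E j" A lam] by (auto simp: le_less_trans)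
      have ii: "integrable lam (indicat_real ((A - E j) \<union> (E j \<inter> ?T)))" "integrable lam (indicat_real (E j))"
        using fA fin(1)[of j ?T] E(3)[of j]
        by (auto intro!: integrable_real_indicator le_less_trans[OF emeasure_subadditive] simp: less_top)
      have "(\<integral>x. \<bar>indicator A x *\<^sub>R c - hl [(q, i, j)] x\<bar> \<partial>lam) \<le>
         (\<integral>x. \<bar>c\<bar> * indicat_real ((A - E j) \<union> (E j \<inter> ?T)) x + \<bar>c - real_of_rat q\<bar> * indicat_real (E j) x \<partial>lam)"
      proof (rule integral_mono)
        show "integrable lam (\<lambda>x. \<bar>indicator A x *\<^sub>R c - hl [(q, i, j)] x\<bar>)"
          using base(2) hl_int by (intro integrable_abs Bochner_Integration.integrable_diff) auto
        show "\<bar>indicator A x *\<^sub>R c - hl [(q, i, j)] x\<bar> \<le>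
            \<bar>c\<bar> * indicat_real ((A - E j) \<union> (E j \<inter> ?T)) x + \<bar>c - real_of_rat q\<bar> * indicat_real (E j) x" for x
        proof -
          define Q where "Q = real_of_rat q"
          have "hl [(q, i, j)] x = Q * indicat_real (V i \<inter> E j) x" by (simp add: hl_def Q_def)
          then show ?thesis unfolding Q_def[symmetric] by (auto simp: indicator_def)
        qed
      qed (use ii in auto)
      also have "\<dots> = \<bar>c\<bar> * measure lam ((A - E j) \<union> (E j \<inter> ?T)) + \<bar>c - real_of_rat q\<bar> * measure lam (E j)"
        using ii by simp
      also have "\<dots> \<le> (\<bar>c\<bar> + 1) * (2 * d) + e / 4"
      proof (rule add_mono)
        have "measure lam ((A - E j) \<union> (E j \<inter> ?T)) \<le> measure lam (A - E j) + measure lam (E j \<inter> ?T)"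
          by (rule measure_Un_le) auto
        then show "\<bar>c\<bar> * measure lam ((A - E j) \<union> (E j \<inter> ?T)) \<le> (\<bar>c\<bar> + 1) * (2 * d)"
          using i1 j1 by (intro mult_mono) auto
        have "\<bar>c - real_of_rat q\<bar> * measure lam (E j) \<le> e / (4 * (measure lam (E j) + 1)) * (measure lam (E j) + 1)"
          using q by (intro mult_mono) auto
        also have "\<dots> = e / 4"
          using measure_nonneg[of lam "E j"] by (simp add: field_simps add_nonneg_eq_0_iff)
        finally show "\<bar>c - real_of_rat q\<bar> * measure lam (E j) \<le> e / 4" .
      qed
      also have "(\<bar>c\<bar> + 1) * (2 * d) = e / 2"
        unfolding d_def by (simp add: field_simps)
      finally have "(\<integral>x. \<bar>indicator A x *\<^sub>R c - hl [(q, i, j)] x\<bar> \<partial>lam) < e" using e by simp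
      then show "\<exists>l. (\<integral>x. \<bar>indicator A x *\<^sub>R c - hl l x\<bar> \<partial>lam) < e" by blast
    qed
  next
    case (add f g)
    show ?case unfolding P_def
    proof (intro allI impI)
      fix e :: real assume "0 < e"
      then obtain l l' where l: "(\<integral>x. \<bar>f x - hl l x\<bar> \<partial>lam) < e / 2" "(\<integral>x. \<bar>g x - hl l' x\<bar> \<partial>lam) < e / 2"
        using add.IH unfolding P_def by (meson half_gt_zero)
      have "(\<integral>x. \<bar>f x + g x - hl (l @ l') x\<bar> \<partial>lam) \<le> (\<integral>x. \<bar>f x - hl l x\<bar> + \<bar>g x - hl l' x\<bar> \<partial>lam)"
        using add.hyps hl_int by (intro integral_mono) (auto simp: hl_append)
      also have "\<dots> < e" using l add.hyps hl_int by simp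
      finally show "\<exists>l. (\<integral>x. \<bar>f x + g x - hl l x\<bar> \<partial>lam) < e" by blast
    qed
  next
    case (lim f s)
    show ?case unfolding P_def
    proof (intro allI impI)
      fix e :: real assume e: "0 < e"
      note [measurable] = borel_measurable_integrable[OF lim.hyps(1)] borel_measurable_integrable[OF lim.hyps(4)]
      have "(\<lambda>i. \<integral>x. \<bar>f x - s i x\<bar> \<partial>lam) \<longlonglongrightarrow> (\<integral>x. 0 \<partial>lam)"
      proof (rule integral_dominated_convergence[where w="\<lambda>x. 3 * \<bar>f x\<bar>"])
        show "AE x in lam. (\<lambda>i. \<bar>f x - s i x\<bar>) \<longlonglongrightarrow> 0"
        proof (rule AE_I2)
          fix x assume "x \<in> space lam"
          then have "(\<lambda>i. \<bar>f x - s i x\<bar>) \<longlonglongrightarrow> \<bar>f x - f x\<bar>" by (intro tendsto_intros lim.hyps(2))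
          then show "(\<lambda>i. \<bar>f x - s i x\<bar>) \<longlonglongrightarrow> 0" by simp
        qed
        show "AE x in lam. norm \<bar>f x - s i x\<bar> \<le> 3 * \<bar>f x\<bar>" for i
        proof (rule AE_I2)
          fix x assume "x \<in> space lam"
          then show "norm \<bar>f x - s i x\<bar> \<le> 3 * \<bar>f x\<bar>" using lim.hyps(3)[of x i] by simp
        qed
      qed (use lim.hyps(4) in auto)
      then have "\<forall>\<^sub>F i in sequentially. (\<integral>x. \<bar>f x - s i x\<bar> \<partial>lam) < e / 2"
        using e by (intro order_tendstoD) auto
      then obtain i where i: "(\<integral>x. \<bar>f x - s i x\<bar> \<partial>lam) < e / 2" by (auto simp: eventually_sequentially)
      obtain l where l: "(\<integral>x. \<bar>s i x - hl l x\<bar> \<partial>lam) < e / 2"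
        using lim.IH[of i] e unfolding P_def by (meson half_gt_zero)
      have "(\<integral>x. \<bar>f x - hl l x\<bar> \<partial>lam) \<le> (\<integral>x. \<bar>f x - s i x\<bar> + \<bar>s i x - hl l x\<bar> \<partial>lam)"
        using lim.hyps(1,4) hl_int by (intro integral_mono) auto
      also have "\<dots> < e" using l i lim.hyps(1,4) hl_int by simp
      finally show "\<exists>l. (\<integral>x. \<bar>f x - hl l x\<bar> \<partial>lam) < e" by blast
    qed
  qed
  then have "\<exists>n. (\<integral>x. \<bar>f x - hl (from_nat n) x\<bar> \<partial>lam) < e" if "integrable lam f" "0 < e" for f e
    using that unfolding P_def by (metis from_nat_to_nat)
  then show ?thesis using hl_int by (intro exI[of _ "\<lambda>n. hl (from_nat n)"]) auto
qed

text \<open>The dense functions h n need not be densities of members of S. For each n and each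
  accuracy 1/(k + 1) a member of S that close to h n is picked if there is one; for the pairs
  without one, any member of S fills the place.\<close>

lemma ac_separable:
  assumes S: "S \<subseteq> ac" "S \<noteq> {}"
  shows "\<exists>y::nat \<Rightarrow> 'a measure. (\<forall>n. y n \<in> S) \<and> (\<forall>\<mu>\<in>S. \<forall>e>0. \<exists>n. rho_var lam \<mu> (y n) < e)"
proof -
  obtain h :: "nat \<Rightarrow> 'a \<Rightarrow> real" where hi: "\<And>n. integrable lam (h n)"
    and h: "\<And>f e. integrable lam f \<Longrightarrow> 0 < e \<Longrightarrow> \<exists>n. (\<integral>x. \<bar>f x - h n x\<bar> \<partial>lam) < e"
    using L1_separable by metis
  define good where "good n k \<mu> \<longleftrightarrow> \<mu> \<in> S \<and> (\<integral>x. \<bar>dens lam \<mu> x - h n x\<bar> \<partial>lam) < 1 / Suc k" for n k \<mu>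
  define z where "z n k = (if \<exists>\<mu>. good n k \<mu> then SOME \<mu>. good n k \<mu> else SOME \<mu>. \<mu> \<in> S)" for n k
  have zg: "good n k (z n k)" if "good n k \<mu>" for n k \<mu>
    unfolding z_def using that by (auto intro: someI)
  have zS: "z n k \<in> S" for n k
  proof (cases "\<exists>\<mu>. good n k \<mu>")
    case True then show ?thesis using zg by (auto simp: good_def)
  next
    case False then show ?thesis unfolding z_def using S(2) by (auto intro: someI_ex)
  qed
  show ?thesis
  proof (intro exI[of _ "\<lambda>p. z (fst (prod_decode p)) (snd (prod_decode p))"] conjI allI ballI impI)
    show "z (fst (prod_decode p)) (snd (prod_decode p)) \<in> S" for p by (rule zS)
    fix \<mu> and e :: real assume \<mu>: "\<mu> \<in> S" and e: "0 < e"
    obtain k where k: "1 / Suc k < e / 2" using nat_approx_posE[of "e / 2"] e by auto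
    have mu: "\<mu> \<in> ac" using \<mu> S by auto
    obtain n where n: "(\<integral>x. \<bar>dens lam \<mu> x - h n x\<bar> \<partial>lam) < 1 / Suc k"
      using h[OF integrable_dens[OF mu], of "1 / Suc k"] by auto
    then have "good n k \<mu>" using \<mu> by (simp add: good_def)
    then have g: "(\<integral>x. \<bar>dens lam (z n k) x - h n x\<bar> \<partial>lam) < 1 / Suc k" using zg by (auto simp: good_def)
    have zac: "z n k \<in> ac" using zS S by auto
    have "rho_var lam \<mu> (z n k) \<le> (\<integral>x. \<bar>dens lam \<mu> x - h n x\<bar> + \<bar>dens lam (z n k) x - h n x\<bar> \<partial>lam)"
      unfolding rho_var_dens using hi integrable_dens mu zac by (intro integral_mono) auto
    also have "\<dots> < e" using n g k hi integrable_dens mu zac by simp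
    finally have "rho_var lam \<mu> (z n k) < e" .
    then show "\<exists>p. rho_var lam \<mu> (z (fst (prod_decode p)) (snd (prod_decode p))) < e"
      by (intro exI[of _ "prod_encode (n, k)"]) simp
  qed
qed

text \<open>L1 completeness for the densities: a subsequence converges almost everywhere, Fatou
  gives convergence in L1, and the limit is again a nonnegative integrable density.\<close>

lemma rho_var_Cauchy_limit:
  assumes \<sigma>: "\<And>n. \<sigma> n \<in> ac"
    and Cau: "\<And>e. 0 < e \<Longrightarrow> \<exists>N. \<forall>n\<ge>N. \<forall>k\<ge>N. rho_var lam (\<sigma> n) (\<sigma> k) < e"
  obtains \<mu> where "\<mu> \<in> ac" "(\<lambda>n. rho_var lam (\<sigma> n) \<mu>) \<longlonglongrightarrow> 0"
proof -
  define f where "f n = dens lam (\<sigma> n)" for n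
  have fi: "integrable lam (f n)" for n unfolding f_def by (rule integrable_dens[OF \<sigma>])
  note [measurable] = borel_measurable_integrable[OF fi]
  have "\<exists>N. \<forall>i\<ge>N. \<forall>j\<ge>N. (LINT x|lam. norm (f i x - f j x)) < e" if "0 < e" for e
    using Cau[OF that] by (simp add: f_def rho_var_dens)
  then obtain r where r: "strict_mono r" "AE x in lam. Cauchy (\<lambda>i. f (r i) x)"
    using cauchy_L1_AE_cauchy_subseq[of lam f, OF fi] by metis
  \<comment> \<open>The maximum with 0 keeps g nonnegative also on the null set without convergence,
    where \<open>lim\<close> is arbitrary.\<close>
  define g where "g x = max 0 (lim (\<lambda>i. f (r i) x))" for x
  have [measurable]: "g \<in> borel_measurable lam"
    unfolding g_def by (intro borel_measurable_max borel_measurable_const borel_measurable_lim_metric) simp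
  have lim: "AE x in lam. (\<lambda>i. f (r i) x) \<longlonglongrightarrow> g x"
    using r(2)
  proof eventually_elim
    case (elim x)
    then have l: "(\<lambda>i. f (r i) x) \<longlonglongrightarrow> lim (\<lambda>i. f (r i) x)"
      by (simp add: Cauchy_convergent_iff convergent_LIMSEQ_iff)
    then have "0 \<le> lim (\<lambda>i. f (r i) x)"
      by (rule LIMSEQ_le_const) (auto simp: f_def)
    then show ?case using l by (simp add: g_def)
  qed
  have le: "(\<integral>\<^sup>+x. ennreal \<bar>f n x - g x\<bar> \<partial>lam) \<le> ennreal e"
    if N: "\<forall>n\<ge>N. \<forall>k\<ge>N. rho_var lam (\<sigma> n) (\<sigma> k) < e" and n: "n \<ge> N" for N n e
  proof -
    have "(\<integral>\<^sup>+x. ennreal \<bar>f n x - g x\<bar> \<partial>lam) \<le> liminf (\<lambda>k. \<integral>\<^sup>+x. ennreal \<bar>f n x - f (r k) x\<bar> \<partial>lam)"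
    proof (rule nn_integral_Fatou_le)
      show "AE x in lam. (\<lambda>k. ennreal \<bar>f n x - f (r k) x\<bar>) \<longlonglongrightarrow> ennreal \<bar>f n x - g x\<bar>"
        using lim by eventually_elim (intro tendsto_intros)
    qed simp
    also have "\<dots> \<le> ennreal e"
    proof (rule Liminf_le)
      have "(\<integral>\<^sup>+x. ennreal \<bar>f n x - f (r k) x\<bar> \<partial>lam) \<le> ennreal e" if "k \<ge> N" for k
      proof -
        have "(\<integral>\<^sup>+x. ennreal \<bar>f n x - f (r k) x\<bar> \<partial>lam) = ennreal (rho_var lam (\<sigma> n) (\<sigma> (r k)))"
          unfolding rho_var_dens f_def[symmetric] using fi by (intro nn_integral_eq_integral) auto
        also have "\<dots> \<le> ennreal e"
          using N n that seq_suble[OF r(1), of k] by (intro ennreal_leI less_imp_le) auto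
        finally show ?thesis .
      qed
      then show "\<forall>\<^sub>F k in sequentially. (\<integral>\<^sup>+x. ennreal \<bar>f n x - f (r k) x\<bar> \<partial>lam) \<le> ennreal e"
        by (auto simp: eventually_sequentially)
    qed simp
    finally show ?thesis .
  qed
  obtain N1 where N1: "\<forall>n\<ge>N1. \<forall>k\<ge>N1. rho_var lam (\<sigma> n) (\<sigma> k) < 1" using Cau[of 1] by auto
  have "integrable lam (\<lambda>x. f N1 x - g x)"
    using le[OF N1 order_refl] by (intro integrableI_bounded) (auto intro: le_less_trans)
  from Bochner_Integration.integrable_diff[OF fi[of N1] this] have gi: "integrable lam g" by simp
  define \<mu> where "\<mu> = density lam (\<lambda>x. ennreal (g x))"
  have \<mu>: "\<mu> \<in> ac" "AE x in lam. dens lam \<mu> x = g x"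
    unfolding \<mu>_def by (rule density_in_ac[OF gi]; simp add: g_def)+
  have rho: "rho_var lam (\<sigma> n) \<mu> = (\<integral>x. \<bar>f n x - g x\<bar> \<partial>lam)" for n
    unfolding rho_var_dens f_def by (intro integral_cong_AE) (use \<mu>(2) in auto)
  have "(\<lambda>n. rho_var lam (\<sigma> n) \<mu>) \<longlonglongrightarrow> 0"
  proof (rule LIMSEQ_I)
    fix e :: real assume e: "0 < e"
    then obtain N where N: "\<forall>n\<ge>N. \<forall>k\<ge>N. rho_var lam (\<sigma> n) (\<sigma> k) < e / 2" using Cau[of "e / 2"] by auto
    have "rho_var lam (\<sigma> n) \<mu> < e" if "n \<ge> N" for n
    proof -
      have "ennreal (rho_var lam (\<sigma> n) \<mu>) \<le> ennreal (e / 2)"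
        using le[OF N that] fi gi unfolding rho by (subst nn_integral_eq_integral[symmetric]) auto
      then show ?thesis using e by (simp add: ennreal_le_iff)
    qed
    moreover have "0 \<le> rho_var lam (\<sigma> n) \<mu>" for n by (simp add: rho_var_dens)
    ultimately show "\<exists>N. \<forall>n\<ge>N. norm (rho_var lam (\<sigma> n) \<mu> - 0) < e" by auto
  qed
  with \<mu>(1) show ?thesis by (rule that)
qed

text \<open>Formulated for a subset stable under limits, so as to include the probability
  measures.\<close>

lemma mcomplete_ac:
  assumes S: "S \<subseteq> ac"
    and closed: "\<And>\<sigma> \<mu>. (\<And>n. \<sigma> n \<in> S) \<Longrightarrow> \<mu> \<in> ac \<Longrightarrow> (\<lambda>n. rho_var lam (\<sigma> n) \<mu>) \<longlonglongrightarrow> 0 \<Longrightarrow> \<mu> \<in> S"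
  shows "Metric_space.mcomplete S (rho_var lam)"
proof -
  interpret Metric_space S "rho_var lam" by (rule Metric_space.subspace[OF Metric_space_ac S])
  show ?thesis
    unfolding mcomplete_def
  proof (intro allI impI)
    fix \<sigma> assume \<sigma>: "MCauchy \<sigma>"
    then have \<sigma>S: "\<sigma> n \<in> S" for n by (auto simp: MCauchy_def)
    obtain \<mu> where \<mu>: "\<mu> \<in> ac" "(\<lambda>n. rho_var lam (\<sigma> n) \<mu>) \<longlonglongrightarrow> 0"
    proof (rule rho_var_Cauchy_limit)
      show "\<sigma> n \<in> ac" for n using \<sigma>S S by blast
      show "\<exists>N. \<forall>n\<ge>N. \<forall>k\<ge>N. rho_var lam (\<sigma> n) (\<sigma> k) < e" if e: "0 < e" for e
      proof -
        obtain N where "\<forall>n n'. N \<le> n \<longrightarrow> N \<le> n' \<longrightarrow> rho_var lam (\<sigma> n) (\<sigma> n') < e"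
          using \<sigma> e unfolding MCauchy_def by blast
        then show ?thesis by (intro exI[of _ N]) simp
      qed
    qed
    have "limitin mtopology \<sigma> \<mu> sequentially"
      unfolding limit_metric_sequentially
    proof (intro conjI allI impI)
      show "\<mu> \<in> S" by (rule closed[OF \<sigma>S \<mu>])
      fix e :: real assume "0 < e"
      then have "\<forall>\<^sub>F n in sequentially. rho_var lam (\<sigma> n) \<mu> < e" using \<mu>(2) by (intro order_tendstoD) auto
      then show "\<exists>N. \<forall>n\<ge>N. \<sigma> n \<in> S \<and> rho_var lam (\<sigma> n) \<mu> < e" using \<sigma>S by (auto simp: eventually_sequentially)
    qed
    then show "\<exists>x. limitin mtopology \<sigma> x sequentially" by blast
  qed
qed

end

section \<open>Lipschitz continuity from the extrinsic derivative\<close>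

lemma sets_meas_add [simp, measurable_cong]: "sets (meas_add \<mu> \<nu>) = sets \<mu>"
  by (simp add: meas_add_def sets.space_closed sets.sigma_sets_eq)

lemma space_meas_add [simp]: "space (meas_add \<mu> \<nu>) = space \<mu>"
  by (simp add: meas_add_def sets.space_closed)

lemma emeasure_meas_add:
  assumes s: "sets \<nu> = sets \<mu>" and A: "A \<in> sets \<mu>"
  shows "emeasure (meas_add \<mu> \<nu>) A = emeasure \<mu> A + emeasure \<nu> A"
proof (rule emeasure_measure_of[OF meas_add_def])
  \<comment> \<open>\<open>measure_of\<close> reproduces the given set function only when it is
    countably additive.\<close>
  show "countably_additive (sets (meas_add \<mu> \<nu>)) (\<lambda>A. emeasure \<mu> A + emeasure \<nu> A)"
    unfolding countably_additive_def
  proof (intro allI impI)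
    fix A :: "nat \<Rightarrow> _" assume "range A \<subseteq> sets (meas_add \<mu> \<nu>)" "disjoint_family A"
    then show "(\<Sum>i. emeasure \<mu> (A i) + emeasure \<nu> (A i)) = emeasure \<mu> (\<Union>i. A i) + emeasure \<nu> (\<Union>i. A i)"
      using s by (simp add: suminf_add[symmetric] suminf_emeasure)
  qed
qed (use A sets.space_closed in \<open>auto simp: positive_def\<close>)

lemma fin_measuresD:
  assumes "\<mu> \<in> fin_measures"
  shows "sets \<mu> = sets borel" "finite_measure \<mu>" "space \<mu> = UNIV"
  using assms sets_eq_imp_space_eq[of \<mu> borel] by (auto simp: fin_measures_def)

lemma meas_add_fin:
  assumes \<mu>: "\<mu> \<in> fin_measures" and \<nu>: "\<nu> \<in> fin_measures"
  shows "meas_add \<mu> \<nu> \<in> fin_measures"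
    "A \<in> sets borel \<Longrightarrow> measure (meas_add \<mu> \<nu>) A = measure \<mu> A + measure \<nu> A"
proof -
  interpret m: finite_measure \<mu> using fin_measuresD[OF \<mu>] by simp
  interpret n: finite_measure \<nu> using fin_measuresD[OF \<nu>] by simp
  have e: "emeasure (meas_add \<mu> \<nu>) A = ennreal (measure \<mu> A + measure \<nu> A)" if "A \<in> sets borel" for A
    using that fin_measuresD[OF \<mu>] fin_measuresD[OF \<nu>]
    by (simp add: emeasure_meas_add m.emeasure_eq_measure n.emeasure_eq_measure ennreal_plus)
  then have "finite_measure (meas_add \<mu> \<nu>)"
    by (intro finite_measureI) (simp add: fin_measuresD(3)[OF \<mu>])
  then show "meas_add \<mu> \<nu> \<in> fin_measures"
    using fin_measuresD[OF \<mu>] by (simp add: fin_measures_def)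
  show "A \<in> sets borel \<Longrightarrow> measure (meas_add \<mu> \<nu>) A = measure \<mu> A + measure \<nu> A"
    using e by (simp add: measure_def[of "meas_add _ _"] del: ennreal_plus)
qed

lemma scale_measure_fin:
  assumes \<mu>: "\<mu> \<in> fin_measures"
  shows "scale_measure (ennreal c) \<mu> \<in> fin_measures"
    "0 \<le> c \<Longrightarrow> measure (scale_measure (ennreal c) \<mu>) A = c * measure \<mu> A"
proof -
  interpret m: finite_measure \<mu> using fin_measuresD[OF \<mu>] by simp
  have "finite_measure (scale_measure (ennreal c) \<mu>)"
    by (intro finite_measureI) (simp add: space_scale_measure ennreal_mult_eq_top_iff m.emeasure_finite)
  then show "scale_measure (ennreal c) \<mu> \<in> fin_measures"
    using fin_measuresD[OF \<mu>] by (simp add: fin_measures_def)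
  show "0 \<le> c \<Longrightarrow> measure (scale_measure (ennreal c) \<mu>) A = c * measure \<mu> A"
    by (simp add: measure_def enn2real_mult)
qed

lemma return_fin: "return borel x \<in> fin_measures"
  by (simp add: fin_measures_def prob_space.finite_measure prob_space_return)

lemma measure_return_borel: "A \<in> sets borel \<Longrightarrow> measure (return borel x) A = indicat_real A x"
  by (simp add: measure_return)

text \<open>Through this rule, equations between combinations of finite measures become identities
  of real numbers.\<close>

lemma fin_measures_eqI:
  assumes \<mu>: "\<mu> \<in> fin_measures" and \<nu>: "\<nu> \<in> fin_measures"
    and eq: "\<And>A. A \<in> sets borel \<Longrightarrow> measure \<mu> A = measure \<nu> A"
  shows "\<mu> = \<nu>"
proof (rule measure_eqI)
  show "sets \<mu> = sets \<nu>" using fin_measuresD[OF \<mu>] fin_measuresD[OF \<nu>] by simp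
  fix A assume "A \<in> sets \<mu>"
  then show "emeasure \<mu> A = emeasure \<nu> A"
    using eq[of A] fin_measuresD[OF \<mu>] fin_measuresD[OF \<nu>] by (simp add: finite_measure.emeasure_eq_measure)
qed

lemma nn_integral_meas_add:
  assumes s: "sets \<nu> = sets \<mu>" and f: "f \<in> borel_measurable \<mu>"
  shows "(\<integral>\<^sup>+x. f x \<partial>meas_add \<mu> \<nu>) = (\<integral>\<^sup>+x. f x \<partial>\<mu>) + (\<integral>\<^sup>+x. f x \<partial>\<nu>)"
  using f
proof (induction rule: borel_measurable_induct)
  case (cong f g)
  have "space \<nu> = space \<mu>" using sets_eq_imp_space_eq[OF s] .
  then have "(\<integral>\<^sup>+x. f x \<partial>meas_add \<mu> \<nu>) = (\<integral>\<^sup>+x. g x \<partial>meas_add \<mu> \<nu>)"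
    "(\<integral>\<^sup>+x. f x \<partial>\<mu>) = (\<integral>\<^sup>+x. g x \<partial>\<mu>)" "(\<integral>\<^sup>+x. f x \<partial>\<nu>) = (\<integral>\<^sup>+x. g x \<partial>\<nu>)"
    using cong(3) by (auto intro!: nn_integral_cong)
  then show ?case using cong(4) by simp
next
  case (set A)
  then show ?case using s by (simp add: emeasure_meas_add)
next
  case (mult u c)
  have "u \<in> borel_measurable \<nu>" "u \<in> borel_measurable (meas_add \<mu> \<nu>)"
    using mult(2) measurable_cong_sets[OF s refl] measurable_cong_sets[OF sets_meas_add refl] by auto
  then show ?case using mult by (simp add: nn_integral_cmult distrib_left)
next
  case (add u v)
  have "u \<in> borel_measurable \<nu>" "u \<in> borel_measurable (meas_add \<mu> \<nu>)" "v \<in> borel_measurable \<nu>" "v \<in> borel_measurable (meas_add \<mu> \<nu>)"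
    using add(1,3) measurable_cong_sets[OF s refl] measurable_cong_sets[OF sets_meas_add refl] by auto
  then show ?case using add by (simp add: nn_integral_add ac_simps)
next
  case (seq U)
  have m: "U i \<in> borel_measurable \<nu>" "U i \<in> borel_measurable (meas_add \<mu> \<nu>)" for i
    using seq(1) measurable_cong_sets[OF s refl] measurable_cong_sets[OF sets_meas_add refl] by auto
  have inc: "incseq (\<lambda>i. integral\<^sup>N M (U i))" for M
    using seq(3) by (auto simp: incseq_def le_fun_def intro!: nn_integral_mono)
  show ?case
    unfolding SUP_apply
    using seq(1,3) m by (simp add: nn_integral_monotone_convergence_SUP seq.IH ennreal_SUP_add[OF inc inc])
qed

text \<open>The formula for nonnegative functions is applied to the positive and the negative part;
  boundedness of f makes both integrals finite, so that they can be converted to reals.\<close>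

lemma integral_meas_add:
  fixes f :: "'a::topological_space \<Rightarrow> real"
  assumes \<mu>: "\<mu> \<in> fin_measures" and \<nu>: "\<nu> \<in> fin_measures" and [measurable]: "f \<in> borel_measurable borel"
    and bnd: "\<And>x. \<bar>f x\<bar> \<le> C"
  shows "(\<integral>x. f x \<partial>meas_add \<mu> \<nu>) = (\<integral>x. f x \<partial>\<mu>) + (\<integral>x. f x \<partial>\<nu>)"
proof -
  have i: "integrable M f" if "M \<in> fin_measures" for M
    using fin_measuresD[OF that] bnd measurable_cong_sets[OF fin_measuresD(1)[OF that] refl]
    by (intro finite_measure.integrable_const_bound[where B=C]) auto
  have m: "f \<in> borel_measurable \<mu>" "f \<in> borel_measurable \<nu>" using i[OF \<mu>] i[OF \<nu>] by auto
  have s: "sets \<nu> = sets \<mu>" using fin_measuresD(1) \<mu> \<nu> by metis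
  have fin: "(\<integral>\<^sup>+x. ennreal (g x) \<partial>M) < \<infinity>" if "M \<in> fin_measures" "g = f \<or> g = (\<lambda>x. - f x)" for M g
  proof -
    have "integrable M g" using i[OF that(1)] that(2) by auto
    then have "(\<integral>\<^sup>+x. ennreal (norm (g x)) \<partial>M) < \<infinity>" by (simp add: integrable_iff_bounded)
    moreover have "(\<integral>\<^sup>+x. ennreal (g x) \<partial>M) \<le> (\<integral>\<^sup>+x. ennreal (norm (g x)) \<partial>M)"
      by (intro nn_integral_mono ennreal_leI) simp
    ultimately show ?thesis by (rule le_less_trans[rotated])
  qed
  have "enn2real (\<integral>\<^sup>+x. ennreal (g x) \<partial>meas_add \<mu> \<nu>) = enn2real (\<integral>\<^sup>+x. ennreal (g x) \<partial>\<mu>) + enn2real (\<integral>\<^sup>+x. ennreal (g x) \<partial>\<nu>)"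
    if g: "g = f \<or> g = (\<lambda>x. - f x)" for g
    using nn_integral_meas_add[OF s, of "\<lambda>x. ennreal (g x)"] g m fin[OF \<mu> g] fin[OF \<nu> g]
    by (auto simp: enn2real_plus)
  from this[of f] this[of "\<lambda>x. - f x"] show ?thesis
    by (simp add: real_lebesgue_integral_def i \<mu> \<nu> meas_add_fin(1))
qed

lemma scale_measure_eq_density: "scale_measure r M = density M (\<lambda>_. r)"
  by (rule measure_eqI) (auto simp: emeasure_density nn_integral_cmult)

lemma integral_scale_measure:
  fixes f :: "'a \<Rightarrow> real"
  assumes "f \<in> borel_measurable M" "0 \<le> c"
  shows "(\<integral>x. f x \<partial>scale_measure (ennreal c) M) = c * (\<integral>x. f x \<partial>M)"
  unfolding scale_measure_eq_density using assms by (subst integral_density) auto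

text \<open>Mean value inequality for right derivatives. If C' > C and s is the last point with h s
  - C' s \<le> h 0, then s = c, because the right derivative at an earlier s would allow a further
  step.\<close>

lemma right_derivative_bound:
  fixes h :: "real \<Rightarrow> real"
  assumes c: "0 \<le> c" and cont: "continuous_on {0..c} h"
    and der: "\<And>s. 0 \<le> s \<Longrightarrow> s < c \<Longrightarrow> \<exists>D\<le>C. ((\<lambda>\<epsilon>. (h (s + \<epsilon>) - h s) / \<epsilon>) \<longlongrightarrow> D) (at_right 0)"
  shows "h c - h 0 \<le> C * c"
proof (rule field_le_epsilon)
  fix e :: real assume e: "0 < e"
  \<comment> \<open>The slack e / (c + 1) costs less than e over an interval of length c.\<close>
  define C' where "C' = C + e / (c + 1)"
  have C': "C < C'" using e c by (simp add: C'_def)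
  define T where "T = {s \<in> {0..c}. h s - C' * s \<le> h 0}"
  have "closed T"
    unfolding T_def by (intro continuous_on_closed_Collect_le continuous_intros cont)
  have T0: "0 \<in> T" using c by (simp add: T_def)
  have bdd: "bdd_above T" unfolding T_def by (rule bdd_aboveI[of _ c]) auto
  define s where "s = Sup T"
  have sT: "s \<in> T" unfolding s_def using T0 bdd \<open>closed T\<close> by (intro closed_contains_Sup) auto
  have "s = c"
  proof (rule ccontr)
    assume "s \<noteq> c"
    then have s: "0 \<le> s" "s < c" "h s - C' * s \<le> h 0" using sT by (auto simp: T_def)
    then obtain D where D: "D \<le> C" "((\<lambda>\<epsilon>. (h (s + \<epsilon>) - h s) / \<epsilon>) \<longlongrightarrow> D) (at_right 0)" using der by blast
    have "\<forall>\<^sub>F \<epsilon> in at_right 0. (h (s + \<epsilon>) - h s) / \<epsilon> < C'"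
      using D C' by (intro order_tendstoD(2)[OF D(2)]) auto
    then obtain b where b: "0 < b" "\<And>\<epsilon>. 0 < \<epsilon> \<Longrightarrow> \<epsilon> < b \<Longrightarrow> (h (s + \<epsilon>) - h s) / \<epsilon> < C'"
      by (auto simp: eventually_at_right_field)
    define \<epsilon> where "\<epsilon> = min (b / 2) (c - s)"
    have \<epsilon>: "0 < \<epsilon>" "\<epsilon> < b" "s + \<epsilon> \<le> c" using b(1) s(2) by (auto simp: \<epsilon>_def min_def)
    have "h (s + \<epsilon>) - h s < C' * \<epsilon>" using b(2)[OF \<epsilon>(1,2)] \<epsilon>(1) by (simp add: field_simps)
    then have "s + \<epsilon> \<in> T" using s \<epsilon> by (simp add: T_def algebra_simps)
    then have "s + \<epsilon> \<le> s" unfolding s_def by (rule cSup_upper[OF _ bdd])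
    then show False using \<epsilon> by simp
  qed
  then have "h c - h 0 \<le> C' * c" using sT by (simp add: T_def)
  also have "\<dots> \<le> C * c + e" using e c by (simp add: C'_def field_simps)
  finally show "h c - h 0 \<le> C * c + e" .
qed

section \<open>Weak convergence and increments of measures\<close>

definition weak_conv :: "(nat \<Rightarrow> 'a::topological_space measure) \<Rightarrow> 'a measure \<Rightarrow> bool" where
  "weak_conv \<sigma> \<mu> \<longleftrightarrow> (\<forall>f::'a \<Rightarrow> real. continuous_on UNIV f \<and> bounded (range f) \<longrightarrow>
     (\<lambda>n. \<integral>x. f x \<partial>\<sigma> n) \<longlonglongrightarrow> (\<integral>x. f x \<partial>\<mu>))"

lemma topspace_weak_topology: "topspace (weak_topology S) = S"
proof -
  have "S \<in> {{\<mu> \<in> S. (\<integral>x. f x \<partial>\<mu>) \<in> V} | (f :: 'a \<Rightarrow> real) V. continuous_on UNIV f \<and> bounded (range f) \<and> open V}"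
    by (intro CollectI exI[of _ "\<lambda>_. 0"] exI[of _ UNIV]) auto
  then show ?thesis
    unfolding weak_topology_def topology_generated_by_topspace by blast
qed

lemma continuous_map_integral:
  fixes f :: "'a::topological_space \<Rightarrow> real"
  assumes "continuous_on UNIV f" "bounded (range f)"
  shows "continuous_map (weak_topology S) euclideanreal (\<lambda>\<mu>. \<integral>x. f x \<partial>\<mu>)"
  unfolding continuous_map_def topspace_weak_topology
proof (intro conjI allI impI)
  fix V assume "openin euclideanreal V"
  then show "openin (weak_topology S) {\<mu> \<in> S. (\<integral>x. f x \<partial>\<mu>) \<in> V}"
    unfolding weak_topology_def using assms by (intro topology_generated_by_Basis) auto
qed auto

text \<open>The open sets of \<open>weak_topology\<close> are generated from a subbasis. For
  subbasic sets, lying in them eventually is the convergence of one integral, and this property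
  passes to finite intersections and to unions.\<close>

lemma weak_conv_continuous:
  assumes \<sigma>: "\<And>n. \<sigma> n \<in> S" "\<mu> \<in> S" "weak_conv \<sigma> \<mu>"
    and u: "continuous_map (weak_topology S) euclideanreal u"
  shows "(\<lambda>n. u (\<sigma> n)) \<longlonglongrightarrow> u \<mu>"
proof -
  have "\<mu> \<in> U \<longrightarrow> (\<forall>\<^sub>F n in sequentially. \<sigma> n \<in> U)" if "openin (weak_topology S) U" for U
    using that unfolding weak_topology_def openin_topology_generated_by_iff
  proof induction
    case (Basis s)
    then obtain f :: "'a \<Rightarrow> real" and V where s: "s = {\<mu> \<in> S. (\<integral>x. f x \<partial>\<mu>) \<in> V}"
      "continuous_on UNIV f" "bounded (range f)" "open V" by auto
    show ?case
    proof
      assume "\<mu> \<in> s"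
      then have "\<forall>\<^sub>F n in sequentially. (\<integral>x. f x \<partial>\<sigma> n) \<in> V"
        using \<sigma>(3) s by (intro topological_tendstoD[of _ "\<integral>x. f x \<partial>\<mu>"]) (auto simp: weak_conv_def)
      then show "\<forall>\<^sub>F n in sequentially. \<sigma> n \<in> s" using \<sigma>(1) s(1) by simp
    qed
  next
    case (UN K)
    show ?case
    proof
      assume "\<mu> \<in> \<Union> K"
      then obtain k where k: "k \<in> K" "\<mu> \<in> k" by blast
      then have "\<forall>\<^sub>F n in sequentially. \<sigma> n \<in> k" using UN by blast
      then show "\<forall>\<^sub>F n in sequentially. \<sigma> n \<in> \<Union> K" by eventually_elim (use k in blast)
    qed
  qed (auto intro: eventually_conj)
  then have "limitin (weak_topology S) \<sigma> \<mu> sequentially"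
    using \<sigma>(2) by (simp add: limitin_def topspace_weak_topology)
  from continuous_map_limit[OF u this] show ?thesis by (simp add: comp_def)
qed

text \<open>The mass threshold m0 makes one argument fit two situations: it is 0 for functions of
  finite measures, while functions of the normalised measure degenerate near mass 0 and use 1/2.
  Adding mass never leads below the threshold.\<close>

locale dirac_lipschitz =
  fixes U :: "'a::polish_space measure \<Rightarrow> real" and m0 C :: real
  assumes cont: "(\<And>n. \<sigma> n \<in> fin_measures) \<Longrightarrow> (\<And>n. m0 \<le> measure (\<sigma> n) UNIV) \<Longrightarrow> \<mu> \<in> fin_measures
      \<Longrightarrow> m0 \<le> measure \<mu> UNIV \<Longrightarrow> weak_conv \<sigma> \<mu> \<Longrightarrow> (\<lambda>n. U (\<sigma> n)) \<longlonglongrightarrow> U \<mu>"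
    and der: "\<mu> \<in> fin_measures \<Longrightarrow> m0 \<le> measure \<mu> UNIV \<Longrightarrow>
      \<exists>D. \<bar>D\<bar> \<le> C \<and> ((\<lambda>\<epsilon>. (U (meas_add \<mu> (scale_measure (ennreal \<epsilon>) (return borel x))) - U \<mu>) / \<epsilon>) \<longlongrightarrow> D) (at_right 0)"
begin

text \<open>Along s |-> \<mu> + s \<delta>_x the right derivative at s is the derivative at the
  measure \<mu> + s \<delta>_x in direction x, so C bounds it on the whole path. The mean value
  inequality is used for U and for - U.\<close>

lemma dirac_bound:
  assumes \<mu>: "\<mu> \<in> fin_measures" "m0 \<le> measure \<mu> UNIV" and c: "0 \<le> c"
  shows "\<bar>U (meas_add \<mu> (scale_measure (ennreal c) (return borel x))) - U \<mu>\<bar> \<le> C * c"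
proof -
  define p where "p s = meas_add \<mu> (scale_measure (ennreal s) (return borel x))" for s
  have pf: "p s \<in> fin_measures" for s
    unfolding p_def by (intro meas_add_fin \<mu> scale_measure_fin return_fin)
  have pm: "measure (p s) A = measure \<mu> A + s * indicat_real A x" if "0 \<le> s" "A \<in> sets borel" for s A
    unfolding p_def using that \<mu> by (simp add: meas_add_fin scale_measure_fin return_fin measure_return_borel)
  have pm0: "m0 \<le> measure (p s) UNIV" if "0 \<le> s" for s using pm[OF that, of UNIV] \<mu>(2) that by simp
  have p0: "p 0 = \<mu>" by (rule fin_measures_eqI[OF pf \<mu>(1)]) (simp add: pm)
  have padd: "meas_add (p s) (scale_measure (ennreal \<epsilon>) (return borel x)) = p (s + \<epsilon>)" if "0 \<le> s" "0 \<le> \<epsilon>" for s \<epsilon>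
    by (rule fin_measures_eqI)
       (use that in \<open>auto simp: pf meas_add_fin scale_measure_fin return_fin pm measure_return_borel algebra_simps\<close>)
  have pint: "(\<integral>y. f y \<partial>p s) = (\<integral>y. f y \<partial>\<mu>) + s * f x" if s: "0 \<le> s" and f: "continuous_on UNIV f" "bounded (range f)" for s and f :: "'a \<Rightarrow> real"
  proof -
    have [measurable]: "f \<in> borel_measurable borel" using f(1) by (rule borel_measurable_continuous_onI)
    obtain B where B: "\<And>x. \<bar>f x\<bar> \<le> B" using f(2) by (auto simp: bounded_iff)
    show ?thesis
      unfolding p_def using s
      by (simp add: integral_meas_add[OF \<mu>(1) scale_measure_fin(1)[OF return_fin] _ B] integral_scale_measure integral_return)
  qed
  have cts: "continuous_on {0..c} (\<lambda>s. U (p s))"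
    unfolding continuous_on_sequentially comp_def
  proof (intro allI ballI impI)
    fix t :: "nat \<Rightarrow> real" and s assume s: "s \<in> {0..c}" and t: "(\<forall>n. t n \<in> {0..c}) \<and> t \<longlonglongrightarrow> s"
    have t0: "0 \<le> t n" for n using t by auto
    show "(\<lambda>n. U (p (t n))) \<longlonglongrightarrow> U (p s)"
    proof (rule cont)
      show "weak_conv (\<lambda>n. p (t n)) (p s)"
        unfolding weak_conv_def
      proof (intro allI impI)
        fix f :: "'a \<Rightarrow> real" assume f: "continuous_on UNIV f \<and> bounded (range f)"
        have "(\<lambda>n. (\<integral>y. f y \<partial>\<mu>) + t n * f x) \<longlonglongrightarrow> (\<integral>y. f y \<partial>\<mu>) + s * f x"
          using t by (intro tendsto_intros) auto
        then show "(\<lambda>n. \<integral>y. f y \<partial>p (t n)) \<longlonglongrightarrow> (\<integral>y. f y \<partial>p s)" using f s t0 by (simp add: pint)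
      qed
    qed (use s t0 pf pm0 in auto)
  qed
  have d: "\<exists>D. \<bar>D\<bar> \<le> C \<and> ((\<lambda>\<epsilon>. (U (p (s + \<epsilon>)) - U (p s)) / \<epsilon>) \<longlongrightarrow> D) (at_right 0)" if s: "0 \<le> s" for s
  proof -
    obtain D where D: "\<bar>D\<bar> \<le> C" "((\<lambda>\<epsilon>. (U (meas_add (p s) (scale_measure (ennreal \<epsilon>) (return borel x))) - U (p s)) / \<epsilon>) \<longlongrightarrow> D) (at_right 0)"
      using der[OF pf pm0[OF s]] by blast
    have "((\<lambda>\<epsilon>. (U (p (s + \<epsilon>)) - U (p s)) / \<epsilon>) \<longlongrightarrow> D) (at_right 0)"
      by (rule Lim_transform_eventually[OF D(2)])
         (auto simp: eventually_at_right_field padd s intro!: exI[of _ 1])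
    then show ?thesis using D(1) by blast
  qed
  have "U (p c) - U (p 0) \<le> C * c"
  proof (rule right_derivative_bound[OF c cts])
    show "\<exists>D\<le>C. ((\<lambda>\<epsilon>. (U (p (s + \<epsilon>)) - U (p s)) / \<epsilon>) \<longlongrightarrow> D) (at_right 0)" if "0 \<le> s" "s < c" for s
      using d[OF that(1)] by (auto simp: abs_le_iff)
  qed
  moreover have "- U (p c) - - U (p 0) \<le> C * c"
  proof (rule right_derivative_bound[OF c continuous_on_minus[OF cts]])
    fix s assume "0 \<le> s" "s < c"
    then obtain D where D: "\<bar>D\<bar> \<le> C" "((\<lambda>\<epsilon>. (U (p (s + \<epsilon>)) - U (p s)) / \<epsilon>) \<longlongrightarrow> D) (at_right 0)" using d by blast
    have "((\<lambda>\<epsilon>. (- U (p (s + \<epsilon>)) - - U (p s)) / \<epsilon>) \<longlongrightarrow> - D) (at_right 0)"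
      using tendsto_minus[OF D(2)] by (simp add: minus_divide_left)
    then show "\<exists>D\<le>C. ((\<lambda>\<epsilon>. (- U (p (s + \<epsilon>)) - - U (p s)) / \<epsilon>) \<longlongrightarrow> D) (at_right 0)"
      using D(1) by (intro exI[of _ "- D"]) auto
  qed
  ultimately show ?thesis unfolding p0 by (simp add: p_def abs_le_iff)
qed

text \<open>Induction over the support: the mass at x is split off, the rest is added first by the
  induction hypothesis, and what remains is a single Dirac increment.\<close>

lemma finite_support_bound:
  assumes "finite X"
  shows "\<mu> \<in> fin_measures \<Longrightarrow> m0 \<le> measure \<mu> UNIV \<Longrightarrow> \<nu> \<in> fin_measures \<Longrightarrow> measure \<nu> (- X) = 0 \<Longrightarrow>
     \<bar>U (meas_add \<mu> \<nu>) - U \<mu>\<bar> \<le> C * measure \<nu> UNIV"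
  using assms
proof (induction X arbitrary: \<nu> rule: finite_induct)
  case empty
  interpret n: finite_measure \<nu> using fin_measuresD[OF empty(3)] by simp
  have "measure \<nu> A = 0" if "A \<in> sets borel" for A
    using n.finite_measure_mono[of A UNIV] empty(4) that fin_measuresD[OF empty(3)] by (simp add: measure_le_0_iff)
  then have "meas_add \<mu> \<nu> = \<mu>"
    by (intro fin_measures_eqI) (use empty in \<open>auto simp: meas_add_fin\<close>)
  then show ?case using empty by simp
next
  case (insert x X)
  note \<mu> = insert.prems(1,2) and \<nu> = insert.prems(3)
  interpret n: finite_measure \<nu> using fin_measuresD[OF \<nu>] by simp
  have sn: "sets \<nu> = sets borel" "space \<nu> = UNIV" using fin_measuresD[OF \<nu>] by auto
  have mX: "- X \<in> sets borel" "- {x} \<in> sets borel" "{x} \<in> sets borel" "- insert x X \<in> sets borel"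
    using insert(1) by (auto intro!: borel_open finite_imp_closed)
  define \<nu>' where "\<nu>' = density \<nu> (indicator (- {x}))"
  have e': "emeasure \<nu>' A = emeasure \<nu> (- {x} \<inter> A)" if "A \<in> sets borel" for A
    unfolding \<nu>'_def using that mX sn by (intro emeasure_restricted) auto
  have m': "measure \<nu>' A = measure \<nu> (- {x} \<inter> A)" if "A \<in> sets borel" for A
    using e'[OF that] by (simp add: measure_def)
  have "finite_measure \<nu>'"
    by (rule finite_measureI) (use e'[of UNIV] sn in \<open>simp add: \<nu>'_def\<close>)
  then have f': "\<nu>' \<in> fin_measures" using sn by (simp add: fin_measures_def \<nu>'_def)
  have "- {x} \<inter> - X = - insert x X" by auto
  then have z: "measure \<nu>' (- X) = 0" using m'[OF mX(1)] insert.prems(4) by simp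
  have split: "measure \<nu> A = measure \<nu>' A + measure \<nu> {x} * indicat_real A x" if A: "A \<in> sets borel" for A
  proof -
    have "measure \<nu> A = measure \<nu> (A - {x}) + measure \<nu> (A \<inter> {x})"
      using n.finite_measure_Union[of "A - {x}" "A \<inter> {x}"] A mX sn by (auto simp: Un_Diff_Int sets.Diff sets.Int)
    moreover have "A - {x} = - {x} \<inter> A" by auto
    moreover have "measure \<nu> (A \<inter> {x}) = measure \<nu> {x} * indicat_real A x" by (auto simp: indicator_def)
    ultimately show ?thesis using m'[OF A] by simp
  qed
  let ?c = "measure \<nu> {x}"
  have eq: "meas_add \<mu> \<nu> = meas_add (meas_add \<mu> \<nu>') (scale_measure (ennreal ?c) (return borel x))"
  proof (rule fin_measures_eqI)
    show "measure (meas_add \<mu> \<nu>) A = measure (meas_add (meas_add \<mu> \<nu>') (scale_measure (ennreal ?c) (return borel x))) A"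
      if "A \<in> sets borel" for A
      using that \<mu> \<nu> f' split[OF that]
      by (simp add: meas_add_fin scale_measure_fin return_fin measure_return_borel)
  qed (use \<mu> \<nu> f' in \<open>auto simp: meas_add_fin scale_measure_fin return_fin\<close>)
  have "\<bar>U (meas_add \<mu> \<nu>') - U \<mu>\<bar> \<le> C * measure \<nu>' UNIV" by (rule insert.IH[OF \<mu> f' z])
  moreover have "\<bar>U (meas_add \<mu> \<nu>) - U (meas_add \<mu> \<nu>')\<bar> \<le> C * ?c"
    unfolding eq
  proof (rule dirac_bound)
    show "m0 \<le> measure (meas_add \<mu> \<nu>') UNIV" using \<mu> f' by (simp add: meas_add_fin add_increasing2)
  qed (use \<mu> f' in \<open>auto simp: meas_add_fin\<close>)
  ultimately have "\<bar>U (meas_add \<mu> \<nu>) - U \<mu>\<bar> \<le> C * (measure \<nu>' UNIV + ?c)" by (simp add: distrib_left)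
  then show ?case using split[of UNIV] by simp
qed

text \<open>Simple functions G i tending pointwise to the identity push \<nu> to finitely supported
  measures of the same mass, which converge weakly to \<nu>. The bound for finite supports involves
  the mass only, so it survives the limit.\<close>

lemma add_bound:
  assumes \<mu>: "\<mu> \<in> fin_measures" "m0 \<le> measure \<mu> UNIV" and \<nu>: "\<nu> \<in> fin_measures"
  shows "\<bar>U (meas_add \<mu> \<nu>) - U \<mu>\<bar> \<le> C * measure \<nu> UNIV"
proof -
  interpret n: finite_measure \<nu> using fin_measuresD[OF \<nu>] by simp
  have sn [measurable_cong]: "sets \<nu> = sets borel" and spn [simp]: "space \<nu> = UNIV" using fin_measuresD[OF \<nu>] by auto
  have "(\<lambda>x. x) \<in> borel_measurable \<nu>" by simp
  from borel_measurable_implies_sequence_metric[OF this, of undefined] obtain G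
    where G: "\<And>i. simple_function \<nu> (G i)" "\<And>x. (\<lambda>i. G i x) \<longlonglongrightarrow> x" by auto
  have [measurable]: "G i \<in> borel_measurable \<nu>" for i by (rule borel_measurable_simple_function[OF G(1)])
  define \<nu>' where "\<nu>' i = distr \<nu> borel (G i)" for i
  have "finite_measure (\<nu>' i)" for i unfolding \<nu>'_def by (rule n.finite_measure_distr) simp
  then have f': "\<nu>' i \<in> fin_measures" for i by (simp add: fin_measures_def \<nu>'_def)
  have mass: "measure (\<nu>' i) UNIV = measure \<nu> UNIV" for i
    unfolding \<nu>'_def by (simp add: measure_distr)
  have le: "\<bar>U (meas_add \<mu> (\<nu>' i)) - U \<mu>\<bar> \<le> C * measure \<nu> UNIV" for i
  proof -
    have fin: "finite (range (G i))" using simple_functionD(1)[OF G(1), of i] by simp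
    then have "- range (G i) \<in> sets borel" by (auto intro!: borel_open finite_imp_closed)
    moreover have "G i -` (- range (G i)) = {}" by auto
    ultimately have "measure (\<nu>' i) (- range (G i)) = 0" unfolding \<nu>'_def by (simp add: measure_distr)
    from finite_support_bound[OF fin \<mu> f' this] show ?thesis by (simp add: mass)
  qed
  have "(\<lambda>i. U (meas_add \<mu> (\<nu>' i))) \<longlonglongrightarrow> U (meas_add \<mu> \<nu>)"
  proof (rule cont)
    show "weak_conv (\<lambda>i. meas_add \<mu> (\<nu>' i)) (meas_add \<mu> \<nu>)"
      unfolding weak_conv_def
    proof (intro allI impI)
      fix f :: "'a \<Rightarrow> real" assume f: "continuous_on UNIV f \<and> bounded (range f)"
      then have [measurable]: "f \<in> borel_measurable borel" by (intro borel_measurable_continuous_onI) auto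
      obtain B where B: "\<And>x. \<bar>f x\<bar> \<le> B" using f by (auto simp: bounded_iff)
      have "(\<lambda>i. \<integral>x. f (G i x) \<partial>\<nu>) \<longlonglongrightarrow> (\<integral>x. f x \<partial>\<nu>)"
      proof (rule integral_dominated_convergence[where w="\<lambda>_. B"])
        show "AE x in \<nu>. (\<lambda>i. f (G i x)) \<longlonglongrightarrow> f x"
          using f G(2) by (intro AE_I2 continuous_on_tendsto_compose[of UNIV f]) auto
        show "AE x in \<nu>. norm (f (G i x)) \<le> B" for i using B by simp
      qed auto
      moreover have "(\<integral>x. f x \<partial>\<nu>' i) = (\<integral>x. f (G i x) \<partial>\<nu>)" for i
        unfolding \<nu>'_def by (rule integral_distr) auto
      ultimately show "(\<lambda>i. \<integral>x. f x \<partial>meas_add \<mu> (\<nu>' i)) \<longlonglongrightarrow> (\<integral>x. f x \<partial>meas_add \<mu> \<nu>)"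
        by (simp add: integral_meas_add[OF \<mu>(1) _ _ B] f' \<nu> tendsto_intros)
    qed
  qed (use \<mu> \<nu> f' in \<open>auto simp: meas_add_fin add_increasing2\<close>)
  then have "(\<lambda>i. \<bar>U (meas_add \<mu> (\<nu>' i)) - U \<mu>\<bar>) \<longlonglongrightarrow> \<bar>U (meas_add \<mu> \<nu>) - U \<mu>\<bar>"
    by (intro tendsto_intros)
  then show ?thesis by (rule LIMSEQ_le_const2) (use le in auto)
qed

end

text \<open>For densities a and b, \<kappa> has density min(a, b), and \<alpha>, \<beta> have the
  excesses (a - b)^+ and (b - a)^+, which add up to |a - b|. Both measures thus arise from \<kappa>
  by adding mass, the direction in which the derivative gives control.\<close>

lemma (in ac_space) common_part:
  assumes \<gamma>: "\<gamma> \<in> ac" and \<eta>: "\<eta> \<in> ac"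
  obtains \<kappa> \<alpha> \<beta> where "\<kappa> \<in> fin_measures" "\<alpha> \<in> fin_measures" "\<beta> \<in> fin_measures"
    "\<gamma> = meas_add \<kappa> \<alpha>" "\<eta> = meas_add \<kappa> \<beta>" "measure \<alpha> UNIV + measure \<beta> UNIV = rho_var lam \<gamma> \<eta>"
proof -
  define a where "a = dens lam \<gamma>"
  define b where "b = dens lam \<eta>"
  have i: "integrable lam a" "integrable lam b" by (auto simp: a_def b_def integrable_dens \<gamma> \<eta>)
  note [measurable] = borel_measurable_integrable[OF i(1)] borel_measurable_integrable[OF i(2)]
  have nn: "0 \<le> a x" "0 \<le> b x" for x by (auto simp: a_def b_def)
  define den where "den g = density lam (\<lambda>x. ennreal (g x))" for g
  have den: "den g \<in> fin_measures" "measure (den g) A = (\<integral>x. g x * indicat_real A x \<partial>lam)"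
    if "integrable lam g" "\<And>x. 0 \<le> g x" "A \<in> sets borel" for g A
  proof -
    have m [measurable]: "g \<in> borel_measurable lam" using that by simp
    show f: "den g \<in> fin_measures" using density_in_ac(1)[OF that(1,2)] by (simp add: den_def ac_part_def)
    have "measure (den g) A = (\<integral>x. indicat_real A x \<partial>den g)"
      using that(3) fin_measuresD[OF f] by simp
    also have "\<dots> = (\<integral>x. g x * indicat_real A x \<partial>lam)"
      unfolding den_def using that by (subst integral_density) (auto simp: sets_lam)
    finally show "measure (den g) A = (\<integral>x. g x * indicat_real A x \<partial>lam)" .
  qed
  let ?k = "\<lambda>x. min (a x) (b x)" and ?a = "\<lambda>x. max 0 (a x - b x)" and ?b = "\<lambda>x. max 0 (b x - a x)"
  have ii: "integrable lam ?k" "integrable lam ?a" "integrable lam ?b" using i by auto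
  have add: "den g = meas_add (den h) (den k)"
    if "integrable lam h" "integrable lam k" "\<And>x. 0 \<le> h x" "\<And>x. 0 \<le> k x" "\<And>x. g x = h x + k x" for g h k
  proof (rule fin_measures_eqI)
    have "g = (\<lambda>x. h x + k x)" using that(5) by auto
    then have g: "integrable lam g" "\<And>x. 0 \<le> g x" using that(1-4) by auto
    show "den g \<in> fin_measures" "meas_add (den h) (den k) \<in> fin_measures"
      using den(1)[of _ UNIV] that g by (auto intro!: meas_add_fin)
    fix A :: "'a set" assume A: "A \<in> sets borel"
    have "measure (den g) A = (\<integral>x. h x * indicat_real A x + k x * indicat_real A x \<partial>lam)"
      unfolding den(2)[OF g A] by (simp add: that(5) distrib_right)
    also have "\<dots> = measure (den h) A + measure (den k) A"
      unfolding den(2)[OF that(1,3) A] den(2)[OF that(2,4) A]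
      using that A by (intro Bochner_Integration.integral_add integrable_real_mult_indicator) (auto simp: sets_lam)
    also have "\<dots> = measure (meas_add (den h) (den k)) A"
      using den(1)[of _ UNIV] that A by (simp add: meas_add_fin)
    finally show "measure (den g) A = measure (meas_add (den h) (den k)) A" .
  qed
  show ?thesis
  proof (rule that[of "den ?k" "den ?a" "den ?b"])
    show "den ?k \<in> fin_measures" "den ?a \<in> fin_measures" "den ?b \<in> fin_measures"
      using den(1)[of _ UNIV] ii nn by auto
    have "den a = \<gamma>" "den b = \<eta>" by (auto simp: den_def a_def b_def density_dens \<gamma> \<eta>)
    then show "\<gamma> = meas_add (den ?k) (den ?a)" "\<eta> = meas_add (den ?k) (den ?b)"
      using add[OF ii(1,2), of a] add[OF ii(1,3), of b] nn by auto
    have "measure (den ?a) UNIV + measure (den ?b) UNIV = (\<integral>x. ?a x \<partial>lam) + (\<integral>x. ?b x \<partial>lam)"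
      using den(2)[OF ii(2), of UNIV] den(2)[OF ii(3), of UNIV] by simp
    also have "\<dots> = (\<integral>x. ?a x + ?b x \<partial>lam)" using ii by simp
    also have "\<dots> = rho_var lam \<gamma> \<eta>"
      unfolding rho_var_dens a_def[symmetric] b_def[symmetric] by (intro Bochner_Integration.integral_cong) auto
    finally show "measure (den ?a) UNIV + measure (den ?b) UNIV = rho_var lam \<gamma> \<eta>" .
  qed
qed

section \<open>Extrinsically differentiable functions\<close>

text \<open>Common form of the two function classes: B is the set of measures, and p \<mu> x is the
  path from \<mu> along which the derivative in direction x is taken.\<close>

definition ext_class :: "'a::polish_space measure set \<Rightarrow> ('a measure \<Rightarrow> 'a \<Rightarrow> real \<Rightarrow> 'a measure) \<Rightarrow> ('a measure \<Rightarrow> real) set" where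
  "ext_class B p = {u. continuous_map (weak_topology B) euclideanreal u \<and>
     (\<forall>\<mu>\<in>B. \<forall>x. \<exists>D. ((\<lambda>\<epsilon>. (u (p \<mu> x \<epsilon>) - u \<mu>) / \<epsilon>) \<longlongrightarrow> D) (at_right 0)) \<and>
     continuous_map (prod_topology (weak_topology B) euclidean) euclideanreal
        (\<lambda>(\<mu>, x). Lim (at_right 0) (\<lambda>\<epsilon>. (u (p \<mu> x \<epsilon>) - u \<mu>) / \<epsilon>)) \<and>
     (\<exists>C. \<forall>\<mu>\<in>B. \<forall>x. \<bar>u \<mu>\<bar> + \<bar>Lim (at_right 0) (\<lambda>\<epsilon>. (u (p \<mu> x \<epsilon>) - u \<mu>) / \<epsilon>)\<bar> \<le> C)}"

lemma CE1b_M_eq: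
  "CE1b_M = ext_class fin_measures (\<lambda>\<mu> x \<epsilon>. meas_add \<mu> (scale_measure (ennreal \<epsilon>) (return borel x)))"
  unfolding CE1b_M_def ext_class_def DE_def ext_quot_def[abs_def] by simp

lemma CE1b_P_eq:
  "CE1b_P = ext_class prob_measures (\<lambda>\<mu> x \<epsilon>. meas_add (scale_measure (ennreal (1 - \<epsilon>)) \<mu>) (scale_measure (ennreal \<epsilon>) (return borel x)))"
  unfolding CE1b_P_def ext_class_def DE_P_def ext_quot_P_def[abs_def] by simp

text \<open>The derivative is a named G instead of a \<open>Lim\<close>, and a one-sided
  \<open>has_real_derivative\<close> instead of a quotient, to make the chain rule available. A
  bound on u is left out on purpose: integrals of bounded continuous functions can be unbounded on
  finite measures although their derivatives are bounded.\<close>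

definition ext_diff :: "'a::polish_space measure set \<Rightarrow> ('a measure \<Rightarrow> 'a \<Rightarrow> real \<Rightarrow> 'a measure) \<Rightarrow> ('a measure \<Rightarrow> real) \<Rightarrow> ('a measure \<Rightarrow> 'a \<Rightarrow> real) \<Rightarrow> bool" where
  "ext_diff B p u G \<longleftrightarrow> continuous_map (weak_topology B) euclideanreal u \<and>
     (\<forall>\<mu>\<in>B. \<forall>x. ((\<lambda>\<epsilon>. u (p \<mu> x \<epsilon>)) has_real_derivative G \<mu> x) (at 0 within {0<..})) \<and>
     continuous_map (prod_topology (weak_topology B) euclidean) euclideanreal (\<lambda>z. G (fst z) (snd z)) \<and>
     (\<exists>C. \<forall>\<mu>\<in>B. \<forall>x. \<bar>G \<mu> x\<bar> \<le> C)"

locale ext_paths =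
  fixes B :: "'a::polish_space measure set" and p :: "'a measure \<Rightarrow> 'a \<Rightarrow> real \<Rightarrow> 'a measure"
    and L :: "('a \<Rightarrow> real) \<Rightarrow> 'a measure \<Rightarrow> 'a \<Rightarrow> real"
  assumes p_0: "\<mu> \<in> B \<Longrightarrow> p \<mu> x 0 = \<mu>"
    and integral_ext_diff: "continuous_on UNIV f \<Longrightarrow> bounded (range f) \<Longrightarrow> ext_diff B p (\<lambda>\<mu>. \<integral>x. f x \<partial>\<mu>) (L f)"
begin

lemma quot_iff:
  assumes "\<mu> \<in> B"
  shows "((\<lambda>\<epsilon>. u (p \<mu> x \<epsilon>)) has_real_derivative D) (at 0 within {0<..}) \<longleftrightarrow>
    ((\<lambda>\<epsilon>. (u (p \<mu> x \<epsilon>) - u \<mu>) / \<epsilon>) \<longlongrightarrow> D) (at_right 0)"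
  by (simp add: has_field_derivative_iff p_0 assms)

lemma ext_classI:
  assumes u: "ext_diff B p u G" and bnd: "\<And>\<mu>. \<mu> \<in> B \<Longrightarrow> \<bar>u \<mu>\<bar> \<le> C"
  shows "u \<in> ext_class B p"
proof -
  have l: "((\<lambda>\<epsilon>. (u (p \<mu> x \<epsilon>) - u \<mu>) / \<epsilon>) \<longlongrightarrow> G \<mu> x) (at_right 0)" if "\<mu> \<in> B" for \<mu> x
    using u that by (simp add: ext_diff_def quot_iff)
  have Lim: "Lim (at_right 0) (\<lambda>\<epsilon>. (u (p \<mu> x \<epsilon>) - u \<mu>) / \<epsilon>) = G \<mu> x" if "\<mu> \<in> B" for \<mu> x
    by (rule tendsto_Lim[OF _ l[OF that]]) simp
  obtain C' where C': "\<And>\<mu> x. \<mu> \<in> B \<Longrightarrow> \<bar>G \<mu> x\<bar> \<le> C'" using u unfolding ext_diff_def by blast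
  have "continuous_map (prod_topology (weak_topology B) euclidean) euclideanreal
        (\<lambda>(\<mu>, x). Lim (at_right 0) (\<lambda>\<epsilon>. (u (p \<mu> x \<epsilon>) - u \<mu>) / \<epsilon>))"
    by (rule continuous_map_eq[of _ _ "\<lambda>z. G (fst z) (snd z)"])
       (use u Lim in \<open>auto simp: ext_diff_def topspace_weak_topology\<close>)
  moreover have "\<bar>u \<mu>\<bar> + \<bar>Lim (at_right 0) (\<lambda>\<epsilon>. (u (p \<mu> x \<epsilon>) - u \<mu>) / \<epsilon>)\<bar> \<le> C + C'" if "\<mu> \<in> B" for \<mu> x
    using bnd[OF that] C'[OF that, of x] by (simp add: Lim that)
  moreover have "continuous_map (weak_topology B) euclideanreal u" using u by (simp add: ext_diff_def)
  ultimately show ?thesis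
    using l unfolding ext_class_def by blast
qed

lemma ext_classE:
  assumes u: "u \<in> ext_class B p"
  obtains G C where "ext_diff B p u G" "\<And>\<mu>. \<mu> \<in> B \<Longrightarrow> \<bar>u \<mu>\<bar> \<le> C" "\<And>\<mu> x. \<mu> \<in> B \<Longrightarrow> \<bar>G \<mu> x\<bar> \<le> C"
proof -
  define G where "G \<mu> x = Lim (at_right 0) (\<lambda>\<epsilon>. (u (p \<mu> x \<epsilon>) - u \<mu>) / \<epsilon>)" for \<mu> x
  obtain C where C: "\<And>\<mu> x. \<mu> \<in> B \<Longrightarrow> \<bar>u \<mu>\<bar> + \<bar>G \<mu> x\<bar> \<le> C"
    using u unfolding ext_class_def G_def by blast
  have "((\<lambda>\<epsilon>. u (p \<mu> x \<epsilon>)) has_real_derivative G \<mu> x) (at 0 within {0<..})" if \<mu>: "\<mu> \<in> B" for \<mu> x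
  proof -
    obtain D where D: "((\<lambda>\<epsilon>. (u (p \<mu> x \<epsilon>) - u \<mu>) / \<epsilon>) \<longlongrightarrow> D) (at_right 0)"
      using u \<mu> unfolding ext_class_def by blast
    have "G \<mu> x = D" unfolding G_def by (rule tendsto_Lim[OF _ D]) simp
    then show ?thesis using D \<mu> by (simp add: quot_iff)
  qed
  moreover have Cu: "\<bar>u \<mu>\<bar> \<le> C" and CG: "\<bar>G \<mu> x\<bar> \<le> C" if "\<mu> \<in> B" for \<mu> x
    using C[OF that, of x] by auto
  moreover have "continuous_map (weak_topology B) euclideanreal u"
    "continuous_map (prod_topology (weak_topology B) euclidean) euclideanreal (\<lambda>z. G (fst z) (snd z))"
    using u by (auto simp: ext_class_def G_def case_prod_unfold)
  ultimately have "ext_diff B p u G" unfolding ext_diff_def by blast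
  then show ?thesis by (rule that[OF _ Cu CG])
qed

text \<open>A global bound on the outer derivative keeps the composed derivative bounded even when u
  ranges over an unbounded set.\<close>

lemma ext_diff_compose:
  assumes u: "ext_diff B p u G" and \<phi>: "\<And>t. (\<phi> has_real_derivative \<phi>' t) (at t)"
    and \<phi>': "continuous_on UNIV \<phi>'" "\<And>t. \<bar>\<phi>' t\<bar> \<le> 1"
  shows "ext_diff B p (\<lambda>\<mu>. \<phi> (u \<mu>)) (\<lambda>\<mu> x. \<phi>' (u \<mu>) * G \<mu> x)"
  unfolding ext_diff_def
proof (intro conjI ballI allI)
  have c\<phi>: "continuous_map euclideanreal euclideanreal \<phi>" "continuous_map euclideanreal euclideanreal \<phi>'"
    using \<phi>'(1) DERIV_isCont[OF \<phi>] by (auto intro!: continuous_at_imp_continuous_on)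
  have cu: "continuous_map (weak_topology B) euclideanreal u" using u by (simp add: ext_diff_def)
  show "continuous_map (weak_topology B) euclideanreal (\<lambda>\<mu>. \<phi> (u \<mu>))"
    using continuous_map_compose[OF cu c\<phi>(1)] by (simp add: comp_def)
  have "continuous_map (prod_topology (weak_topology B) euclidean) euclideanreal (\<lambda>z. \<phi>' (u (fst z)))"
    using continuous_map_compose[OF continuous_map_fst continuous_map_compose[OF cu c\<phi>(2)]] by (simp add: comp_def)
  then show "continuous_map (prod_topology (weak_topology B) euclidean) euclideanreal (\<lambda>z. \<phi>' (u (fst z)) * G (fst z) (snd z))"
    using u by (intro continuous_map_real_mult) (simp_all add: ext_diff_def)
  obtain C where C: "\<And>\<mu> x. \<mu> \<in> B \<Longrightarrow> \<bar>G \<mu> x\<bar> \<le> C" using u unfolding ext_diff_def by blast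
  have "\<bar>\<phi>' (u \<mu>) * G \<mu> x\<bar> \<le> C" if "\<mu> \<in> B" for \<mu> x
  proof -
    have "\<bar>\<phi>' (u \<mu>)\<bar> * \<bar>G \<mu> x\<bar> \<le> 1 * C" by (intro mult_mono \<phi>'(2) C[OF that]) auto
    then show ?thesis by (simp add: abs_mult)
  qed
  then show "\<exists>C. \<forall>\<mu>\<in>B. \<forall>x. \<bar>\<phi>' (u \<mu>) * G \<mu> x\<bar> \<le> C" by blast
  fix \<mu> x assume \<mu>: "\<mu> \<in> B"
  have "((\<lambda>\<epsilon>. u (p \<mu> x \<epsilon>)) has_real_derivative G \<mu> x) (at 0 within {0<..})" using u \<mu> by (simp add: ext_diff_def)
  from DERIV_chain2[OF \<phi> this]
  show "((\<lambda>\<epsilon>. \<phi> (u (p \<mu> x \<epsilon>))) has_real_derivative \<phi>' (u \<mu>) * G \<mu> x) (at 0 within {0<..})"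
    by (simp add: p_0 \<mu>)
qed

lemma ext_diff_lin:
  assumes u: "ext_diff B p u G" and v: "ext_diff B p v H"
  shows "ext_diff B p (\<lambda>\<mu>. a * u \<mu> + b * v \<mu>) (\<lambda>\<mu> x. a * G \<mu> x + b * H \<mu> x)"
  unfolding ext_diff_def
proof (intro conjI ballI allI)
  show "continuous_map (weak_topology B) euclideanreal (\<lambda>\<mu>. a * u \<mu> + b * v \<mu>)"
    using u v by (intro continuous_map_add continuous_map_real_mult_left) (simp_all add: ext_diff_def)
  show "continuous_map (prod_topology (weak_topology B) euclidean) euclideanreal (\<lambda>z. a * G (fst z) (snd z) + b * H (fst z) (snd z))"
    using u v by (intro continuous_map_add continuous_map_real_mult_left) (simp_all add: ext_diff_def)
  obtain C where C: "\<And>\<mu> x. \<mu> \<in> B \<Longrightarrow> \<bar>G \<mu> x\<bar> \<le> C" using u unfolding ext_diff_def by blast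
  obtain C' where C': "\<And>\<mu> x. \<mu> \<in> B \<Longrightarrow> \<bar>H \<mu> x\<bar> \<le> C'" using v unfolding ext_diff_def by blast
  have "\<bar>a * G \<mu> x + b * H \<mu> x\<bar> \<le> \<bar>a\<bar> * C + \<bar>b\<bar> * C'" if "\<mu> \<in> B" for \<mu> x
  proof -
    have "\<bar>a * G \<mu> x\<bar> \<le> \<bar>a\<bar> * C" "\<bar>b * H \<mu> x\<bar> \<le> \<bar>b\<bar> * C'"
      using C[OF that, of x] C'[OF that, of x] by (auto simp: abs_mult intro!: mult_left_mono)
    then show ?thesis by linarith
  qed
  then show "\<exists>C. \<forall>\<mu>\<in>B. \<forall>x. \<bar>a * G \<mu> x + b * H \<mu> x\<bar> \<le> C" by blast
  fix \<mu> x assume \<mu>: "\<mu> \<in> B"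
  show "((\<lambda>\<epsilon>. a * u (p \<mu> x \<epsilon>) + b * v (p \<mu> x \<epsilon>)) has_real_derivative a * G \<mu> x + b * H \<mu> x) (at 0 within {0<..})"
    using u v \<mu> by (intro DERIV_add DERIV_cmult) (auto simp: ext_diff_def)
qed

lemma ext_diff_const: "ext_diff B p (\<lambda>\<mu>. c) (\<lambda>\<mu> x. 0)"
  by (auto simp: ext_diff_def)

lemma ext_class_lin:
  assumes u: "u \<in> ext_class B p" and v: "v \<in> ext_class B p"
  shows "(\<lambda>\<mu>. a * u \<mu> + b * v \<mu>) \<in> ext_class B p"
proof -
  obtain G C where G: "ext_diff B p u G" "\<And>\<mu>. \<mu> \<in> B \<Longrightarrow> \<bar>u \<mu>\<bar> \<le> C" using ext_classE[OF u] by metis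
  obtain H C' where H: "ext_diff B p v H" "\<And>\<mu>. \<mu> \<in> B \<Longrightarrow> \<bar>v \<mu>\<bar> \<le> C'" using ext_classE[OF v] by metis
  show ?thesis
  proof (rule ext_classI[OF ext_diff_lin[OF G(1) H(1)]])
    fix \<mu> assume \<mu>: "\<mu> \<in> B"
    have "\<bar>a * u \<mu>\<bar> \<le> \<bar>a\<bar> * C" "\<bar>b * v \<mu>\<bar> \<le> \<bar>b\<bar> * C'"
      using G(2)[OF \<mu>] H(2)[OF \<mu>] by (auto simp: abs_mult intro!: mult_left_mono)
    then show "\<bar>a * u \<mu> + b * v \<mu>\<bar> \<le> \<bar>a\<bar> * C + \<bar>b\<bar> * C'" by linarith
  qed
qed

lemma ext_class_const: "(\<lambda>\<mu>. c) \<in> ext_class B p"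
  by (rule ext_classI[OF ext_diff_const]) (rule order_refl)

text \<open>The shift s covers three uses: s = 0 is the smoothed absolute value, s = 1 and s = - 1
  are the two parts of \<open>smooth_clamp\<close>.\<close>

lemma sqrt_deriv:
  assumes "0 < e"
  shows "((\<lambda>t. sqrt ((t + s)\<^sup>2 + e)) has_real_derivative (t + s) / sqrt ((t + s)\<^sup>2 + e)) (at t)"
    "continuous_on UNIV (\<lambda>t. (t + s) / sqrt ((t + s)\<^sup>2 + e))" "\<bar>(t + s) / sqrt ((t + s)\<^sup>2 + e)\<bar> \<le> 1"
proof -
  have pos: "0 < (t + s)\<^sup>2 + e" for t using assms by (simp add: add_nonneg_pos)
  show "((\<lambda>t. sqrt ((t + s)\<^sup>2 + e)) has_real_derivative (t + s) / sqrt ((t + s)\<^sup>2 + e)) (at t)"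
    using pos[of t] by (auto intro!: derivative_eq_intros simp: field_simps)
  have "sqrt ((t + s)\<^sup>2 + e) \<noteq> 0" for t using pos[of t] by simp
  then show "continuous_on UNIV (\<lambda>t. (t + s) / sqrt ((t + s)\<^sup>2 + e))" by (intro continuous_intros) auto
  have "\<bar>t + s\<bar> \<le> sqrt ((t + s)\<^sup>2 + e)" using assms by (intro real_le_rsqrt) simp
  then show "\<bar>(t + s) / sqrt ((t + s)\<^sup>2 + e)\<bar> \<le> 1" using pos[of t] by (simp add: abs_divide divide_le_eq_1)
qed

lemma ext_class_sqrt:
  assumes u: "u \<in> ext_class B p" and e: "0 < e"
  shows "(\<lambda>\<mu>. sqrt ((u \<mu>)\<^sup>2 + e)) \<in> ext_class B p"
proof -
  obtain G C where G: "ext_diff B p u G" "\<And>\<mu>. \<mu> \<in> B \<Longrightarrow> \<bar>u \<mu>\<bar> \<le> C" using ext_classE[OF u] by metis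
  show ?thesis
  proof (rule ext_classI)
    show "ext_diff B p (\<lambda>\<mu>. sqrt ((u \<mu>)\<^sup>2 + e)) (\<lambda>\<mu> x. (u \<mu> + 0) / sqrt ((u \<mu> + 0)\<^sup>2 + e) * G \<mu> x)"
      using ext_diff_compose[OF G(1) sqrt_deriv(1,2,3)[OF e, where s=0]] by simp
    fix \<mu> assume \<mu>: "\<mu> \<in> B"
    have "sqrt ((u \<mu>)\<^sup>2 + e) \<le> sqrt (C\<^sup>2 + e)" using G(2)[OF \<mu>] abs_le_square_iff[of "u \<mu>" C] by simp
    then show "\<bar>sqrt ((u \<mu>)\<^sup>2 + e)\<bar> \<le> sqrt (C\<^sup>2 + e)" using e by simp
  qed
qed

text \<open>Smoothing of the truncation to [-1, 1], which is (|t + 1| - |t - 1|) / 2.\<close>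

definition smooth_clamp :: "real \<Rightarrow> real \<Rightarrow> real" where
  "smooth_clamp e t = (sqrt ((t + 1)\<^sup>2 + e) - sqrt ((t + - 1)\<^sup>2 + e)) / 2"

lemma half_diff_le:
  fixes a b c d r :: real
  shows "\<bar>a - c\<bar> \<le> r \<Longrightarrow> \<bar>b - d\<bar> \<le> r \<Longrightarrow> \<bar>(a - b) / 2 - (c - d) / 2\<bar> \<le> r"
    "\<bar>a\<bar> \<le> r \<Longrightarrow> \<bar>b\<bar> \<le> r \<Longrightarrow> \<bar>(a - b) / 2\<bar> \<le> r"
  by (simp_all add: abs_le_iff field_simps)

lemma smooth_clamp_lipschitz:
  assumes "0 \<le> e" shows "\<bar>smooth_clamp e s - smooth_clamp e t\<bar> \<le> \<bar>s - t\<bar>" "\<bar>smooth_clamp e t\<bar> \<le> 1"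
proof -
  have c: "\<bar>sqrt ((s + r)\<^sup>2 + e) - sqrt ((t + r)\<^sup>2 + e)\<bar> \<le> \<bar>s - t\<bar>" for r
    using sqrt_sq_add_contraction[OF assms, of "s + r" "t + r"] by simp
  show "\<bar>smooth_clamp e s - smooth_clamp e t\<bar> \<le> \<bar>s - t\<bar>"
    unfolding smooth_clamp_def by (rule half_diff_le(1)[OF c c])
  show "\<bar>smooth_clamp e t\<bar> \<le> 1"
    using sqrt_sq_add_contraction[OF assms, of "t + 1" "t + - 1"] by (simp add: smooth_clamp_def)
qed

lemma smooth_clamp_tendsto: "(\<lambda>n. smooth_clamp (1 / Suc n) t) \<longlonglongrightarrow> max (- 1) (min 1 t)"
proof -
  have "(\<lambda>n. 1 / real (Suc n)) \<longlonglongrightarrow> 0"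
    using LIMSEQ_inverse_real_of_nat by (simp add: inverse_eq_divide)
  then have "(\<lambda>n. smooth_clamp (1 / Suc n) t) \<longlonglongrightarrow> (sqrt ((t + 1)\<^sup>2 + 0) - sqrt ((t + - 1)\<^sup>2 + 0)) / 2"
    unfolding smooth_clamp_def by (intro tendsto_intros) auto
  also have "(sqrt ((t + 1)\<^sup>2 + 0) - sqrt ((t + - 1)\<^sup>2 + 0)) / 2 = max (- 1) (min 1 t)"
    by (auto simp: abs_if max_def min_def)
  finally show ?thesis .
qed

lemma smooth_clamp_ext_class:
  assumes f: "continuous_on UNIV f" "bounded (range f)" and e: "0 < e"
  shows "(\<lambda>\<mu>. smooth_clamp e ((\<integral>x. f x \<partial>\<mu>) - c)) \<in> ext_class B p"
proof (rule ext_classI)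
  have s: "ext_diff B p (\<lambda>\<mu>. (\<integral>x. f x \<partial>\<mu>) - c) (L f)"
    using ext_diff_lin[OF integral_ext_diff[OF f] ext_diff_const[of c], of 1 "-1"] by simp
  show "ext_diff B p (\<lambda>\<mu>. smooth_clamp e ((\<integral>x. f x \<partial>\<mu>) - c))
     (\<lambda>\<mu> x. ((((\<integral>x. f x \<partial>\<mu>) - c + 1) / sqrt (((\<integral>x. f x \<partial>\<mu>) - c + 1)\<^sup>2 + e) - ((\<integral>x. f x \<partial>\<mu>) - c + - 1) / sqrt (((\<integral>x. f x \<partial>\<mu>) - c + - 1)\<^sup>2 + e)) / 2) * L f \<mu> x)"
  proof (rule ext_diff_compose[OF s])
    fix t
    show "(smooth_clamp e has_real_derivative ((t + 1) / sqrt ((t + 1)\<^sup>2 + e) - (t + - 1) / sqrt ((t + - 1)\<^sup>2 + e)) / 2) (at t)"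
      unfolding smooth_clamp_def[abs_def] by (intro DERIV_cdivide DERIV_diff sqrt_deriv e)
    show "\<bar>((t + 1) / sqrt ((t + 1)\<^sup>2 + e) - (t + - 1) / sqrt ((t + - 1)\<^sup>2 + e)) / 2\<bar> \<le> 1"
      by (rule half_diff_le(2)[OF sqrt_deriv(3)[OF e] sqrt_deriv(3)[OF e]])
  next
    show "continuous_on UNIV (\<lambda>t. ((t + 1) / sqrt ((t + 1)\<^sup>2 + e) - (t + - 1) / sqrt ((t + - 1)\<^sup>2 + e)) / 2)"
      by (intro continuous_on_divide[OF continuous_on_diff[OF sqrt_deriv(2)[OF e] sqrt_deriv(2)[OF e]]] continuous_intros) auto
  qed
  show "\<bar>smooth_clamp e ((\<integral>x. f x \<partial>\<mu>) - c)\<bar> \<le> 1" for \<mu>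
    using smooth_clamp_lipschitz(2)[of e] e by simp
qed

end

section \<open>From the core to truncated total variation distances\<close>

locale ac_ext = ac_space lam + ext_paths B p L for lam :: "'a::polish_space measure" and B p L +
  assumes B_fin: "B \<subseteq> fin_measures"
    and ext_lipschitz: "u \<in> ext_class B p \<Longrightarrow> \<exists>C. \<forall>\<gamma>\<in>ac_part lam B. \<forall>\<eta>\<in>ac_part lam B. \<bar>u \<gamma> - u \<eta>\<bar> \<le> C * rho_var lam \<gamma> \<eta>"
    and compl: "Metric_space.mcomplete (ac_part lam B) (rho_var lam)"
begin

abbreviation "S \<equiv> ac_part lam B"

lemma S_ac: "S \<subseteq> ac" using B_fin by (auto simp: ac_part_def)

text \<open>Truncated distances are reached by three passages to the limit, each among functions
  with constant 1: from smoothed to exact truncations of \<integral> f d\<mu> - c, from continuous f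
  to the sign function 2 1_V - 1 of an open set, and from finite suprema over the V n to the
  countable one.\<close>

lemma jump_form_quasi_regular:
  assumes h: "jump_hyps lam S \<Lambda> J"
  shows "closable_form \<Lambda> (ext_class B p) (jump_form J) \<and>
    dirichlet_form \<Lambda> (closure_dom \<Lambda> (ext_class B p) (jump_form J)) (closure_form \<Lambda> (ext_class B p) (jump_form J)) \<and>
    quasi_regular \<Lambda> (var_topology lam S) (closure_dom \<Lambda> (ext_class B p) (jump_form J)) (closure_form \<Lambda> (ext_class B p) (jump_form J))"
proof -
  interpret ms: Metric_space S "rho_var lam" by (rule Metric_space.subspace[OF Metric_space_ac S_ac])
  have vt: "var_topology lam S = ms.mtopology" by (simp add: var_topology_def)
  interpret \<Lambda>: prob_space \<Lambda> using h by (simp add: jump_hyps_def)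
  interpret mj: metric_jump \<Lambda> S "rho_var lam" J "ext_class B p"
  proof
    show "sets \<Lambda> = sets (borel_of ms.mtopology)" using h by (simp add: jump_hyps_def vt)
    show "sets J = sets (borel_of (prod_topology ms.mtopology ms.mtopology))"
      using h by (simp add: jump_hyps_def vt radon_on_def)
    show "null_sets (\<Lambda> \<Otimes>\<^sub>M \<Lambda>) \<subseteq> null_sets J" using h by (simp add: jump_hyps_def)
    show "(\<integral>\<^sup>+p. ennreal (min 1 ((rho_var lam (fst p) (snd p))\<^sup>2)) \<partial>J) < \<infinity>" using h by (simp add: jump_hyps_def)
    fix u assume u: "u \<in> ext_class B p"
    obtain G C where C: "\<And>\<mu>. \<mu> \<in> B \<Longrightarrow> \<bar>u \<mu>\<bar> \<le> C" using ext_classE[OF u] by metis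
    obtain C' where C': "\<And>\<gamma> \<eta>. \<gamma> \<in> S \<Longrightarrow> \<eta> \<in> S \<Longrightarrow> \<bar>u \<gamma> - u \<eta>\<bar> \<le> C' * rho_var lam \<gamma> \<eta>" using ext_lipschitz[OF u] by blast
    have "blip S (rho_var lam) (max C C') u"
      unfolding blip_def
    proof (intro conjI ballI)
      fix \<gamma> assume \<gamma>: "\<gamma> \<in> S"
      show "\<bar>u \<gamma>\<bar> \<le> max C C'" using C[of \<gamma>] \<gamma> by (auto simp: ac_part_def)
      fix \<eta> assume \<eta>: "\<eta> \<in> S"
      have "C' * rho_var lam \<gamma> \<eta> \<le> max C C' * rho_var lam \<gamma> \<eta>" by (intro mult_right_mono) auto
      then show "\<bar>u \<gamma> - u \<eta>\<bar> \<le> max C C' * rho_var lam \<gamma> \<eta>" using C'[OF \<gamma> \<eta>] by simp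
    qed
    then show "\<exists>C. blip S (rho_var lam) C u" by blast
  qed (auto intro: ext_class_lin ext_class_const ext_class_sqrt)
  have cont: "(\<lambda>\<mu>. max (- 1) (min 1 ((\<integral>x. f x \<partial>\<mu>) - c))) \<in> mj.F \<and>
      blip S (rho_var lam) 1 (\<lambda>\<mu>. max (- 1) (min 1 ((\<integral>x. f x \<partial>\<mu>) - c)))"
    if f: "continuous_on UNIV f" "\<And>x. \<bar>f x\<bar> \<le> 1" for f c
  proof -
    have fb: "bounded (range f)" using f(2) by (auto simp: bounded_iff)
    have [measurable]: "f \<in> borel_measurable borel" by (rule borel_measurable_continuous_onI[OF f(1)])
    let ?g = "\<lambda>n \<mu>. smooth_clamp (1 / Suc n) ((\<integral>x. f x \<partial>\<mu>) - c)"
    have 1: "?g n \<in> mj.F" for n by (intro mj.D_subset_F smooth_clamp_ext_class f fb) simp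
    have 2: "blip S (rho_var lam) 1 (?g n)" for n
      unfolding blip_def
    proof (intro conjI ballI)
      show "\<bar>?g n \<gamma>\<bar> \<le> 1" for \<gamma> by (rule smooth_clamp_lipschitz) simp
      fix \<gamma> \<eta> assume "\<gamma> \<in> S" "\<eta> \<in> S"
      then have "\<bar>(\<integral>x. f x \<partial>\<gamma>) - (\<integral>x. f x \<partial>\<eta>)\<bar> \<le> rho_var lam \<gamma> \<eta>"
        using S_ac f(2) by (intro integral_diff_le_rho_var) auto
      then show "\<bar>?g n \<gamma> - ?g n \<eta>\<bar> \<le> 1 * rho_var lam \<gamma> \<eta>"
        using smooth_clamp_lipschitz(1)[of "1 / Suc n" "(\<integral>x. f x \<partial>\<gamma>) - c" "(\<integral>x. f x \<partial>\<eta>) - c"] by simp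
    qed
    from mj.blip_lim[OF 1 2 smooth_clamp_tendsto] show ?thesis by simp
  qed
  have op: "(\<lambda>\<mu>. max (- 1) (min 1 ((\<integral>x. 2 * indicat_real V x - 1 \<partial>\<mu>) - c))) \<in> mj.F \<and>
      blip S (rho_var lam) 1 (\<lambda>\<mu>. max (- 1) (min 1 ((\<integral>x. 2 * indicat_real V x - 1 \<partial>\<mu>) - c)))"
    if V: "open V" for V c
  \<comment> \<open>\<open>infdist\<close> to the empty set is 0, which would give the wrong limit
    for V = UNIV; there the sign function is the continuous constant 1.\<close>
  proof (cases "- V = {}")
    case True
    then have "V = UNIV" by auto
    then show ?thesis using cont[of "\<lambda>_. 1" c] by simp
  next
    case False
    \<comment> \<open>Continuous functions increasing to 2 1_V - 1. Their values stay in [-1, 1], so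
      their integrals are Lipschitz in \<mu> with constant 1.\<close>
    define f where "f n x = 2 * min 1 (real n * infdist x (- V)) - 1" for n x
    have f: "continuous_on UNIV (f n)" "\<bar>f n x\<bar> \<le> 1" for n x
    proof -
      show "continuous_on UNIV (f n)" unfolding f_def by (intro continuous_intros)
      have "0 \<le> real n * infdist x (- V)" by (simp add: infdist_nonneg)
      then have "0 \<le> min 1 (real n * infdist x (- V))" "min 1 (real n * infdist x (- V)) \<le> 1" by auto
      then show "\<bar>f n x\<bar> \<le> 1" unfolding f_def by linarith
    qed
    have flim: "(\<lambda>n. f n x) \<longlonglongrightarrow> 2 * indicat_real V x - 1" for x
    proof (cases "x \<in> V")
      case True
      then have pos: "0 < infdist x (- V)" using V False by (intro infdist_pos_not_in_closed) auto
      obtain N where N: "1 / infdist x (- V) < real N" using reals_Archimedean2 by blast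
      have "f n x = 2 * indicat_real V x - 1" if "n \<ge> N" for n
      proof -
        have "1 / infdist x (- V) \<le> real n" using N that by linarith
        then have "1 \<le> real n * infdist x (- V)" using pos by (simp add: field_simps)
        then show ?thesis using True by (simp add: f_def)
      qed
      then have "\<forall>\<^sub>F n in sequentially. f n x = 2 * indicat_real V x - 1" by (auto simp: eventually_sequentially)
      then show ?thesis by (rule tendsto_eventually)
    next
      case False
      then show ?thesis by (simp add: f_def)
    qed
    have 3: "(\<lambda>n. max (- 1) (min 1 ((\<integral>x. f n x \<partial>\<mu>) - c))) \<longlonglongrightarrow> max (- 1) (min 1 ((\<integral>x. 2 * indicat_real V x - 1 \<partial>\<mu>) - c))"
      if \<mu>: "\<mu> \<in> S" for \<mu>
    proof -
      interpret \<mu>: finite_measure \<mu> using \<mu> S_ac acD by auto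
      have s [measurable_cong]: "sets \<mu> = sets borel" using \<mu> S_ac acD by auto
      have [measurable]: "f n \<in> borel_measurable borel" for n by (rule borel_measurable_continuous_onI[OF f(1)])
      have [measurable]: "V \<in> sets borel" using V by simp
      have "(\<lambda>n. \<integral>x. f n x \<partial>\<mu>) \<longlonglongrightarrow> (\<integral>x. 2 * indicat_real V x - 1 \<partial>\<mu>)"
      proof (rule integral_dominated_convergence[where w="\<lambda>_. 1"])
        show "(\<lambda>x. 2 * indicat_real V x - 1) \<in> borel_measurable \<mu>" by simp
      qed (use f(2) flim in auto)
      then show ?thesis by (intro tendsto_intros)
    qed
    show ?thesis
      using mj.blip_lim[of "\<lambda>n \<mu>. max (- 1) (min 1 ((\<integral>x. f n x \<partial>\<mu>) - c))" 1, OF _ _ 3] cont[OF f] by blast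
  qed
  obtain y :: "nat \<Rightarrow> 'a measure" where y: "\<And>n. y n \<in> S" "\<And>\<mu> e. \<mu> \<in> S \<Longrightarrow> 0 < e \<Longrightarrow> \<exists>n. rho_var lam \<mu> (y n) < e"
    using ac_separable[OF S_ac mj.S_nonempty] by blast
  obtain V :: "nat \<Rightarrow> 'a set" where Vo: "\<And>n. open (V n)"
    and V: "\<And>M A e. sets M = sets borel \<Longrightarrow> finite_measure M \<Longrightarrow> A \<in> sets borel \<Longrightarrow> 0 < e \<Longrightarrow>
        \<exists>n. measure M ((A - V n) \<union> (V n - A)) < e"
    using countable_open_approximation by metis
  have dmin: "(\<lambda>\<mu>. min 1 (rho_var lam \<mu> \<nu>)) \<in> mj.F" if \<nu>: "\<nu> \<in> S" for \<nu>
  proof -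
    define I where "I n \<mu> = (\<integral>x. 2 * indicat_real (V n) x - 1 \<partial>\<mu>)" for n \<mu>
    \<comment> \<open>The negation turns the supremum over n into an infimum, to be approached by
      running minima.\<close>
    define g where "g n \<mu> = - 1 * max (- 1) (min 1 (I n \<mu> - I n \<nu>))" for n \<mu>
    have gF: "g n \<in> mj.F" for n
      unfolding g_def I_def using op[OF Vo[of n]] by (intro mj.F_scale) blast
    have "blip S (rho_var lam) 1 (\<lambda>\<mu>. max (- 1) (min 1 (I n \<mu> - I n \<nu>)))" for n
      unfolding I_def using op[OF Vo[of n]] by blast
    then have gb: "blip S (rho_var lam) 1 (g n)" for n
      unfolding g_def blip_def by (simp add: abs_minus_commute)
    have lim: "(\<lambda>n. run_min (\<lambda>i. g i \<mu>) n) \<longlonglongrightarrow> - min 1 (rho_var lam \<mu> \<nu>)" if \<mu>: "\<mu> \<in> S" for \<mu>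
    proof (rule run_min_tendsto)
      fix i
      have [measurable]: "V i \<in> sets borel" using Vo by simp
      have "\<bar>I i \<mu> - I i \<nu>\<bar> \<le> rho_var lam \<mu> \<nu>"
        unfolding I_def using \<mu> \<nu> S_ac by (intro integral_diff_le_rho_var) (auto simp: indicator_def)
      then show "- min 1 (rho_var lam \<mu> \<nu>) \<le> g i \<mu>" unfolding g_def by (auto simp: min_def max_def)
    next
      fix e :: real assume e: "0 < e"
      obtain i where i: "rho_var lam \<mu> \<nu> - e \<le> I i \<mu> - I i \<nu>"
        unfolding I_def using rho_var_approx[OF Vo V _ _ e, of \<mu> \<nu>] \<mu> \<nu> S_ac by blast
      have "g i \<mu> \<le> - min 1 (rho_var lam \<mu> \<nu>) + e"
        using i e ms.nonneg[of \<mu> \<nu>] unfolding g_def by (auto simp: min_def max_def)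
      then show "\<exists>i. g i \<mu> \<le> - min 1 (rho_var lam \<mu> \<nu>) + e" by blast
    qed
    have "(\<lambda>\<mu>. - min 1 (rho_var lam \<mu> \<nu>)) \<in> mj.F"
      by (rule mj.blip_lim(1)[OF mj.F_run_min[OF gF] mj.blip_run_min[OF gb] lim])
    from mj.F_scale[OF this, of "- 1"] show ?thesis by simp
  qed
  interpret mr: metric_jump_rich \<Lambda> S "rho_var lam" J "ext_class B p" y
    by unfold_locales (use y dmin in auto)
  show ?thesis
    unfolding vt using mr.quasi_regular_dirichlet_form[OF compl] by blast
qed

end

section \<open>Derivatives on finite and on probability measures\<close>

lemma prob_measures_iff: "\<mu> \<in> prob_measures \<longleftrightarrow> \<mu> \<in> fin_measures \<and> measure \<mu> UNIV = 1"
proof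
  assume "\<mu> \<in> prob_measures"
  then have p: "sets \<mu> = sets borel" "prob_space \<mu>" by (auto simp: prob_measures_def)
  then show "\<mu> \<in> fin_measures \<and> measure \<mu> UNIV = 1"
    using prob_space.prob_space[OF p(2)] sets_eq_imp_space_eq[OF p(1)]
    by (simp add: fin_measures_def prob_space.finite_measure)
next
  assume \<mu>: "\<mu> \<in> fin_measures \<and> measure \<mu> UNIV = 1"
  then have "emeasure \<mu> (space \<mu>) = 1"
    using fin_measuresD[of \<mu>] by (simp add: finite_measure.emeasure_eq_measure)
  then show "\<mu> \<in> prob_measures"
    using \<mu> fin_measuresD[of \<mu>] by (auto simp: prob_measures_def intro: prob_spaceI)
qed

text \<open>Affinity is asked on [0, 1] only: for \<epsilon> > 1 the coefficient
  \<open>ennreal (1 - \<epsilon>)\<close> of the convex path is cut off at 0.\<close>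

lemma affine_right_derivative:
  fixes q :: "real \<Rightarrow> real"
  assumes "\<And>\<epsilon>. 0 \<le> \<epsilon> \<Longrightarrow> \<epsilon> \<le> 1 \<Longrightarrow> q \<epsilon> = a + \<epsilon> * b"
  shows "(q has_real_derivative b) (at 0 within {0<..})"
  unfolding has_field_derivative_iff
proof (rule Lim_transform_eventually[OF tendsto_const])
  show "\<forall>\<^sub>F \<epsilon> in at_right 0. b = (q \<epsilon> - q 0) / (\<epsilon> - 0)"
    unfolding eventually_at_right_field by (intro exI[of _ 1]) (auto simp: assms)
qed

lemma ext_paths_fin:
  "ext_paths fin_measures (\<lambda>\<mu> (x::'a::polish_space) \<epsilon>. meas_add \<mu> (scale_measure (ennreal \<epsilon>) (return borel x))) (\<lambda>f \<mu> x. f x)"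
proof
  show "meas_add \<mu> (scale_measure (ennreal 0) (return borel x)) = \<mu>" if "\<mu> \<in> fin_measures" for \<mu> :: "'a measure" and x :: 'a
    by (rule fin_measures_eqI)
       (use that in \<open>auto simp: meas_add_fin scale_measure_fin return_fin simp del: ennreal_0 scale_measure_0\<close>)
next
  fix f :: "'a \<Rightarrow> real" assume f: "continuous_on UNIV f" "bounded (range f)"
  have [measurable]: "f \<in> borel_measurable borel" by (rule borel_measurable_continuous_onI[OF f(1)])
  obtain C where C: "\<And>x. \<bar>f x\<bar> \<le> C" using f(2) by (auto simp: bounded_iff)
  show "ext_diff fin_measures (\<lambda>\<mu> x \<epsilon>. meas_add \<mu> (scale_measure (ennreal \<epsilon>) (return borel x))) (\<lambda>\<mu>. \<integral>x. f x \<partial>\<mu>) (\<lambda>\<mu> x. f x)"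
    unfolding ext_diff_def
  proof (intro conjI ballI allI)
    show "continuous_map (weak_topology fin_measures) euclideanreal (\<lambda>\<mu>. \<integral>x. f x \<partial>\<mu>)"
      by (rule continuous_map_integral[OF f])
    show "continuous_map (prod_topology (weak_topology fin_measures) euclidean) euclideanreal (\<lambda>z. f (snd z))"
      using continuous_map_compose[OF continuous_map_snd, of euclidean euclideanreal f] f(1) by (simp add: comp_def)
    show "\<exists>C. \<forall>\<mu>\<in>fin_measures. \<forall>x. \<bar>f x\<bar> \<le> C" using C by blast
    fix \<mu> :: "'a measure" and x :: 'a assume \<mu>: "\<mu> \<in> fin_measures"
    show "((\<lambda>\<epsilon>. \<integral>x. f x \<partial>meas_add \<mu> (scale_measure (ennreal \<epsilon>) (return borel x))) has_real_derivative f x) (at 0 within {0<..})"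
    proof (rule affine_right_derivative)
      fix \<epsilon> :: real assume "0 \<le> \<epsilon>" "\<epsilon> \<le> 1"
      then show "(\<integral>x. f x \<partial>meas_add \<mu> (scale_measure (ennreal \<epsilon>) (return borel x))) = (\<integral>x. f x \<partial>\<mu>) + \<epsilon> * f x"
        by (simp add: integral_meas_add[OF \<mu> scale_measure_fin(1)[OF return_fin] _ C] integral_scale_measure integral_return)
    qed
  qed
qed

text \<open>Along (1 - \<epsilon>) \<mu> + \<epsilon> \<delta>_x an integral is affine in \<epsilon>
  with slope f x - \<integral> f d\<mu>, the centred version of its derivative f x on finite
  measures.\<close>

lemma ext_paths_prob:
  "ext_paths prob_measures (\<lambda>\<mu> (x::'a::polish_space) \<epsilon>. meas_add (scale_measure (ennreal (1 - \<epsilon>)) \<mu>) (scale_measure (ennreal \<epsilon>) (return borel x)))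
     (\<lambda>f \<mu> x. f x - (\<integral>z. f z \<partial>\<mu>))"
proof
  show "meas_add (scale_measure (ennreal (1 - 0)) \<mu>) (scale_measure (ennreal 0) (return borel x)) = \<mu>" if "\<mu> \<in> prob_measures" for \<mu> :: "'a measure" and x :: 'a
    by (rule fin_measures_eqI)
       (use that in \<open>auto simp: prob_measures_iff meas_add_fin scale_measure_fin return_fin simp del: ennreal_0 scale_measure_0 ennreal_1 scale_measure_1\<close>)
next
  fix f :: "'a \<Rightarrow> real" assume f: "continuous_on UNIV f" "bounded (range f)"
  have [measurable]: "f \<in> borel_measurable borel" by (rule borel_measurable_continuous_onI[OF f(1)])
  obtain C where C: "\<And>x. \<bar>f x\<bar> \<le> C" using f(2) by (auto simp: bounded_iff)
  have intC: "\<bar>\<integral>z. f z \<partial>\<mu>\<bar> \<le> C" if \<mu>: "\<mu> \<in> prob_measures" for \<mu>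
  proof -
    interpret prob_space \<mu> using \<mu> by (simp add: prob_measures_def)
    have [measurable_cong]: "sets \<mu> = sets borel" using \<mu> by (simp add: prob_measures_def)
    have i: "integrable \<mu> f" using C by (intro integrable_const_bound[where B=C]) auto
    have "\<bar>\<integral>z. f z \<partial>\<mu>\<bar> \<le> (\<integral>z. \<bar>f z\<bar> \<partial>\<mu>)" by (rule integral_abs_bound)
    also have "\<dots> \<le> (\<integral>z. C \<partial>\<mu>)" using i C by (intro integral_mono) auto
    finally show ?thesis by (simp add: prob_space)
  qed
  show "ext_diff prob_measures (\<lambda>\<mu> x \<epsilon>. meas_add (scale_measure (ennreal (1 - \<epsilon>)) \<mu>) (scale_measure (ennreal \<epsilon>) (return borel x)))
     (\<lambda>\<mu>. \<integral>x. f x \<partial>\<mu>) (\<lambda>\<mu> x. f x - (\<integral>z. f z \<partial>\<mu>))"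
    unfolding ext_diff_def
  proof (intro conjI ballI allI)
    show c: "continuous_map (weak_topology prob_measures) euclideanreal (\<lambda>\<mu>. \<integral>x. f x \<partial>\<mu>)"
      by (rule continuous_map_integral[OF f])
    show "continuous_map (prod_topology (weak_topology prob_measures) euclidean) euclideanreal (\<lambda>z. f (snd z) - (\<integral>x. f x \<partial>fst z))"
      using continuous_map_compose[OF continuous_map_snd, of euclidean euclideanreal f] f(1)
        continuous_map_compose[OF continuous_map_fst c]
      by (intro continuous_map_diff) (simp_all add: comp_def)
    have "\<bar>f x - (\<integral>z. f z \<partial>\<mu>)\<bar> \<le> 2 * C" if "\<mu> \<in> prob_measures" for \<mu> x
      using C[of x] intC[OF that] by linarith
    then show "\<exists>C. \<forall>\<mu>\<in>prob_measures. \<forall>x. \<bar>f x - (\<integral>z. f z \<partial>\<mu>)\<bar> \<le> C" by blast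
    fix \<mu> :: "'a measure" and x :: 'a assume "\<mu> \<in> prob_measures"
    then have \<mu>: "\<mu> \<in> fin_measures" by (simp add: prob_measures_iff)
    have [measurable_cong]: "sets \<mu> = sets borel" using fin_measuresD[OF \<mu>] by simp
    show "((\<lambda>\<epsilon>. \<integral>x. f x \<partial>meas_add (scale_measure (ennreal (1 - \<epsilon>)) \<mu>) (scale_measure (ennreal \<epsilon>) (return borel x)))
        has_real_derivative f x - (\<integral>z. f z \<partial>\<mu>)) (at 0 within {0<..})"
    proof (rule affine_right_derivative)
      fix \<epsilon> :: real assume "0 \<le> \<epsilon>" "\<epsilon> \<le> 1"
      then show "(\<integral>x. f x \<partial>meas_add (scale_measure (ennreal (1 - \<epsilon>)) \<mu>) (scale_measure (ennreal \<epsilon>) (return borel x)))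
          = (\<integral>x. f x \<partial>\<mu>) + \<epsilon> * (f x - (\<integral>z. f z \<partial>\<mu>))"
        by (simp add: integral_meas_add[OF scale_measure_fin(1)[OF \<mu>] scale_measure_fin(1)[OF return_fin] _ C]
              integral_scale_measure integral_return algebra_simps)
    qed
  qed
qed

text \<open>Extends a function on probability measures, homogeneously of degree 0, to finite
  measures of positive mass, where mass may be added freely.\<close>

definition normalize_measure :: "'a measure \<Rightarrow> 'a measure" where
  "normalize_measure \<mu> = scale_measure (ennreal (1 / measure \<mu> UNIV)) \<mu>"

lemma normalize_prob:
  assumes "\<mu> \<in> fin_measures" "0 < measure \<mu> UNIV"
  shows "normalize_measure \<mu> \<in> prob_measures"
  unfolding normalize_measure_def prob_measures_iff using assms by (simp add: scale_measure_fin)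

lemma normalize_eq:
  assumes "\<mu> \<in> prob_measures" shows "normalize_measure \<mu> = \<mu>"
  using assms unfolding normalize_measure_def prob_measures_iff by simp

text \<open>Adding mass \<epsilon> at x and normalising is a move along the convex path with
  parameter \<epsilon> / (m + \<epsilon>), m being the mass of \<mu>. This links the two notions of
  derivative.\<close>

lemma normalize_add_dirac:
  assumes \<mu>: "\<mu> \<in> fin_measures" "0 < measure \<mu> UNIV" and \<epsilon>: "0 < \<epsilon>"
  shows "normalize_measure (meas_add \<mu> (scale_measure (ennreal \<epsilon>) (return borel x))) =
    meas_add (scale_measure (ennreal (1 - \<epsilon> / (measure \<mu> UNIV + \<epsilon>))) (normalize_measure \<mu>))
      (scale_measure (ennreal (\<epsilon> / (measure \<mu> UNIV + \<epsilon>))) (return borel x))"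
proof (rule fin_measures_eqI)
  let ?m = "measure \<mu> UNIV" and ?\<nu> = "meas_add \<mu> (scale_measure (ennreal \<epsilon>) (return borel x))"
  have \<nu>: "?\<nu> \<in> fin_measures" "measure ?\<nu> A = measure \<mu> A + \<epsilon> * indicat_real A x" if "A \<in> sets borel" for A
    using that \<mu> \<epsilon> by (auto simp: meas_add_fin scale_measure_fin return_fin measure_return_borel)
  have nn: "0 \<le> 1 - \<epsilon> / (?m + \<epsilon>)" "0 \<le> \<epsilon> / (?m + \<epsilon>)" using \<mu>(2) \<epsilon> by (auto simp: field_simps)
  show "normalize_measure ?\<nu> \<in> fin_measures"
    unfolding normalize_measure_def by (intro scale_measure_fin \<nu>[of UNIV]) simp
  show "meas_add (scale_measure (ennreal (1 - \<epsilon> / (?m + \<epsilon>))) (normalize_measure \<mu>))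
      (scale_measure (ennreal (\<epsilon> / (?m + \<epsilon>))) (return borel x)) \<in> fin_measures"
    unfolding normalize_measure_def by (intro meas_add_fin scale_measure_fin return_fin \<mu>)
  fix A :: "'a set" assume A: "A \<in> sets borel"
  have "measure (normalize_measure ?\<nu>) A = 1 / (?m + \<epsilon>) * (measure \<mu> A + \<epsilon> * indicat_real A x)"
    unfolding normalize_measure_def using \<nu>[OF A] \<nu>(2)[of UNIV] \<mu>(2) \<epsilon> by (simp add: scale_measure_fin)
  also have "\<dots> = (1 - \<epsilon> / (?m + \<epsilon>)) * (1 / ?m * measure \<mu> A) + \<epsilon> / (?m + \<epsilon>) * indicat_real A x"
  proof -
    have k: "1 - \<epsilon> / (?m + \<epsilon>) = ?m / (?m + \<epsilon>)" using \<mu>(2) \<epsilon> by (simp add: field_simps)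
    show ?thesis unfolding k using \<mu>(2) by (simp add: add_divide_distrib)
  qed
  also have "\<dots> = measure (meas_add (scale_measure (ennreal (1 - \<epsilon> / (?m + \<epsilon>))) (normalize_measure \<mu>))
      (scale_measure (ennreal (\<epsilon> / (?m + \<epsilon>))) (return borel x))) A"
    unfolding normalize_measure_def using A \<mu> nn
    by (simp add: meas_add_fin(2)[OF scale_measure_fin(1)[OF scale_measure_fin(1)] scale_measure_fin(1)[OF return_fin]]
         scale_measure_fin(2)[OF scale_measure_fin(1)] scale_measure_fin(2) return_fin measure_return_borel del: scale_scale_measure)
  finally show "measure (normalize_measure ?\<nu>) A = measure (meas_add (scale_measure (ennreal (1 - \<epsilon> / (?m + \<epsilon>))) (normalize_measure \<mu>))
      (scale_measure (ennreal (\<epsilon> / (?m + \<epsilon>))) (return borel x))) A" .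
qed

text \<open>By reparametrisation of the path, the derivative at \<mu> is the one of u at the
  normalised measure divided by the mass of \<mu>, hence at most 2 C in modulus when the mass is at
  least 1/2.\<close>

lemma dirac_lipschitz_normalize:
  assumes u: "u \<in> CE1b_P"
  obtains C where "dirac_lipschitz (\<lambda>\<mu>. u (normalize_measure \<mu>)) (1 / 2) (2 * C)" "0 \<le> C"
    "\<And>\<mu>. \<mu> \<in> prob_measures \<Longrightarrow> \<bar>u \<mu>\<bar> \<le> C"
proof -
  interpret ext_paths prob_measures
    "\<lambda>\<mu> x \<epsilon>. meas_add (scale_measure (ennreal (1 - \<epsilon>)) \<mu>) (scale_measure (ennreal \<epsilon>) (return borel x))"
    "\<lambda>f \<mu> x. f x - (\<integral>z. f z \<partial>\<mu>)" by (rule ext_paths_prob)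
  obtain G C where G: "ext_diff prob_measures (\<lambda>\<mu> x \<epsilon>. meas_add (scale_measure (ennreal (1 - \<epsilon>)) \<mu>) (scale_measure (ennreal \<epsilon>) (return borel x))) u G"
    and Cu: "\<And>\<mu>. \<mu> \<in> prob_measures \<Longrightarrow> \<bar>u \<mu>\<bar> \<le> C" and CG: "\<And>\<mu> x. \<mu> \<in> prob_measures \<Longrightarrow> \<bar>G \<mu> x\<bar> \<le> C"
    using ext_classE[OF u[unfolded CE1b_P_eq]] by blast
  have cu: "continuous_map (weak_topology prob_measures) euclideanreal u" using G by (simp add: ext_diff_def)
  have "return borel undefined \<in> (prob_measures :: 'a measure set)"
    by (simp add: prob_measures_def prob_space_return)
  then have C0: "0 \<le> C" using Cu abs_ge_zero order_trans by blast
  have "dirac_lipschitz (\<lambda>\<mu>. u (normalize_measure \<mu>)) (1 / 2) (2 * C)"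
  proof
    fix \<sigma> and \<mu> :: "'a measure"
    assume \<sigma>: "\<And>n. \<sigma> n \<in> fin_measures" "\<And>n. 1 / 2 \<le> measure (\<sigma> n) UNIV"
      and \<mu>: "\<mu> \<in> fin_measures" "1 / 2 \<le> measure \<mu> UNIV" and w: "weak_conv \<sigma> \<mu>"
    have m: "(\<integral>x. (1::real) \<partial>\<nu>) = measure \<nu> UNIV" if "\<nu> \<in> fin_measures" for \<nu> :: "'a measure"
      using fin_measuresD[OF that] by simp
    \<comment> \<open>The constant 1 as test function turns weak convergence into convergence of the
      masses.\<close>
    have "(\<lambda>n. \<integral>x. (1::real) \<partial>\<sigma> n) \<longlonglongrightarrow> (\<integral>x. 1 \<partial>\<mu>)"
      by (rule w[unfolded weak_conv_def, rule_format]) auto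
    then have mass: "(\<lambda>n. measure (\<sigma> n) UNIV) \<longlonglongrightarrow> measure \<mu> UNIV" by (simp only: m \<sigma> \<mu>)
    show "(\<lambda>n. u (normalize_measure (\<sigma> n))) \<longlonglongrightarrow> u (normalize_measure \<mu>)"
    proof (rule weak_conv_continuous[OF _ _ _ cu])
      show "normalize_measure (\<sigma> n) \<in> prob_measures" for n using \<sigma>(1,2)[of n] by (intro normalize_prob) auto
      show "normalize_measure \<mu> \<in> prob_measures" using \<mu> by (intro normalize_prob) auto
      show "weak_conv (\<lambda>n. normalize_measure (\<sigma> n)) (normalize_measure \<mu>)"
        unfolding weak_conv_def
      proof (intro allI impI)
        fix f :: "'a \<Rightarrow> real" assume f: "continuous_on UNIV f \<and> bounded (range f)"
        then have fm: "f \<in> borel_measurable borel" by (intro borel_measurable_continuous_onI) auto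
        have int: "(\<integral>x. f x \<partial>normalize_measure \<nu>) = 1 / measure \<nu> UNIV * (\<integral>x. f x \<partial>\<nu>)" if "\<nu> \<in> fin_measures" for \<nu>
          unfolding normalize_measure_def
          by (rule integral_scale_measure) (use fm measurable_cong_sets[OF fin_measuresD(1)[OF that] refl] in auto)
        have "(\<lambda>n. 1 / measure (\<sigma> n) UNIV * (\<integral>x. f x \<partial>\<sigma> n)) \<longlonglongrightarrow> 1 / measure \<mu> UNIV * (\<integral>x. f x \<partial>\<mu>)"
          using f w \<mu>(2) by (intro tendsto_intros mass) (auto simp: weak_conv_def)
        then show "(\<lambda>n. \<integral>x. f x \<partial>normalize_measure (\<sigma> n)) \<longlonglongrightarrow> (\<integral>x. f x \<partial>normalize_measure \<mu>)"
          by (simp only: int \<sigma> \<mu>)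
      qed
    qed
  next
    fix \<mu> :: "'a measure" and x :: 'a assume \<mu>: "\<mu> \<in> fin_measures" "1 / 2 \<le> measure \<mu> UNIV"
    let ?m = "measure \<mu> UNIV" and ?N = "normalize_measure \<mu>"
    have N: "?N \<in> prob_measures" using \<mu> by (intro normalize_prob) auto
    define t where "t \<epsilon> = \<epsilon> / (?m + \<epsilon>)" for \<epsilon>
    have q: "((\<lambda>\<epsilon>. (u (meas_add (scale_measure (ennreal (1 - \<epsilon>)) ?N) (scale_measure (ennreal \<epsilon>) (return borel x))) - u ?N) / \<epsilon>) \<longlongrightarrow> G ?N x) (at_right 0)"
      using G N by (simp add: ext_diff_def quot_iff)
    have t: "filterlim t (at_right 0) (at_right 0)"
    proof -
      have "(t \<longlongrightarrow> 0 / (?m + 0)) (at_right 0)"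
        unfolding t_def using \<mu>(2) by (intro tendsto_intros) auto
      moreover have "\<forall>\<^sub>F \<epsilon> in at_right 0. t \<epsilon> \<in> {0<..}"
        unfolding eventually_at_right_field t_def using \<mu>(2) by (intro exI[of _ 1]) auto
      ultimately show ?thesis by (simp add: filterlim_at) (auto elim: eventually_mono)
    qed
    \<comment> \<open>The difference quotient in \<epsilon> is the quotient in t \<epsilon> times t
      \<epsilon> / \<epsilon> = 1 / (m + \<epsilon>).\<close>
    have "((\<lambda>\<epsilon>. (u (meas_add (scale_measure (ennreal (1 - t \<epsilon>)) ?N) (scale_measure (ennreal (t \<epsilon>)) (return borel x))) - u ?N) / t \<epsilon> * (1 / (?m + \<epsilon>)))
        \<longlongrightarrow> G ?N x * (1 / (?m + 0))) (at_right 0)"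
      using \<mu>(2) by (intro tendsto_mult filterlim_compose[OF q t] tendsto_intros) auto
    then have "((\<lambda>\<epsilon>. (u (normalize_measure (meas_add \<mu> (scale_measure (ennreal \<epsilon>) (return borel x)))) - u ?N) / \<epsilon>) \<longlongrightarrow> G ?N x * (1 / (?m + 0))) (at_right 0)"
    proof (rule Lim_transform_eventually)
      have pos: "0 < ?m" using \<mu>(2) by simp
      have "(u (meas_add (scale_measure (ennreal (1 - t \<epsilon>)) ?N) (scale_measure (ennreal (t \<epsilon>)) (return borel x))) - u ?N) / t \<epsilon> * (1 / (?m + \<epsilon>)) =
          (u (normalize_measure (meas_add \<mu> (scale_measure (ennreal \<epsilon>) (return borel x)))) - u ?N) / \<epsilon>" if \<epsilon>: "0 < \<epsilon>" for \<epsilon>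
        unfolding normalize_add_dirac[OF \<mu>(1) pos \<epsilon>] t_def using pos \<epsilon> by simp
      then show "\<forall>\<^sub>F \<epsilon> in at_right 0. (u (meas_add (scale_measure (ennreal (1 - t \<epsilon>)) ?N) (scale_measure (ennreal (t \<epsilon>)) (return borel x))) - u ?N) / t \<epsilon> * (1 / (?m + \<epsilon>)) =
          (u (normalize_measure (meas_add \<mu> (scale_measure (ennreal \<epsilon>) (return borel x)))) - u ?N) / \<epsilon>"
        unfolding eventually_at_right_field by (intro exI[of _ 1]) auto
    qed
    moreover have "\<bar>G ?N x * (1 / (?m + 0))\<bar> \<le> 2 * C"
    proof -
      have "\<bar>G ?N x\<bar> * (1 / ?m) \<le> C * 2"
        using CG[OF N, of x] \<mu>(2) C0 by (intro mult_mono) (auto simp: field_simps)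
      then show ?thesis using \<mu>(2) by (simp add: abs_mult)
    qed
    ultimately show "\<exists>D. \<bar>D\<bar> \<le> 2 * C \<and> ((\<lambda>\<epsilon>. (u (normalize_measure (meas_add \<mu> (scale_measure (ennreal \<epsilon>) (return borel x)))) - u ?N) / \<epsilon>) \<longlongrightarrow> D) (at_right 0)"
      by blast
  qed
  then show ?thesis using C0 Cu by (rule that)
qed

context ac_space
begin

lemma CE1b_M_lipschitz:
  assumes u: "u \<in> CE1b_M"
  shows "\<exists>C. \<forall>\<gamma>\<in>ac. \<forall>\<eta>\<in>ac. \<bar>u \<gamma> - u \<eta>\<bar> \<le> C * rho_var lam \<gamma> \<eta>"
proof -
  interpret ext_paths fin_measures "\<lambda>\<mu> (x::'a) \<epsilon>. meas_add \<mu> (scale_measure (ennreal \<epsilon>) (return borel x))" "\<lambda>f \<mu> x. f x"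
    by (rule ext_paths_fin)
  obtain G C where G: "ext_diff fin_measures (\<lambda>\<mu> x \<epsilon>. meas_add \<mu> (scale_measure (ennreal \<epsilon>) (return borel x))) u G"
    and Cu: "\<And>\<mu>. \<mu> \<in> fin_measures \<Longrightarrow> \<bar>u \<mu>\<bar> \<le> C" and CG: "\<And>\<mu> x. \<mu> \<in> fin_measures \<Longrightarrow> \<bar>G \<mu> x\<bar> \<le> C"
    using ext_classE[OF u[unfolded CE1b_M_eq]] by blast
  interpret dirac_lipschitz u 0 C
  proof
    show "(\<lambda>n. u (\<sigma> n)) \<longlonglongrightarrow> u \<mu>" if "\<And>n. \<sigma> n \<in> fin_measures" "\<mu> \<in> fin_measures" "weak_conv \<sigma> \<mu>" for \<sigma> \<mu>
      using weak_conv_continuous[of \<sigma> fin_measures \<mu> u] that G by (simp add: ext_diff_def)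
    show "\<exists>D. \<bar>D\<bar> \<le> C \<and> ((\<lambda>\<epsilon>. (u (meas_add \<mu> (scale_measure (ennreal \<epsilon>) (return borel x))) - u \<mu>) / \<epsilon>) \<longlongrightarrow> D) (at_right 0)"
      if "\<mu> \<in> fin_measures" for \<mu> x
    proof (intro exI[of _ "G \<mu> x"] conjI CG[OF that])
      have "((\<lambda>\<epsilon>. u (meas_add \<mu> (scale_measure (ennreal \<epsilon>) (return borel x)))) has_real_derivative G \<mu> x) (at 0 within {0<..})"
        using G that unfolding ext_diff_def by blast
      then show "((\<lambda>\<epsilon>. (u (meas_add \<mu> (scale_measure (ennreal \<epsilon>) (return borel x))) - u \<mu>) / \<epsilon>) \<longlongrightarrow> G \<mu> x) (at_right 0)"
        by (simp only: quot_iff[OF that])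
    qed
  qed
  have "\<bar>u \<gamma> - u \<eta>\<bar> \<le> C * rho_var lam \<gamma> \<eta>" if \<gamma>: "\<gamma> \<in> ac" and \<eta>: "\<eta> \<in> ac" for \<gamma> \<eta>
  proof (rule common_part[OF \<gamma> \<eta>])
    fix \<kappa> \<alpha> \<beta> assume \<kappa>: "\<kappa> \<in> fin_measures" and \<alpha>: "\<alpha> \<in> fin_measures" and \<beta>: "\<beta> \<in> fin_measures"
      and eq: "\<gamma> = meas_add \<kappa> \<alpha>" "\<eta> = meas_add \<kappa> \<beta>" and rho: "measure \<alpha> UNIV + measure \<beta> UNIV = rho_var lam \<gamma> \<eta>"
    have "\<bar>u \<gamma> - u \<kappa>\<bar> \<le> C * measure \<alpha> UNIV" "\<bar>u \<eta> - u \<kappa>\<bar> \<le> C * measure \<beta> UNIV"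
      unfolding eq by (intro add_bound \<kappa> \<alpha> \<beta>; simp)+
    then have "\<bar>u \<gamma> - u \<eta>\<bar> \<le> C * measure \<alpha> UNIV + C * measure \<beta> UNIV" by linarith
    then show ?thesis by (simp only: rho flip: distrib_left)
  qed
  then show ?thesis by blast
qed

text \<open>The common part has mass 1 - \<rho>/2. For \<rho> \<le> 1 this is at least 1/2 and the
  increment bounds start from it; for \<rho> > 1 the oscillation bound 2 C is already below 2 C
  \<rho>.\<close>

lemma CE1b_P_lipschitz:
  assumes u: "u \<in> CE1b_P"
  shows "\<exists>C. \<forall>\<gamma>\<in>ac_part lam prob_measures. \<forall>\<eta>\<in>ac_part lam prob_measures. \<bar>u \<gamma> - u \<eta>\<bar> \<le> C * rho_var lam \<gamma> \<eta>"
proof -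
  obtain C where dl: "dirac_lipschitz (\<lambda>\<mu>. u (normalize_measure \<mu>)) (1 / 2) (2 * C)" and C0: "0 \<le> C"
    and Cu: "\<And>\<mu>. \<mu> \<in> prob_measures \<Longrightarrow> \<bar>u \<mu>\<bar> \<le> C"
    using dirac_lipschitz_normalize[OF u] by blast
  interpret dirac_lipschitz "\<lambda>\<mu>. u (normalize_measure \<mu>)" "1 / 2" "2 * C" by (rule dl)
  have "\<bar>u \<gamma> - u \<eta>\<bar> \<le> 2 * C * rho_var lam \<gamma> \<eta>"
    if \<gamma>: "\<gamma> \<in> ac_part lam prob_measures" and \<eta>: "\<eta> \<in> ac_part lam prob_measures" for \<gamma> \<eta>
  proof -
    have p: "\<gamma> \<in> prob_measures" "\<eta> \<in> prob_measures" using \<gamma> \<eta> by (auto simp: ac_part_def)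
    have a: "\<gamma> \<in> ac" "\<eta> \<in> ac" using \<gamma> \<eta> by (auto simp: ac_part_def prob_measures_iff)
    show ?thesis
    proof (rule common_part[OF a])
      fix \<kappa> \<alpha> \<beta> assume \<kappa>: "\<kappa> \<in> fin_measures" and \<alpha>: "\<alpha> \<in> fin_measures" and \<beta>: "\<beta> \<in> fin_measures"
        and eq: "\<gamma> = meas_add \<kappa> \<alpha>" "\<eta> = meas_add \<kappa> \<beta>" and rho: "measure \<alpha> UNIV + measure \<beta> UNIV = rho_var lam \<gamma> \<eta>"
      have 1: "measure \<kappa> UNIV + measure \<alpha> UNIV = 1" "measure \<kappa> UNIV + measure \<beta> UNIV = 1"
        using p meas_add_fin(2)[OF \<kappa> \<alpha>, of UNIV] meas_add_fin(2)[OF \<kappa> \<beta>, of UNIV]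
        unfolding eq prob_measures_iff by auto
      show ?thesis
      proof (cases "rho_var lam \<gamma> \<eta> \<le> 1")
        case True
        then have m: "1 / 2 \<le> measure \<kappa> UNIV" using 1 rho by linarith
        have "\<bar>u \<gamma> - u (normalize_measure \<kappa>)\<bar> \<le> 2 * C * measure \<alpha> UNIV"
          "\<bar>u \<eta> - u (normalize_measure \<kappa>)\<bar> \<le> 2 * C * measure \<beta> UNIV"
          using add_bound[OF \<kappa> m \<alpha>] add_bound[OF \<kappa> m \<beta>] by (simp_all flip: eq add: normalize_eq p)
        then have "\<bar>u \<gamma> - u \<eta>\<bar> \<le> 2 * C * measure \<alpha> UNIV + 2 * C * measure \<beta> UNIV" by linarith
        then show ?thesis by (simp only: rho flip: distrib_left)
      next
        case False
        then have "2 * C * 1 \<le> 2 * C * rho_var lam \<gamma> \<eta>" using C0 by (intro mult_left_mono) auto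
        then show ?thesis using Cu[OF p(1)] Cu[OF p(2)] by linarith
      qed
    qed
  qed
  then show ?thesis by blast
qed

lemma ac_ext_fin:
  "ac_ext lam fin_measures (\<lambda>\<mu> (x::'a) \<epsilon>. meas_add \<mu> (scale_measure (ennreal \<epsilon>) (return borel x))) (\<lambda>f \<mu> x. f x)"
proof (intro ac_ext.intro ac_space_axioms ext_paths_fin ac_ext_axioms.intro)
  show "Metric_space.mcomplete ac (rho_var lam)" by (rule mcomplete_ac) auto
qed (simp_all only: order_refl CE1b_M_lipschitz flip: CE1b_M_eq)

lemma ac_ext_prob:
  "ac_ext lam prob_measures (\<lambda>\<mu> (x::'a) \<epsilon>. meas_add (scale_measure (ennreal (1 - \<epsilon>)) \<mu>) (scale_measure (ennreal \<epsilon>) (return borel x)))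
     (\<lambda>f \<mu> x. f x - (\<integral>z. f z \<partial>\<mu>))"
proof (intro ac_ext.intro ac_space_axioms ext_paths_prob ac_ext_axioms.intro)
  show "(prob_measures :: 'a measure set) \<subseteq> fin_measures" by (auto simp: prob_measures_iff)
  show "Metric_space.mcomplete (ac_part lam prob_measures) (rho_var lam)"
  proof (rule mcomplete_ac)
    show sub: "ac_part lam prob_measures \<subseteq> ac" by (auto simp: ac_part_def prob_measures_iff)
    fix \<sigma> \<mu> assume \<sigma>: "\<And>n::nat. \<sigma> n \<in> ac_part lam prob_measures" and \<mu>: "\<mu> \<in> ac"
      and lim: "(\<lambda>n. rho_var lam (\<sigma> n) \<mu>) \<longlonglongrightarrow> 0"
    \<comment> \<open>The mass is the integral of the constant 1, hence Lipschitz in total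
      variation, so mass 1 is kept in the limit.\<close>
    have "\<bar>1 - measure \<mu> UNIV\<bar> \<le> rho_var lam (\<sigma> n) \<mu>" for n
    proof -
      have s: "\<sigma> n \<in> ac" using \<sigma> sub by blast
      have "measure (\<sigma> n) UNIV = 1" using \<sigma>[of n] by (simp add: ac_part_def prob_measures_iff)
      then show ?thesis
        using integral_diff_le_rho_var[OF s \<mu>, of "\<lambda>_. 1"] acD(4)[OF s] acD(4)[OF \<mu>] by simp
    qed
    then have "\<bar>1 - measure \<mu> UNIV\<bar> \<le> 0" by (intro LIMSEQ_le_const[OF lim]) auto
    then show "\<mu> \<in> ac_part lam prob_measures" using \<mu> by (simp add: ac_part_def prob_measures_iff)
  qed
qed (simp only: CE1b_P_lipschitz flip: CE1b_P_eq)

end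

theorem theorem3p1:
  fixes lam :: "'a::polish_space measure"
  assumes "sigma_finite_measure lam"
    and "radon_on euclidean lam"
    and "emeasure lam (space lam) \<noteq> 0"
  shows
   "(\<forall>\<Lambda> J. jump_hyps lam (ac_part lam fin_measures) \<Lambda> J \<longrightarrow>
       closable_form \<Lambda> CE1b_M (jump_form J) \<and>
       dirichlet_form \<Lambda> (closure_dom \<Lambda> CE1b_M (jump_form J))
                        (closure_form \<Lambda> CE1b_M (jump_form J)) \<and>
       quasi_regular \<Lambda> (var_topology lam (ac_part lam fin_measures))
                        (closure_dom \<Lambda> CE1b_M (jump_form J))
                        (closure_form \<Lambda> CE1b_M (jump_form J))) \<and>
    (\<forall>\<Lambda> J. jump_hyps lam (ac_part lam prob_measures) \<Lambda> J \<longrightarrow>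
       closable_form \<Lambda> CE1b_P (jump_form J) \<and>
       dirichlet_form \<Lambda> (closure_dom \<Lambda> CE1b_P (jump_form J))
                        (closure_form \<Lambda> CE1b_P (jump_form J)) \<and>
       quasi_regular \<Lambda> (var_topology lam (ac_part lam prob_measures))
                        (closure_dom \<Lambda> CE1b_P (jump_form J))
                        (closure_form \<Lambda> CE1b_P (jump_form J)))"
proof -
  \<comment> \<open>The Radon hypothesis identifies the \<sigma>-algebra of \<open>lam\<close> with
    the Borel sets.\<close>
  have "sets lam = sets borel" using assms(2) by (simp add: radon_on_def sets_borel_of_euclidean)
  then interpret ac_space lam using assms(1) by (intro ac_space.intro ac_space_axioms.intro)
  show ?thesis
    unfolding CE1b_M_eq CE1b_P_eq
    using ac_ext.jump_form_quasi_regular[OF ac_ext_fin] ac_ext.jump_form_quasi_regular[OF ac_ext_prob]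
    by blast
qed

end
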